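(* If $f$ is a doubly concave function on an interval $\Omega\subset[0,\infty)$ and $A,B\in\mathbb{M}_n\{\Omega\}$, then $$\|f(A\,\sigma\,B)\|_!\ge\|f(A)\|_!\,\sigma\,\|f(B)\|_!$$ for all derived anti-norms $\|\cdot\|_!$ on $\mathbb{M}_n^+$ and all geodesic means $\sigma$.
   Context: $\mathbb{M}_n$ is the algebra of $n\times n$ complex matrices, $\mathbb{M}_n\{\Omega\}$ the set of Hermitian matrices with spectrum in $\Omega$, $\mathbb{M}_n^+=\mathbb{M}_n\{[0,\infty)\}$. A function $f$ on $\Omega$ is doubly concave if it is non-negative, continuous, concave, and geometrically concave, i.e. $f(\sqrt{xy})\ge\sqrt{f(x)f(y)}$ for all $x,y\in\Omega$. A derived anti-norm is a functional on $\mathbb{M}_n^+$ of the form $\|A\|_!=\|A^{-p}\|^{-1/p}$ if $A$ is invertible and $\|A\|_!=0$ otherwise, for some symmetric (i.e. unitarily invariant) norm $\|\cdot\|$ on $\mathbb{M}_n$ and some $p>0$. For $\alpha\in[0,1]$ and invertible $A,B\in\mathbb{M}_n^+$, $A\,\#_\alpha\,B:=A^{1/2}(A^{-1/2}BA^{-1/2})^\alpha A^{1/2}$; for general $A,B\in\mathbb{M}_n^+$, $A\,\#_\alpha\,B:=\lim_{\varepsilon\searrow0}(A+\varepsilon I)\,\#_\alpha\,(B+\varepsilon I)$. A geodesic mean is an operator mean $\sigma$ of the form $A\,\sigma\,B=\int_0^1A\,\#_\alpha\,B\,d\nu(\alpha)$ for some probability measure $\nu$ on $[0,1]$. For scalars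 $a,b\ge0$, $a\,\sigma\,b$ is the case $n=1$, i.e. $a\,\sigma\,b=\int_0^1a^{1-\alpha}b^\alpha\,d\nu(\alpha)$ with the convention $0^0=1$. *)

theory Defs
  imports "HOL-Probability.Probability"
begin

definition ctranspose :: "complex^'n^'m \<Rightarrow> complex^'m^'n"
  where "ctranspose A = map_matrix cnj (transpose A)"

definition hermitian :: "complex^'n^'n \<Rightarrow> bool"
  where "hermitian A \<longleftrightarrow> ctranspose A = A"

definition unitary :: "complex^'n^'n \<Rightarrow> bool"
  where "unitary U \<longleftrightarrow> ctranspose U ** U = mat 1 \<and> U ** ctranspose U = mat 1"

definition spectrum :: "complex^'n^'n \<Rightarrow> complex set"
  where "spectrum A = {z. \<not> invertible (mat z - A)}"

definition herm_on :: "real set \<Rightarrow> (complex^'n^'n) set"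
  where "herm_on \<Omega> = {A. hermitian A \<and> spectrum A \<subseteq> complex_of_real ` \<Omega>}"

definition psd :: "(complex^'n^'n) set"
  where "psd = herm_on {0..}"

definition real_diag :: "('n \<Rightarrow> real) \<Rightarrow> complex^'n^'n"
  where "real_diag l = (\<chi> i j. if i = j then complex_of_real (l i) else 0)"

text \<open>Functional calculus. For Hermitian \<open>A\<close> the matrix described below exists and does not depend
  on the unitary diagonalisation \<open>U\<close>, \<open>l\<close>; only the values of \<open>f\<close> on the spectrum of \<open>A\<close> matter.\<close>

definition mat_fun :: "(real \<Rightarrow> real) \<Rightarrow> complex^'n^'n \<Rightarrow> complex^'n^'n"
  where "mat_fun f A = (THE B. \<exists>U l. unitary U \<and> A = U ** real_diag l ** ctranspose U \<and>
                                     B = U ** real_diag (\<lambda>i. f (l i)) ** ctranspose U)"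

text \<open>Real powers, applied below to positive definite matrices only.\<close>

definition mat_powr :: "complex^'n^'n \<Rightarrow> real \<Rightarrow> complex^'n^'n"
  where "mat_powr A t = mat_fun (\<lambda>x. x powr t) A"

definition doubly_concave_on :: "real set \<Rightarrow> (real \<Rightarrow> real) \<Rightarrow> bool"
  where "doubly_concave_on \<Omega> f \<longleftrightarrow>
    (\<forall>x\<in>\<Omega>. 0 \<le> f x) \<and> continuous_on \<Omega> f \<and> concave_on \<Omega> f \<and>
    (\<forall>x\<in>\<Omega>. \<forall>y\<in>\<Omega>. f (sqrt (x * y)) \<ge> sqrt (f x * f y))"

definition symmetric_norm :: "(complex^'n^'n \<Rightarrow> real) \<Rightarrow> bool"
  where "symmetric_norm N \<longleftrightarrow>
    (\<forall>A. 0 \<le> N A) \<and> (\<forall>A. N A = 0 \<longleftrightarrow> A = 0) \<and>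
    (\<forall>c A. N (map_matrix ((*) c) A) = cmod c * N A) \<and>
    (\<forall>A B. N (A + B) \<le> N A + N B) \<and>
    (\<forall>A U V. unitary U \<longrightarrow> unitary V \<longrightarrow> N (U ** A ** V) = N A)"

text \<open>A functional on \<open>psd\<close> is a total function whose values outside \<open>psd\<close> are irrelevant.\<close>

definition derived_anti_norm :: "(complex^'n^'n \<Rightarrow> real) \<Rightarrow> bool"
  where "derived_anti_norm F \<longleftrightarrow>
    (\<exists>N p. symmetric_norm N \<and> p > 0 \<and>
      (\<forall>A\<in>psd. F A = (if invertible A then N (mat_powr A (-p)) powr (-1/p) else 0)))"

definition geo_mean_inv :: "real \<Rightarrow> complex^'n^'n \<Rightarrow> complex^'n^'n \<Rightarrow> complex^'n^'n"
  where "geo_mean_inv \<alpha> A B =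
    mat_powr A (1/2) ** mat_powr (mat_powr A (-1/2) ** B ** mat_powr A (-1/2)) \<alpha> ** mat_powr A (1/2)"

definition geo_mean :: "real \<Rightarrow> complex^'n^'n \<Rightarrow> complex^'n^'n \<Rightarrow> complex^'n^'n"
  where "geo_mean \<alpha> A B =
    (if invertible A \<and> invertible B then geo_mean_inv \<alpha> A B
     else Lim (at_right 0) (\<lambda>\<epsilon>::real. geo_mean_inv \<alpha> (A + mat (of_real \<epsilon>)) (B + mat (of_real \<epsilon>))))"

text \<open>A geodesic mean is determined by a Borel probability measure \<open>\<nu>\<close> on \<open>[0,1]\<close>.\<close>

definition prob_on_unit :: "real measure \<Rightarrow> bool"
  where "prob_on_unit \<nu> \<longleftrightarrow> prob_space \<nu> \<and> sets \<nu> = sets (restrict_space borel {0..1})"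

definition geodesic_mean :: "real measure \<Rightarrow> complex^'n^'n \<Rightarrow> complex^'n^'n \<Rightarrow> complex^'n^'n"
  where "geodesic_mean \<nu> A B = (\<integral>\<alpha>. geo_mean \<alpha> A B \<partial>\<nu>)"

text \<open>The library has \<open>0 powr 0 = 0\<close>; the scalar mean needs \<open>0\<^sup>0 = 1\<close>.\<close>

definition powr1 :: "real \<Rightarrow> real \<Rightarrow> real"
  where "powr1 x t = (if t = 0 then 1 else x powr t)"

definition scalar_geodesic_mean :: "real measure \<Rightarrow> real \<Rightarrow> real \<Rightarrow> real"
  where "scalar_geodesic_mean \<nu> a b = (\<integral>\<alpha>. powr1 a (1 - \<alpha>) * powr1 b \<alpha> \<partial>\<nu>)"

end

theory Submission
  imports Defs
begin

text \<open>
  Write \<open>Z \<alpha>\<close> for the geometric mean of \<open>A\<close> and \<open>B\<close> with weight \<open>\<alpha>\<close> and \<open>X\<close> for its integral over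
  \<open>\<nu>\<close>. The proof combines an inequality for each \<open>Z \<alpha>\<close> with the superadditivity of the anti-norm
  and the concavity of \<open>f\<close>.

  For a single \<open>\<alpha>\<close>, the anti-norm of \<open>f (Z \<alpha>)\<close> is at least the weighted geometric mean of those
  of \<open>f A\<close> and \<open>f B\<close>. The reason is a log-majorisation. Let \<open>a\<close>, \<open>b\<close>, \<open>z\<close> be the eigenvalues of
  \<open>A\<close>, \<open>B\<close>, \<open>Z \<alpha>\<close>. The vector \<open>ln z\<close> lies in the convex hull of the vectors
  \<open>(1 - \<alpha>) ln a + \<alpha> ln b\<close>, where \<open>a\<close> and \<open>b\<close> may be permuted independently
  (\<open>ln_eigenvalues_geo_mean_convex_hull\<close>). Instead of antisymmetric tensor powers, the proof
  truncates the spectra of \<open>A\<close> and \<open>B\<close> from above: the mean decreases because it is monotone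
  (\<open>geo_mean_inv_mono\<close>), its determinant is multiplicative, and Hadamard's inequality in the
  eigenbasis of \<open>Z \<alpha>\<close> compares that determinant with the truncated \<open>z\<close>. Monotonicity follows
  from writing \<open>t powr \<alpha>\<close> as a mixture of the functions \<open>t / (s + t)\<close>, whose quadratic forms
  are infima of monotone expressions. Geometric concavity makes \<open>f (exp t) powr (-p)\<close> convex, so
  that a norming functional, the hull and Hoelder's inequality give the claim
  (\<open>anti_geometric_mean\<close>).

  To integrate over \<open>\<alpha>\<close>, the anti-norm is linearised at \<open>X\<close>. It has a supergradient at every
  positive vector (\<open>anti_supergradient\<close>), obtained from a norming functional of the symmetric norm
  and the convexity of \<open>x powr (-p)\<close>; this is its superadditivity. Likewise \<open>f\<close> has, up to an
  arbitrarily small error, an affine majorant that touches it at each eigenvalue of \<open>X\<close>. The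
  anti-norm of \<open>f X\<close> is then, up to that error, the integral of an affine functional of \<open>Z \<alpha>\<close>
  which dominates the anti-norm of \<open>f (Z \<alpha>)\<close>.

  Singular \<open>A\<close> and \<open>B\<close> are reached by the limit in the definition of the mean. The affine
  functional is continuous, which makes the passage to the limit possible without continuity of the
  functional calculus.
\<close>

section \<open>Matrices acting on the real inner product space of complex vectors\<close>

lemma ctranspose_nth [simp]: "ctranspose A $ i $ j = cnj (A $ j $ i)"
  by (simp add: ctranspose_def transpose_def)

lemma ctranspose_ctranspose [simp]: "ctranspose (ctranspose A) = A"
  by (simp add: vec_eq_iff)

lemma ctranspose_mult: "ctranspose (A ** B) = ctranspose B ** ctranspose A"
  by (simp add: vec_eq_iff matrix_matrix_mult_def mult.commute)

text \<open>The library's inner product on \<open>complex^'n\<close> is the real part of the Hermitian one. The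
  conjugate transpose is the adjoint for it as well, so quadratic forms, orthogonality and norms
  are all handled as real notions.\<close>

lemma inner_matrix_vector: "x \<bullet> (A *v y) = (ctranspose A *v x) \<bullet> (y :: complex^'n)"
proof -
  have c: "a \<bullet> (b * c) = (cnj b * a) \<bullet> c" for a b c :: complex
    by (simp add: inner_complex_def algebra_simps)
  have "x \<bullet> (A *v y) = (\<Sum>i\<in>UNIV. \<Sum>j\<in>UNIV. x $ i \<bullet> (A $ i $ j * y $ j))"
    by (simp add: inner_vec_def matrix_vector_mult_def inner_sum_right)
  also have "\<dots> = (\<Sum>j\<in>UNIV. \<Sum>i\<in>UNIV. (cnj (A $ i $ j) * x $ i) \<bullet> y $ j)"
    by (subst sum.swap) (simp add: c)
  also have "\<dots> = (ctranspose A *v x) \<bullet> y"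
    by (simp add: inner_vec_def matrix_vector_mult_def inner_sum_left)
  finally show ?thesis .
qed

lemma hermitian_inner: "hermitian A \<Longrightarrow> x \<bullet> (A *v y) = (A *v x) \<bullet> y"
  using inner_matrix_vector[of x A y] by (simp add: hermitian_def)

lemma unitaryD:
  assumes "unitary U"
  shows "ctranspose U ** U = mat 1" "U ** ctranspose U = mat 1"
  using assms by (auto simp: unitary_def)

lemma unitary_ctranspose: "unitary U \<Longrightarrow> unitary (ctranspose U)"
  by (auto simp: unitary_def)

lemma unitary_mult:
  assumes "unitary U" "unitary V"
  shows "unitary (U ** V)"
proof -
  have "ctranspose (U ** V) ** (U ** V) = ctranspose V ** (ctranspose U ** U) ** V"
    by (simp add: ctranspose_mult matrix_mul_assoc)
  moreover have "(U ** V) ** ctranspose (U ** V) = U ** (V ** ctranspose V) ** ctranspose U"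
    by (simp add: ctranspose_mult matrix_mul_assoc)
  ultimately show ?thesis
    using assms by (simp add: unitary_def)
qed

lemma norm_unitary:
  assumes "unitary U"
  shows "norm (U *v x) = norm (x :: complex^'n)"
proof -
  have "(U *v x) \<bullet> (U *v x) = x \<bullet> x"
    using assms by (simp add: inner_matrix_vector matrix_vector_mul_assoc unitaryD)
  then show ?thesis
    by (simp add: norm_eq_sqrt_inner)
qed

lemma matrix_eq_vectorI: "(\<And>x. A *v x = B *v (x :: complex^'n)) \<Longrightarrow> A = (B :: complex^'n^'m)"
  by (metis matrix_eq)

lemma matrix_vector_scaleR: "A *v (r *\<^sub>R x) = r *\<^sub>R (A *v (x :: complex^'n))"
  by (rule linear_cmul[OF matrix_vector_mul_linear])

lemma of_real_vector_scaleR: "complex_of_real r *s x = r *\<^sub>R (x :: complex^'n)"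
  by (simp add: vec_eq_iff complex_eq_iff)

lemma matrix_add_distrib:
  fixes A B C :: "complex^'n^'n"
  shows "A ** (B + C) = A ** B + A ** C" "(B + C) ** A = B ** A + C ** A"
  by (simp_all add: vec_eq_iff matrix_matrix_mult_def distrib_left distrib_right sum.distrib)

lemma matrix_diff_distrib:
  fixes A B C :: "complex^'n^'n"
  shows "A ** (B - C) = A ** B - A ** C" "(B - C) ** A = B ** A - C ** A"
  by (simp_all add: vec_eq_iff matrix_matrix_mult_def left_diff_distrib right_diff_distrib
      sum_subtractf)

section \<open>Diagonal matrices and functional calculus\<close>

lemma real_diag_nth: "real_diag l $ i $ j = (if i = j then complex_of_real (l i) else 0)"
  by (simp add: real_diag_def)

lemma real_diag_vector: "real_diag l *v x = (\<chi> i. complex_of_real (l i) * x $ i)"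
  by (simp add: vec_eq_iff matrix_vector_mult_def real_diag_nth if_distrib[of "\<lambda>x. x * _"]
      cong: if_cong)

lemma real_diag_mult: "real_diag l ** real_diag m = real_diag (\<lambda>i. l i * m i)"
  by (rule matrix_eq_vectorI)
     (simp add: matrix_vector_mul_assoc[symmetric] real_diag_vector vec_eq_iff)

lemma real_diag_mult_nth:
  "(real_diag l ** A) $ i $ j = complex_of_real (l i) * A $ i $ j"
  "(A ** real_diag l) $ i $ j = A $ i $ j * complex_of_real (l j)"
  by (simp_all add: matrix_matrix_mult_def real_diag_nth if_distrib[of "\<lambda>x. x * _"]
      if_distrib[of "\<lambda>x. _ * x"] cong: if_cong)

lemma ctranspose_real_diag [simp]: "ctranspose (real_diag l) = real_diag l"
  by (simp add: vec_eq_iff real_diag_nth)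

lemma real_diag_const: "real_diag (\<lambda>_. c) = mat (complex_of_real c)"
  by (simp add: vec_eq_iff real_diag_nth mat_def)

lemma det_real_diag: "det (real_diag l) = complex_of_real (\<Prod>i\<in>UNIV. l i)"
  by (subst det_diagonal) (auto simp: real_diag_nth)

text \<open>For unitary \<open>U\<close> this is a diagonalisation, and every Hermitian matrix below is handled
  through one. For invertible \<open>S\<close> it is a congruence with a diagonal matrix; a pair of positive
  definite matrices can be written as \<open>diag_in S (\<lambda>_. 1)\<close> and \<open>diag_in S d\<close> with the same
  \<open>S\<close>.\<close>

definition diag_in :: "complex^'n^'n \<Rightarrow> ('n \<Rightarrow> real) \<Rightarrow> complex^'n^'n"
  where "diag_in U l = U ** real_diag l ** ctranspose U"

lemma diag_in_hermitian: "hermitian (diag_in U l)"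
  by (simp add: hermitian_def diag_in_def ctranspose_mult matrix_mul_assoc)

lemma diag_in_mult:
  assumes "unitary U"
  shows "diag_in U l ** diag_in U m = diag_in U (\<lambda>i. l i * m i)"
proof -
  have "diag_in U l ** diag_in U m
      = U ** real_diag l ** (ctranspose U ** U) ** real_diag m ** ctranspose U"
    by (simp add: diag_in_def matrix_mul_assoc)
  also have "\<dots> = U ** (real_diag l ** real_diag m) ** ctranspose U"
    using assms by (simp add: unitaryD matrix_mul_assoc)
  finally show ?thesis
    by (simp add: real_diag_mult diag_in_def)
qed

lemma mat_commute: "A ** mat z = mat z ** (A :: complex^'n^'n)"
  by (simp add: vec_eq_iff matrix_matrix_mult_def mat_def if_distrib[of "\<lambda>x. x * _"]
      if_distrib[of "\<lambda>x. _ * x"] mult.commute cong: if_cong)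

lemma diag_in_const:
  assumes "unitary U"
  shows "diag_in U (\<lambda>_. c) = mat (complex_of_real c)"
proof -
  have "diag_in U (\<lambda>_. c) = mat (complex_of_real c) ** (U ** ctranspose U)"
    by (simp add: diag_in_def real_diag_const matrix_mul_assoc mat_commute[of U])
  then show ?thesis
    using assms by (simp add: unitaryD)
qed

lemma diag_in_add: "diag_in U l + diag_in U m = diag_in U (\<lambda>i. l i + m i)"
proof -
  have "real_diag (\<lambda>i. l i + m i) = real_diag l + real_diag m"
    by (simp add: vec_eq_iff real_diag_nth)
  then show ?thesis
    by (simp add: diag_in_def matrix_add_distrib)
qed

lemma inner_diag_in:
  "x \<bullet> (diag_in U l *v x) = (\<Sum>j\<in>UNIV. l j * (cmod ((ctranspose U *v x) $ j))\<^sup>2)"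
proof -
  have "x \<bullet> (diag_in U l *v x) = (ctranspose U *v x) \<bullet> (real_diag l *v (ctranspose U *v x))"
    by (simp add: diag_in_def matrix_vector_mul_assoc[symmetric] inner_matrix_vector)
  also have "\<dots> = (\<Sum>j\<in>UNIV. l j * (cmod ((ctranspose U *v x) $ j))\<^sup>2)"
    unfolding cmod_power2
    by (simp add: inner_vec_def real_diag_vector inner_complex_def algebra_simps power2_eq_square)
  finally show ?thesis .
qed

lemma det_diag_in:
  assumes "unitary U"
  shows "det (diag_in U l) = complex_of_real (\<Prod>i\<in>UNIV. l i)"
proof -
  have "det U * det (ctranspose U) = 1"
    using assms by (metis det_I det_mul unitaryD(2))
  then show ?thesis
    by (simp add: diag_in_def det_mul det_real_diag mult.commute mult.left_commute)
qed

lemma invertible_diag_in: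
  assumes "unitary U"
  shows "invertible (diag_in U l) \<longleftrightarrow> (\<forall>i. l i \<noteq> 0)"
  by (simp add: invertible_det_nz det_diag_in[OF assms])

lemma spectrum_diag_in:
  assumes "unitary U"
  shows "spectrum (diag_in U l) = complex_of_real ` range l"
proof -
  have "det (mat z - diag_in U l) = (\<Prod>i\<in>UNIV. z - complex_of_real (l i))" for z
  proof -
    have "mat z - diag_in U l = U ** (mat z - real_diag l) ** ctranspose U"
    proof -
      have "mat z = U ** mat z ** ctranspose U"
        unfolding mat_commute[of U] matrix_mul_assoc[symmetric] unitaryD(2)[OF assms] by simp
      then show ?thesis
        unfolding diag_in_def by (metis matrix_diff_distrib)
    qed
    moreover have "det U * det (ctranspose U) = 1"
      using assms by (metis det_I det_mul unitaryD(2))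
    moreover have "det (mat z - real_diag l) = (\<Prod>i\<in>UNIV. z - complex_of_real (l i))"
      by (subst det_diagonal) (auto simp: real_diag_nth mat_def)
    ultimately show ?thesis
      by (simp add: det_mul mult.commute mult.left_commute)
  qed
  then show ?thesis
    by (auto simp: spectrum_def invertible_det_nz)
qed

text \<open>If two diagonalisations give the same matrix, then \<open>ctranspose V ** U\<close> intertwines the two
  diagonals; its entry at a position can be non-zero only where the two eigenvalues agree, so it
  also intertwines their images under any function.\<close>

lemma diag_in_fun_cong:
  assumes U: "unitary U" and V: "unitary V" and eq: "diag_in U l = diag_in V m"
  shows "diag_in U (\<lambda>i. f (l i)) = diag_in V (\<lambda>i. f (m i))"
proof -
  define W where "W = ctranspose V ** U"
  have inter: "W ** real_diag l' = real_diag m' ** W \<longleftrightarrow> diag_in U l' = diag_in V m'" for l' m'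
  proof
    assume h: "diag_in U l' = diag_in V m'"
    have "W ** real_diag l' = ctranspose V ** (U ** real_diag l' ** (ctranspose U ** U))"
      unfolding unitaryD(1)[OF U] by (simp add: W_def matrix_mul_assoc)
    also have "\<dots> = ctranspose V ** diag_in U l' ** U"
      by (simp add: diag_in_def matrix_mul_assoc)
    also have "\<dots> = (ctranspose V ** V) ** real_diag m' ** W"
      unfolding h by (simp add: W_def diag_in_def matrix_mul_assoc)
    finally show "W ** real_diag l' = real_diag m' ** W"
      using V by (simp add: unitaryD)
  next
    assume h: "W ** real_diag l' = real_diag m' ** W"
    have "diag_in U l' = (V ** ctranspose V) ** U ** real_diag l' ** ctranspose U"
      using V by (simp add: diag_in_def unitaryD)
    also have "\<dots> = V ** (W ** real_diag l') ** ctranspose U"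
      by (simp add: W_def matrix_mul_assoc)
    also have "\<dots> = V ** real_diag m' ** ctranspose V ** (U ** ctranspose U)"
      unfolding h by (simp add: W_def matrix_mul_assoc)
    finally show "diag_in U l' = diag_in V m'"
      using U by (simp add: diag_in_def unitaryD)
  qed
  have "W ** real_diag l = real_diag m ** W"
    using inter eq by blast
  then have "W $ i $ j * complex_of_real (l j) = complex_of_real (m i) * W $ i $ j" for i j
    by (metis real_diag_mult_nth)
  then have "W $ i $ j = 0 \<or> l j = m i" for i j
    by (metis mult.commute mult_cancel_left of_real_eq_iff)
  then have "W $ i $ j * complex_of_real (f (l j)) = complex_of_real (f (m i)) * W $ i $ j" for i j
    by (metis mult.commute mult_zero_left)
  then have "W ** real_diag (\<lambda>i. f (l i)) = real_diag (\<lambda>i. f (m i)) ** W"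
    by (simp add: vec_eq_iff real_diag_mult_nth)
  then show ?thesis
    using inter by blast
qed

lemma mat_fun_diag_in:
  assumes "unitary U"
  shows "mat_fun f (diag_in U l) = diag_in U (\<lambda>i. f (l i))"
  unfolding mat_fun_def
proof (rule the_equality)
  show "\<exists>V m. unitary V \<and> diag_in U l = V ** real_diag m ** ctranspose V \<and>
      diag_in U (\<lambda>i. f (l i)) = V ** real_diag (\<lambda>i. f (m i)) ** ctranspose V"
    using assms unfolding diag_in_def by blast
next
  fix B
  assume "\<exists>V m. unitary V \<and> diag_in U l = V ** real_diag m ** ctranspose V \<and>
      B = V ** real_diag (\<lambda>i. f (m i)) ** ctranspose V"
  then show "B = diag_in U (\<lambda>i. f (l i))"
    using diag_in_fun_cong[OF assms] unfolding diag_in_def by metis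
qed

lemma mat_powr_diag_in:
  "unitary U \<Longrightarrow> mat_powr (diag_in U l) t = diag_in U (\<lambda>i. l i powr t)"
  by (simp add: mat_powr_def mat_fun_diag_in)

section \<open>The spectral theorem\<close>

text \<open>Orthogonality to \<open>e i\<close> for the Hermitian product means real orthogonality to \<open>e i\<close>
  and to \<open>\<i> *s e i\<close>; \<open>k\<close> vectors thus span at most \<open>2 * k\<close> real dimensions. On the
  orthogonal complement, a maximiser of the quadratic form over the unit sphere is an
  eigenvector.\<close>

lemma exists_orthogonal_eigenvector:
  fixes A :: "complex^'n^'n" and e :: "nat \<Rightarrow> complex^'n"
  assumes A: "hermitian A" and k: "k < CARD('n)"
    and e: "\<And>i. i < k \<Longrightarrow> A *v e i = complex_of_real (l i) *s e i"
  shows "\<exists>x c. norm x = 1 \<and> A *v x = complex_of_real c *s x \<and>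
           (\<forall>i<k. e i \<bullet> x = 0 \<and> (\<i> *s e i) \<bullet> x = 0)"
proof -
  define E where "E = e ` {..<k} \<union> (\<lambda>i. \<i> *s e i) ` {..<k}"
  define W where "W = {x. \<forall>v\<in>E. v \<bullet> x = 0}"
  have "finite E"
    by (simp add: E_def)
  have "card E \<le> k + k"
    unfolding E_def
    by (rule order_trans[OF card_Un_le]) (intro add_mono order_trans[OF card_image_le]; simp)
  then have "dim E < DIM(complex^'n)"
    using dim_le_card'[OF \<open>finite E\<close>] k by (simp add: DIM_complex)
  then obtain w where w: "w \<noteq> 0" "\<And>y. y \<in> span E \<Longrightarrow> orthogonal w y"
    using orthogonal_to_subspace_exists[of E] by metis
  then have wW: "w /\<^sub>R norm w \<in> W \<inter> sphere 0 1"
    by (auto simp: W_def orthogonal_def span_base inner_commute)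
  have WE: "W = (\<Inter>v\<in>E. {x. v \<bullet> x = 0})"
    by (auto simp: W_def)
  have "closed W"
    unfolding WE by (intro closed_INT ballI closed_hyperplane)
  then have "compact (W \<inter> sphere 0 1)"
    by (intro closed_Int_compact compact_sphere)
  moreover have "continuous_on (W \<inter> sphere 0 1) (\<lambda>x. x \<bullet> (A *v x))"
    by (intro continuous_intros matrix_vector_mult_linear_continuous_on)
  ultimately obtain x where x: "x \<in> W \<inter> sphere 0 1"
    and max: "\<And>y. y \<in> W \<inter> sphere 0 1 \<Longrightarrow> y \<bullet> (A *v y) \<le> x \<bullet> (A *v x)"
    using continuous_attains_sup[of "W \<inter> sphere 0 1" "\<lambda>x. x \<bullet> (A *v x)"] wW by blast
  define c where "c = x \<bullet> (A *v x)"
  have "subspace W"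
    by (auto simp: W_def subspace_def inner_add_right)
  have gap: "0 \<le> c * (y \<bullet> y) - y \<bullet> (A *v y)" if "y \<in> W" for y
  proof (cases "y = 0")
    case False
    have "(y /\<^sub>R norm y) \<bullet> (A *v (y /\<^sub>R norm y)) \<le> c"
      unfolding c_def using that False \<open>subspace W\<close>
      by (intro max) (auto simp: subspace_scale)
    then have "y \<bullet> (A *v y) / (norm y)\<^sup>2 \<le> c"
      by (simp add: matrix_vector_scaleR power2_eq_square divide_inverse algebra_simps)
    then show ?thesis
      using False by (simp add: divide_le_eq power2_norm_eq_inner)
  qed simp
  \<comment> \<open>\<open>A\<close> maps the orthogonal complement \<open>W\<close> of eigenvectors to itself.\<close>
  have AW: "A *v y \<in> W" if "y \<in> W" for y
  proof -
    have "v \<bullet> (A *v y) = 0" if "v \<in> E" for v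
    proof -
      have sc: "complex_of_real r *s u = r *\<^sub>R u" for r and u :: "complex^'n"
        by (simp add: of_real_vector_scaleR)
      obtain r where "A *v v = r *\<^sub>R v"
      proof -
        from \<open>v \<in> E\<close> obtain i where i: "i < k" and "v = e i \<or> v = \<i> *s e i"
          by (auto simp: E_def)
        moreover have "A *v (\<i> *s e i) = \<i> *s (A *v e i)"
          by (simp add: vec_eq_iff matrix_vector_mult_def sum_distrib_left mult.left_commute)
        moreover have "\<i> *s (r *\<^sub>R u) = r *\<^sub>R (\<i> *s u)" for r and u :: "complex^'n"
          by (simp add: vec_eq_iff)
        ultimately show ?thesis
          using that[of "l i"] e[OF i] sc by metis
      qed
      moreover have "v \<bullet> y = 0"
        using \<open>y \<in> W\<close> \<open>v \<in> E\<close> by (simp add: W_def)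
      ultimately show ?thesis
        by (simp add: hermitian_inner[OF A])
    qed
    then show ?thesis
      by (simp add: W_def)
  qed
  \<comment> \<open>The form \<open>c * norm\<^sup>2 - A\<close> is non-negative on \<open>W\<close> and vanishes at \<open>x\<close>, so it vanishes to
    second order there: its gradient is zero.\<close>
  define z where "z = c *\<^sub>R x - A *v x"
  have zW: "z \<in> W"
    using x AW[of x] \<open>subspace W\<close> by (simp add: z_def subspace_diff subspace_scale)
  have xx: "x \<bullet> x = 1"
    using x by (simp add: norm_eq_1)
  have poly: "0 \<le> 2 * t * (z \<bullet> z) + t\<^sup>2 * (c * (z \<bullet> z) - z \<bullet> (A *v z))" for t
  proof -
    have "x + t *\<^sub>R z \<in> W"
      using x zW \<open>subspace W\<close> by (simp add: subspace_add subspace_scale)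
    then have "0 \<le> c * ((x + t *\<^sub>R z) \<bullet> (x + t *\<^sub>R z)) - (x + t *\<^sub>R z) \<bullet> (A *v (x + t *\<^sub>R z))"
      by (rule gap)
    also have "\<dots> = (c * (x \<bullet> x) - x \<bullet> (A *v x)) + 2 * t * (c * (x \<bullet> z) - (A *v x) \<bullet> z)
        + t\<^sup>2 * (c * (z \<bullet> z) - z \<bullet> (A *v z))"
      using hermitian_inner[OF A, of x z]
      by (simp add: matrix_vector_right_distrib matrix_vector_scaleR inner_simps
          power2_eq_square algebra_simps inner_commute)
    also have "c * (x \<bullet> z) - (A *v x) \<bullet> z = z \<bullet> z"
      by (metis inner_diff_left inner_scaleR_left z_def)
    finally show ?thesis
      by (simp add: xx c_def)
  qed
  have "z \<bullet> z = 0"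
  proof (rule ccontr)
    assume "z \<bullet> z \<noteq> 0"
    then have pos: "z \<bullet> z > 0"
      by simp
    define b where "b = c * (z \<bullet> z) - z \<bullet> (A *v z)"
    have b: "b \<ge> 0"
      using gap[OF zW] by (simp add: b_def)
    define t where "t = (z \<bullet> z) / (b + 1)"
    have zt: "z \<bullet> z = t * (b + 1)" and t: "t > 0"
      using pos b by (simp_all add: t_def)
    have "2 * (- t) * (z \<bullet> z) + (- t)\<^sup>2 * b = - (t\<^sup>2 * (b + 2))"
      unfolding zt by (simp add: algebra_simps power2_eq_square)
    also have "\<dots> < 0"
      using t b by simp
    finally show False
      using poly[of "- t"] by (simp add: b_def)
  qed
  then have "A *v x = complex_of_real c *s x"
    by (simp add: z_def of_real_vector_scaleR)
  moreover have "\<forall>i<k. e i \<bullet> x = 0 \<and> (\<i> *s e i) \<bullet> x = 0"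
    using x by (auto simp: W_def E_def)
  ultimately show ?thesis
    using x by auto
qed

lemma exists_orthonormal_eigenvectors:
  fixes A :: "complex^'n^'n"
  assumes A: "hermitian A" and "k \<le> CARD('n)"
  shows "\<exists>(e :: nat \<Rightarrow> complex^'n) l. (\<forall>i<k. norm (e i) = 1 \<and> A *v e i = complex_of_real (l i) *s e i)
          \<and> (\<forall>i<k. \<forall>j<i. e j \<bullet> e i = 0 \<and> (\<i> *s e j) \<bullet> e i = 0)"
  using \<open>k \<le> CARD('n)\<close>
proof (induction k)
  case (Suc k)
  then obtain e :: "nat \<Rightarrow> complex^'n" and l where
    e: "\<forall>i<k. norm (e i) = 1 \<and> A *v e i = complex_of_real (l i) *s e i"
    "\<forall>i<k. \<forall>j<i. e j \<bullet> e i = 0 \<and> (\<i> *s e j) \<bullet> e i = 0"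
    by auto
  obtain x c where x: "norm x = 1" "A *v x = complex_of_real c *s x"
    "\<forall>i<k. e i \<bullet> x = 0 \<and> (\<i> *s e i) \<bullet> x = 0"
    using exists_orthogonal_eigenvector[OF A, of k e l] Suc.prems e by auto
  show ?case
    by (rule exI[of _ "e(k := x)"], rule exI[of _ "l(k := c)"])
       (use e x in \<open>auto simp: less_Suc_eq\<close>)
qed auto

theorem hermitian_diagonalisation:
  fixes A :: "complex^'n^'n"
  assumes A: "hermitian A"
  obtains U l where "unitary U" "A = diag_in U l"
proof -
  obtain e :: "nat \<Rightarrow> complex^'n" and l where
    e: "\<forall>i<CARD('n). norm (e i) = 1 \<and> A *v e i = complex_of_real (l i) *s e i"
    "\<forall>i<CARD('n). \<forall>j<i. e j \<bullet> e i = 0 \<and> (\<i> *s e j) \<bullet> e i = 0"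
    using exists_orthonormal_eigenvectors[OF A order_refl] by blast
  obtain h :: "'n \<Rightarrow> nat" where h: "bij_betw h UNIV {..<CARD('n)}"
    using ex_bij_betw_finite_nat[of "UNIV :: 'n set"] by (auto simp: atLeast0LessThan)
  define v where "v i = e (h i)" for i
  have hl: "h i < CARD('n)" for i
    using h by (auto simp: bij_betw_def)
  have v1: "norm (v i) = 1" "A *v v i = complex_of_real (l (h i)) *s v i" for i
    using e hl by (auto simp: v_def)
  have flip: "(\<i> *s x) \<bullet> y = - (x \<bullet> (\<i> *s y))" for x y :: "complex^'n"
    by (simp add: inner_vec_def inner_complex_def sum_negf[symmetric] algebra_simps)
  have v2: "v i \<bullet> v j = 0 \<and> (\<i> *s v i) \<bullet> v j = 0" if "i \<noteq> j" for i j
  proof -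
    have "h i \<noteq> h j"
      using h that by (auto simp: bij_betw_def inj_def)
    then consider "h i < h j" | "h j < h i"
      by linarith
    then show ?thesis
    proof cases
      case 1
      then show ?thesis
        using e hl by (auto simp: v_def)
    next
      case 2
      then have "v j \<bullet> v i = 0" "(\<i> *s v j) \<bullet> v i = 0"
        using e hl by (auto simp: v_def)
      then show ?thesis
        using flip[of "v i" "v j"] by (simp add: inner_commute)
    qed
  qed
  define U :: "complex^'n^'n" where "U = (\<chi> i j. v j $ i)"
  have prod: "(\<Sum>k\<in>UNIV. cnj (x $ k) * y $ k) = Complex (x \<bullet> y) ((\<i> *s x) \<bullet> y)"
    for x y :: "complex^'n"
    by (rule complex_eqI) (simp_all add: inner_vec_def inner_complex_def sum.distrib[symmetric])
  have "ctranspose U ** U = mat 1"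
  proof -
    have "(ctranspose U ** U) $ i $ j = (mat 1 :: complex^'n^'n) $ i $ j" for i j
    proof -
      have "(ctranspose U ** U) $ i $ j = Complex (v i \<bullet> v j) ((\<i> *s v i) \<bullet> v j)"
        by (simp add: matrix_matrix_mult_def U_def prod[symmetric])
      also have "\<dots> = (mat 1 :: complex^'n^'n) $ i $ j"
      proof (cases "i = j")
        case True
        have "(\<i> *s v j) \<bullet> v j = 0"
          by (simp add: inner_vec_def inner_complex_def)
        then show ?thesis
          using True v1(1)[of j] by (simp add: mat_def norm_eq_1 complex_eq_iff)
      next
        case False
        then show ?thesis
          using v2[OF False] by (simp add: mat_def complex_eq_iff)
      qed
      finally show ?thesis .
    qed
    then show ?thesis
      by (simp add: vec_eq_iff)
  qed
  then have U: "unitary U"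
    by (simp add: unitary_def matrix_left_right_inverse)
  have "A ** U = U ** real_diag (\<lambda>i. l (h i))"
  proof -
    have "(A ** U) $ i $ j = (A *v v j) $ i" for i j
      by (simp add: matrix_matrix_mult_def matrix_vector_mult_def U_def)
    moreover have "(U ** real_diag (\<lambda>i. l (h i))) $ i $ j = complex_of_real (l (h j)) * v j $ i" for i j
      by (simp add: matrix_matrix_mult_def U_def real_diag_nth if_distrib[of "\<lambda>x. _ * x"]
          mult.commute cong: if_cong)
    ultimately show ?thesis
      by (simp add: vec_eq_iff v1)
  qed
  then have "A = diag_in U (\<lambda>i. l (h i))"
    unfolding diag_in_def using unitaryD(2)[OF U] by (metis matrix_mul_assoc matrix_mul_rid)
  with U show ?thesis
    using that by blast
qed

section \<open>Symmetric norms and derived anti-norms on eigenvalue vectors\<close>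

lemma symmetric_normD:
  assumes "symmetric_norm N"
  shows "0 \<le> N A" "N A = 0 \<longleftrightarrow> A = 0" "N (map_matrix ((*) c) A) = cmod c * N A"
    "N (A + B) \<le> N A + N B" "unitary U \<Longrightarrow> unitary V \<Longrightarrow> N (U ** A ** V) = N A"
  using assms unfolding symmetric_norm_def by blast+

lemma symmetric_norm_diag_in:
  assumes "symmetric_norm N" "unitary U"
  shows "N (diag_in U t) = N (real_diag t)"
  unfolding diag_in_def using assms unitary_ctranspose by (intro symmetric_normD(5))

lemma symmetric_norm_real_diag_scale:
  assumes "symmetric_norm N"
  shows "N (real_diag (\<lambda>i. c * t i)) = \<bar>c\<bar> * N (real_diag t)"
proof -
  have "real_diag (\<lambda>i. c * t i) = map_matrix ((*) (complex_of_real c)) (real_diag t)"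
    by (simp add: vec_eq_iff real_diag_nth)
  then show ?thesis
    using symmetric_normD(3)[OF assms] by simp
qed

lemma symmetric_norm_real_diag_add:
  assumes "symmetric_norm N"
  shows "N (real_diag (\<lambda>i. s i + t i)) \<le> N (real_diag s) + N (real_diag t)"
proof -
  have "real_diag (\<lambda>i. s i + t i) = real_diag s + real_diag t"
    by (simp add: vec_eq_iff real_diag_nth)
  then show ?thesis
    using symmetric_normD(4)[OF assms] by simp
qed

lemma symmetric_norm_real_diag_pos:
  assumes "symmetric_norm N" and "t i \<noteq> 0"
  shows "0 < N (real_diag t)"
proof -
  have "real_diag t $ i $ i \<noteq> 0"
    using assms by (simp add: real_diag_nth)
  then have "real_diag t \<noteq> 0"
    by (metis zero_index)
  then show ?thesis
    using symmetric_normD(1,2)[OF assms(1), of "real_diag t"] by linarith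
qed

lemma unitary_signs:
  assumes "\<And>i. s i = 1 \<or> s i = -1"
  shows "unitary (real_diag s)"
proof -
  have "s i * s i = 1" for i
    using assms[of i] by auto
  then show ?thesis
    by (simp add: unitary_def real_diag_mult real_diag_const)
qed

text \<open>The diagonal part of a matrix is reached by averaging, one index at a time, with the
  conjugate by the diagonal sign matrix that flips that index.\<close>

lemma symmetric_norm_pinching:
  assumes N: "symmetric_norm N"
  shows "N (\<chi> i j. if i = j then A $ i $ j else 0) \<le> N A"
proof -
  define P where "P S = (\<chi> i j. if i = j \<or> (i \<notin> S \<and> j \<notin> S) then A $ i $ j else 0)" for S
  have "N (P S) \<le> N A" if "finite S" for S
    using that
  proof (induction S)
    case empty
    have "P {} = A"
      by (simp add: P_def vec_eq_iff)
    then show ?case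
      by simp
  next
    case (insert k S)
    define D :: "complex^'a^'a" where "D = real_diag (\<lambda>i. if i = k then -1 else 1)"
    have "unitary D"
      unfolding D_def by (rule unitary_signs) simp
    then have DN: "N (D ** P S ** D) = N (P S)"
      by (intro symmetric_normD(5)[OF N])
    have "P (insert k S) = map_matrix ((*) (1/2)) (P S + D ** P S ** D)"
      by (simp add: vec_eq_iff real_diag_mult_nth D_def P_def)
    then have "N (P (insert k S)) = 1/2 * N (P S + D ** P S ** D)"
      using symmetric_normD(3)[OF N, of "1/2"] by simp
    also have "\<dots> \<le> N (P S)"
      using symmetric_normD(4)[OF N, of "P S" "D ** P S ** D"] DN by simp
    finally show ?case
      using insert.IH by linarith
  qed
  from this[of UNIV] show ?thesis
    by (simp add: P_def)
qed

lemma diag_in_diagonal: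
  "diag_in U t $ i $ i = complex_of_real (\<Sum>j\<in>UNIV. (cmod (U $ i $ j))\<^sup>2 * t j)"
proof -
  have "diag_in U t $ i $ i = (\<Sum>j\<in>UNIV. (U ** real_diag t) $ i $ j * cnj (U $ i $ j))"
    unfolding diag_in_def by (subst matrix_matrix_mult_def) simp
  also have "\<dots> = (\<Sum>j\<in>UNIV. (U $ i $ j * cnj (U $ i $ j)) * complex_of_real (t j))"
    by (simp add: real_diag_mult_nth algebra_simps)
  finally show ?thesis
    by (simp add: complex_norm_square[symmetric])
qed

lemma symmetric_norm_diagonal_le:
  assumes N: "symmetric_norm N" and U: "unitary U"
  shows "N (real_diag (\<lambda>i. \<Sum>j\<in>UNIV. (cmod (U $ i $ j))\<^sup>2 * t j)) \<le> N (real_diag t)"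
proof -
  have "real_diag (\<lambda>i. \<Sum>j\<in>UNIV. (cmod (U $ i $ j))\<^sup>2 * t j)
      = (\<chi> i j. if i = j then diag_in U t $ i $ j else 0)"
    unfolding vec_eq_iff by (auto simp: real_diag_nth diag_in_diagonal)
  then show ?thesis
    using symmetric_norm_pinching[OF N, of "diag_in U t"] symmetric_norm_diag_in[OF N U]
    by simp
qed

text \<open>A norming functional at a positive vector, extended to all unitary conjugates by pinching.
  Its coefficients are non-negative because the norm does not see the signs of the entries.\<close>

lemma symmetric_norm_support:
  fixes t :: "'n::finite \<Rightarrow> real"
  assumes N: "symmetric_norm (N :: complex^'n^'n \<Rightarrow> real)" and t: "\<And>i. 0 < t i"
  obtains y where "\<And>i. 0 \<le> y i" "(\<Sum>i\<in>UNIV. y i * t i) = N (real_diag t)"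
    "\<And>U s. unitary U \<Longrightarrow>
       (\<Sum>i\<in>UNIV. y i * (\<Sum>j\<in>UNIV. (cmod (U $ i $ j))\<^sup>2 * s j)) \<le> N (real_diag s)"
proof -
  define \<Phi> where "\<Phi> s = N (real_diag s)" for s
  have \<Phi>_nonneg: "0 \<le> \<Phi> s" for s
    by (simp add: \<Phi>_def symmetric_normD[OF N])
  have \<Phi>_scale: "\<Phi> (\<lambda>i. c * s i) = \<bar>c\<bar> * \<Phi> s" for c s
    by (simp add: \<Phi>_def symmetric_norm_real_diag_scale[OF N])
  have \<Phi>_add: "\<Phi> (\<lambda>i. r i + s i) \<le> \<Phi> r + \<Phi> s" for r s
    by (simp add: \<Phi>_def symmetric_norm_real_diag_add[OF N])
  have \<Phi>t: "0 < \<Phi> t"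
    using symmetric_norm_real_diag_pos[OF N] t by (simp add: \<Phi>_def less_imp_neq[symmetric])
  have nth: "($) (x + y) = (\<lambda>i. x $ i + y $ i)" "($) (r *\<^sub>R x) = (\<lambda>i. r * x $ i)"
      "($) (0 :: real^'n) = (\<lambda>_. 0)" "($) (\<chi> i. s i) = s" for x y :: "real^'n" and r s
    by (simp_all add: fun_eq_iff)
  define B where "B = {x :: real^'n. \<Phi> (($) x) < \<Phi> t}"
  have "convex B"
  proof (rule convexI)
    fix x y and u v :: real
    assume xy: "x \<in> B" "y \<in> B" and uv: "0 \<le> u" "0 \<le> v" "u + v = 1"
    have "\<Phi> (($) (u *\<^sub>R x + v *\<^sub>R y)) \<le> u * \<Phi> (($) x) + v * \<Phi> (($) y)"
      using \<Phi>_add[of "\<lambda>i. u * x $ i" "\<lambda>i. v * y $ i"] \<Phi>_scale[of u "($) x"]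
        \<Phi>_scale[of v "($) y"] uv by (simp add: nth)
    also have "\<dots> < \<Phi> t"
      by (rule convex_bound_lt) (use xy uv in \<open>auto simp: B_def\<close>)
    finally show "u *\<^sub>R x + v *\<^sub>R y \<in> B"
      by (simp add: B_def)
  qed
  moreover have "(0 :: real^'n) \<in> B"
    using \<Phi>t \<Phi>_scale[of 0 "\<lambda>_. 0"] by (simp add: B_def nth)
  moreover have "(\<chi> i. t i) \<notin> B"
    by (simp add: B_def nth)
  ultimately obtain a b where a: "a \<noteq> 0" and aB: "\<And>x. x \<in> B \<Longrightarrow> inner a x \<le> b"
    and at: "b \<le> inner a (\<chi> i. t i)"
    using separating_hyperplane_sets[of B "{\<chi> i. t i}"] by auto
  have aB': "inner a x * \<Phi> t \<le> inner a (\<chi> i. t i) * \<Phi> (($) x)" for x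
  proof -
    have scaled: "r * inner a x \<le> inner a (\<chi> i. t i)" if "0 < r" "r * \<Phi> (($) x) < \<Phi> t" for r
    proof -
      have "r *\<^sub>R x \<in> B"
        using \<Phi>_scale[of r "($) x"] that by (simp add: B_def nth)
      then show ?thesis
        using aB[of "r *\<^sub>R x"] at by simp
    qed
    show ?thesis
    proof (rule ccontr)
      define p where "p = inner a x"
      define q where "q = inner a (\<chi> i. t i)"
      define w where "w = \<Phi> (($) x)"
      assume "\<not> ?thesis"
      then have lt: "q * w < p * \<Phi> t"
        by (simp add: p_def q_def w_def)
      have w0: "0 \<le> w"
        by (simp add: w_def \<Phi>_nonneg)
      have q0: "0 \<le> q"
        using aB[OF \<open>0 \<in> B\<close>] at by (simp add: q_def)
      have p0: "0 < p"
        using lt q0 w0 \<Phi>t by (smt (verit) mult_nonneg_nonneg mult_le_0_iff)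
      have "q / p * w < \<Phi> t"
        using lt p0 by (simp add: field_simps)
      moreover have "((\<lambda>r. r * w) \<longlongrightarrow> q / p * w) (at_right (q / p))"
        by (intro tendsto_intros)
      ultimately have "\<forall>\<^sub>F r in at_right (q / p). r * w < \<Phi> t"
        by (auto dest: order_tendstoD)
      moreover have "\<forall>\<^sub>F r in at_right (q / p). q / p < r"
        by (simp add: eventually_at_right_less)
      ultimately have "\<forall>\<^sub>F r in at_right (q / p). r * w < \<Phi> t \<and> q / p < r"
        by (rule eventually_conj)
      then obtain r where r: "r * w < \<Phi> t" "q / p < r"
        using eventually_happens'[OF trivial_limit_at_right_real] by blast
      have "0 < r"
        using r q0 p0 by (smt (verit) divide_nonneg_pos)
      then have "r * p \<le> q"
        using scaled[of r] r by (simp add: p_def q_def w_def)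
      then show False
        using r p0 by (simp add: field_simps)
    qed
  qed
  have at0: "0 < inner a (\<chi> i. t i)"
  proof -
    have "0 < inner a a * \<Phi> t"
      using a \<Phi>t by simp
    then have "0 < inner a (\<chi> i. t i) * \<Phi> (($) a)"
      using aB'[of a] by linarith
    then show ?thesis
      using \<Phi>_nonneg[of "($) a"] by (simp add: zero_less_mult_iff)
  qed
  define \<kappa> where "\<kappa> = \<Phi> t / inner a (\<chi> i. t i)"
  define y where "y i = a $ i * \<kappa>" for i
  have ysum: "(\<Sum>i\<in>UNIV. y i * s i) = inner a (\<chi> i. s i) * \<kappa>" for s
    by (simp add: y_def inner_vec_def sum_distrib_left mult.commute mult.left_commute)
  have yle: "(\<Sum>i\<in>UNIV. y i * s i) \<le> \<Phi> s" for s
    unfolding ysum \<kappa>_def using aB'[of "\<chi> i. s i"] at0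
    by (simp add: pos_divide_le_eq mult.commute nth)
  have yeq: "(\<Sum>i\<in>UNIV. y i * t i) = \<Phi> t"
    using at0 by (simp add: ysum \<kappa>_def)
  have ynonneg: "0 \<le> y k" for k
  proof -
    define sg where "sg i = (if i = k then -1 else 1 :: real)" for i
    have "real_diag (\<lambda>i. sg i * t i) = real_diag sg ** real_diag t ** mat 1"
      by (simp add: real_diag_mult)
    moreover have sg: "unitary (real_diag sg)"
      by (rule unitary_signs) (simp add: sg_def)
    moreover have one: "unitary (mat 1 :: complex^'n^'n)"
      using unitary_signs[of "\<lambda>_. 1"] by (simp add: real_diag_const)
    ultimately have "\<Phi> (\<lambda>i. sg i * t i) = \<Phi> t"
      unfolding \<Phi>_def using symmetric_normD(5)[OF N sg one, of "real_diag t"] by (simp only:)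
    then have "(\<Sum>i\<in>UNIV. y i * (sg i * t i)) \<le> (\<Sum>i\<in>UNIV. y i * t i)"
      using yle[of "\<lambda>i. sg i * t i"] yeq by simp
    also have "(\<Sum>i\<in>UNIV. y i * (sg i * t i)) = (\<Sum>i\<in>UNIV. y i * t i - (if i = k then 2 * (y i * t i) else 0))"
      by (intro sum.cong) (auto simp: sg_def)
    finally have "0 \<le> y k * t k"
      by (simp add: sum_subtractf mult.commute)
    then show ?thesis
      using t[of k] by (simp add: zero_le_mult_iff)
  qed
  have ydiag: "(\<Sum>i\<in>UNIV. y i * (\<Sum>j\<in>UNIV. (cmod (U $ i $ j))\<^sup>2 * s j)) \<le> N (real_diag s)"
    if "unitary U" for U s
    using yle[of "\<lambda>i. \<Sum>j\<in>UNIV. (cmod (U $ i $ j))\<^sup>2 * s j"]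
      symmetric_norm_diagonal_le[OF N that, of s] by (simp add: \<Phi>_def)
  show ?thesis
    by (rule that[OF ynonneg yeq[unfolded \<Phi>_def] ydiag])
qed

text \<open>Permuting the coordinates of the vector is the special case of a permutation matrix in the
  last property of the norming functional.\<close>

definition permutation_matrix :: "('n \<Rightarrow> 'n) \<Rightarrow> complex^'n^'n"
  where "permutation_matrix \<pi> = (\<chi> i j. if j = \<pi> i then 1 else 0)"

lemma unitary_permutation_matrix:
  assumes "bij \<pi>"
  shows "unitary (permutation_matrix \<pi> :: complex^'n^'n)"
proof -
  have "permutation_matrix \<pi> ** ctranspose (permutation_matrix \<pi>) = (mat 1 :: complex^'n^'n)"
    using assms
    by (auto simp: vec_eq_iff matrix_matrix_mult_def permutation_matrix_def mat_def
        if_distrib[of "\<lambda>x. x * _"] bij_def inj_eq cong: if_cong)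
  then show ?thesis
    by (simp add: unitary_def matrix_left_right_inverse)
qed

lemma sum_permutation_matrix:
  "(\<Sum>j\<in>UNIV. (cmod (permutation_matrix \<pi> $ i $ j))\<^sup>2 * s j) = s (\<pi> i)"
  by (simp add: permutation_matrix_def if_distrib[of cmod] if_distrib[of "\<lambda>x. x\<^sup>2"]
      if_distrib[of "\<lambda>x. x * _"] cong: if_cong)

lemma symmetric_norm_mono:
  assumes N: "symmetric_norm (N :: complex^'n^'n \<Rightarrow> real)" and st: "\<And>i. 0 < s i" "\<And>i. s i \<le> t i"
  shows "N (real_diag s) \<le> N (real_diag t)"
proof -
  obtain y where y: "\<And>i. 0 \<le> y i" "(\<Sum>i\<in>UNIV. y i * s i) = N (real_diag s)"
    "\<And>U r. unitary U \<Longrightarrow>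
       (\<Sum>i\<in>UNIV. y i * (\<Sum>j\<in>UNIV. (cmod (U $ i $ j))\<^sup>2 * r j)) \<le> N (real_diag r)"
    by (rule symmetric_norm_support[where t = s, OF N st(1)]) (rule that)
  have "N (real_diag s) \<le> (\<Sum>i\<in>UNIV. y i * t i)"
    unfolding y(2)[symmetric] by (intro sum_mono mult_left_mono st y)
  also have "\<dots> \<le> N (real_diag t)"
    using y(3)[OF unitary_permutation_matrix[OF bij_id], of t] by (simp add: sum_permutation_matrix)
  finally show ?thesis .
qed

lemma unitary_row_sum:
  assumes "unitary U"
  shows "(\<Sum>j\<in>UNIV. (cmod (U $ i $ j))\<^sup>2) = 1"
proof -
  have "complex_of_real (\<Sum>j\<in>UNIV. (cmod (U $ i $ j))\<^sup>2) = diag_in U (\<lambda>_. 1) $ i $ i"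
    by (simp add: diag_in_diagonal)
  also have "\<dots> = 1"
    using assms by (simp add: diag_in_const mat_def)
  finally show ?thesis
    using of_real_eq_1_iff by blast
qed

lemma unitary_column_sum:
  assumes "unitary U"
  shows "(\<Sum>i\<in>UNIV. (cmod (U $ i $ j))\<^sup>2) = 1"
  using unitary_row_sum[OF unitary_ctranspose[OF assms], of j] by simp

text \<open>The value that the derived anti-norm with exponent \<open>p\<close> takes at positive eigenvalues
  \<open>h\<close>.\<close>

definition anti :: "(complex^'n^'n \<Rightarrow> real) \<Rightarrow> real \<Rightarrow> ('n \<Rightarrow> real) \<Rightarrow> real"
  where "anti N p h = N (real_diag (\<lambda>i. h i powr (-p))) powr (-1/p)"

lemma convex_on_powr_neg:
  assumes "p > 0"
  shows "convex_on {0<..} (\<lambda>x::real. x powr (-p))"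
proof (rule f''_ge0_imp_convex[where f' = "\<lambda>x. -p * x powr (-p - 1)"
      and f'' = "\<lambda>x. -p * ((-p - 1) * x powr (-p - 1 - 1))"])
  show "convex {0::real<..}"
    by simp
  fix x :: real
  assume x: "x \<in> {0<..}"
  show "((\<lambda>x. x powr (-p)) has_real_derivative -p * x powr (-p - 1)) (at x)"
    using x by (auto intro!: derivative_eq_intros)
  show "((\<lambda>x. -p * x powr (-p - 1)) has_real_derivative -p * ((-p - 1) * x powr (-p - 1 - 1))) (at x)"
    using x by (auto intro!: derivative_eq_intros)
  have "-p * (-p - 1) = p * (p + 1)"
    by (simp add: algebra_simps)
  then have "-p * (-p - 1) \<ge> 0"
    using assms by simp
  then have "0 \<le> (-p * (-p - 1)) * x powr (-p - 1 - 1)"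
    by (rule mult_nonneg_nonneg) simp
  then show "0 \<le> -p * ((-p - 1) * x powr (-p - 1 - 1))"
    by (simp add: mult.assoc)
qed

text \<open>The vectors \<open>q\<close> that bound the anti-norm from above by a linear function of the matrix:
  the sum on the right is the trace of a matrix with eigenvalues \<open>g\<close> against one with eigenvalues
  \<open>q\<close>, for an arbitrary position \<open>U\<close> of the two eigenbases.\<close>

definition anti_dominating :: "(complex^'n^'n \<Rightarrow> real) \<Rightarrow> real \<Rightarrow> ('n \<Rightarrow> real) \<Rightarrow> bool"
  where "anti_dominating N p q \<longleftrightarrow> (\<forall>i. 0 \<le> q i) \<and>
    (\<forall>U g. unitary U \<longrightarrow> (\<forall>j. 0 < g j) \<longrightarrow>
       anti N p g \<le> (\<Sum>i\<in>UNIV. q i * (\<Sum>j\<in>UNIV. (cmod (U $ i $ j))\<^sup>2 * g j)))"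

text \<open>Superadditivity of the derived anti-norm in the form of a supergradient at \<open>u\<close>: it is the
  norming functional \<open>y\<close> at \<open>u powr (-p)\<close>, rescaled, and the bound is Jensen's inequality for
  \<open>x powr (-p)\<close>, used for the average with weights \<open>\<theta>\<close> and for each row of the unistochastic
  matrix.\<close>

lemma anti_supergradient:
  fixes u :: "'n::finite \<Rightarrow> real"
  assumes N: "symmetric_norm (N :: complex^'n^'n \<Rightarrow> real)" and p: "0 < p" and u: "\<And>i. 0 < u i"
  shows "\<exists>q. anti_dominating N p q \<and> (\<Sum>i\<in>UNIV. q i * u i) = anti N p u"
proof -
  define v where "v i = u i powr (-p)" for i
  have v: "0 < v i" for i
    using u[of i] by (simp add: v_def)
  obtain y where y: "\<And>i. 0 \<le> y i" "(\<Sum>i\<in>UNIV. y i * v i) = N (real_diag v)"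
    "\<And>U s. unitary U \<Longrightarrow>
       (\<Sum>i\<in>UNIV. y i * (\<Sum>j\<in>UNIV. (cmod (U $ i $ j))\<^sup>2 * s j)) \<le> N (real_diag s)"
    by (rule symmetric_norm_support[where t = v, OF N v]) (rule that)
  define c where "c = N (real_diag v)"
  have c: "0 < c"
    unfolding c_def by (rule symmetric_norm_real_diag_pos[OF N]) (use v in \<open>simp add: less_imp_neq[symmetric]\<close>)
  define \<theta> where "\<theta> i = y i * v i / c" for i
  have \<theta>: "0 \<le> \<theta> i" for i
    using y(1) v c by (simp add: \<theta>_def less_imp_le)
  have \<theta>1: "(\<Sum>i\<in>UNIV. \<theta> i) = 1"
    using y(2) c by (simp add: \<theta>_def sum_divide_distrib[symmetric] c_def)
  have anti_u: "anti N p u = c powr (-1/p)"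
    by (simp add: anti_def c_def v_def[abs_def])
  define q where "q i = anti N p u * \<theta> i / u i" for i
  have q0: "0 \<le> q i" for i
    using \<theta>[of i] u[of i] by (simp add: q_def anti_u less_imp_le)
  have qu: "(\<Sum>i\<in>UNIV. q i * u i) = anti N p u"
  proof -
    have "(\<Sum>i\<in>UNIV. q i * u i) = (\<Sum>i\<in>UNIV. anti N p u * \<theta> i)"
      using u by (intro sum.cong) (auto simp: q_def less_imp_neq[symmetric])
    then show ?thesis
      by (simp add: sum_distrib_left[symmetric] \<theta>1)
  qed
  have qg: "anti N p g \<le> (\<Sum>i\<in>UNIV. q i * (\<Sum>j\<in>UNIV. (cmod (U $ i $ j))\<^sup>2 * g j))"
    if U: "unitary U" and g: "\<And>j. 0 < g j" for U g
  proof -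
    define k where "k i = (\<Sum>j\<in>UNIV. (cmod (U $ i $ j))\<^sup>2 * g j)" for i
    have k: "0 < k i" for i
    proof -
      have "\<exists>j. cmod (U $ i $ j) \<noteq> 0"
      proof (rule ccontr)
        assume "\<not> ?thesis"
        then show False
          using unitary_row_sum[OF U, of i] by simp
      qed
      then obtain j where "0 < (cmod (U $ i $ j))\<^sup>2 * g j"
        using g by (metis mult_pos_pos zero_less_norm_iff norm_eq_zero zero_less_power)
      then show ?thesis
        unfolding k_def using g by (intro sum_pos2[of _ j]) (auto simp: less_imp_le)
    qed
    define r where "r = (\<Sum>i\<in>UNIV. \<theta> i * (k i / u i))"
    have r: "0 < r"
    proof -
      have "\<exists>i. \<theta> i \<noteq> 0"
        using \<theta>1 by (metis sum.neutral zero_neq_one)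
      then obtain i where "0 < \<theta> i * (k i / u i)"
        using \<theta> k u by (metis divide_pos_pos mult_pos_pos order_le_less)
      then show ?thesis
        unfolding r_def using \<theta> k u
        by (intro sum_pos2[of _ i]) (auto simp: less_imp_le)
    qed
    have "r powr (-p) \<le> (\<Sum>i\<in>UNIV. \<theta> i * (k i / u i) powr (-p))"
      unfolding r_def
      using convex_on_sum[OF _ _ convex_on_powr_neg[OF p] \<theta>1, of "\<lambda>i. k i / u i"] \<theta> k u by simp
    also have "\<dots> = (\<Sum>i\<in>UNIV. y i * k i powr (-p)) / c"
      unfolding sum_divide_distrib
    proof (rule sum.cong)
      fix i
      have "(k i / u i) powr (-p) = k i powr (-p) / v i"
        using k[of i] u[of i] by (simp add: powr_divide v_def)
      then show "\<theta> i * (k i / u i) powr (-p) = y i * k i powr (-p) / c"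
        using v[of i] by (simp add: \<theta>_def)
    qed simp
    also have "(\<Sum>i\<in>UNIV. y i * k i powr (-p))
        \<le> (\<Sum>i\<in>UNIV. y i * (\<Sum>j\<in>UNIV. (cmod (U $ i $ j))\<^sup>2 * g j powr (-p)))"
    proof (intro sum_mono mult_left_mono y)
      fix i
      show "k i powr (-p) \<le> (\<Sum>j\<in>UNIV. (cmod (U $ i $ j))\<^sup>2 * g j powr (-p))"
        unfolding k_def
        using convex_on_sum[OF _ _ convex_on_powr_neg[OF p] unitary_row_sum[OF U, of i], of g] g
        by simp
    qed
    also have "\<dots> \<le> N (real_diag (\<lambda>j. g j powr (-p)))"
      by (rule y(3)[OF U])
    finally have main: "r powr (-p) * c \<le> N (real_diag (\<lambda>j. g j powr (-p)))"
      using c by (simp add: field_simps divide_right_mono)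
    have "anti N p g \<le> (r powr (-p) * c) powr (-1/p)"
      unfolding anti_def using main r c p by (intro powr_mono2') auto
    also have "\<dots> = r * anti N p u"
      using r c p by (simp add: powr_mult powr_powr anti_u)
    also have "\<dots> = (\<Sum>i\<in>UNIV. q i * k i)"
      by (simp add: r_def q_def sum_distrib_left mult.commute mult.left_commute)
    finally show ?thesis
      by (simp add: k_def)
  qed
  have "anti_dominating N p q"
    unfolding anti_dominating_def using q0 qg by blast
  then show ?thesis
    using qu by blast
qed

lemma anti_nonneg [simp]: "0 \<le> anti N p h"
  by (simp add: anti_def)

lemma anti_mono:
  assumes N: "symmetric_norm (N :: complex^'n^'n \<Rightarrow> real)" and p: "0 < p"
    and "\<And>i. 0 < s i" "\<And>i. s i \<le> t i"
  shows "anti N p s \<le> anti N p t"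
proof -
  have t: "0 < t i" for i
    using assms(3,4)[of i] by linarith
  have "N (real_diag (\<lambda>i. t i powr (-p))) \<le> N (real_diag (\<lambda>i. s i powr (-p)))"
  proof (intro symmetric_norm_mono[OF N] powr_mono2')
    show "0 < t i powr (-p)" for i
      using t[of i] by simp
  qed (use assms in auto)
  moreover have "0 < N (real_diag (\<lambda>i. t i powr (-p)))"
    using symmetric_norm_real_diag_pos[OF N, of _ undefined] t[of undefined] by simp
  ultimately show ?thesis
    unfolding anti_def using p by (intro powr_mono2') auto
qed

lemma anti_scale:
  assumes N: "symmetric_norm N" and p: "0 < p" and c: "0 < c" and h: "\<And>i. 0 < h i"
  shows "anti N p (\<lambda>i. c * h i) = c * anti N p h"
proof -
  have "N (real_diag (\<lambda>i. (c * h i) powr (-p))) = c powr (-p) * N (real_diag (\<lambda>i. h i powr (-p)))"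
    using symmetric_norm_real_diag_scale[OF N, of "c powr (-p)" "\<lambda>i. h i powr (-p)"] h c
    by (simp add: powr_mult less_imp_le)
  then show ?thesis
    using c p symmetric_normD(1)[OF N]
    by (simp add: anti_def powr_mult powr_powr)
qed

section \<open>Positive definite matrices\<close>

definition pos_def :: "complex^'n^'n \<Rightarrow> bool"
  where "pos_def A \<longleftrightarrow> hermitian A \<and> (\<forall>x. x \<noteq> 0 \<longrightarrow> 0 < x \<bullet> (A *v x))"

lemma ctranspose_invertible:
  assumes "invertible S"
  shows "invertible (ctranspose S)"
proof -
  obtain T where "S ** T = mat 1" "T ** S = mat 1"
    using assms by (auto simp: invertible_def)
  moreover have "ctranspose (mat 1) = (mat 1 :: complex^'n^'n)"
    using ctranspose_real_diag[of "\<lambda>_. 1"] by (simp add: real_diag_const)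
  ultimately show ?thesis
    unfolding invertible_def by (metis ctranspose_mult)
qed

lemma ctranspose_vector_nonzero:
  assumes "invertible S" and "x \<noteq> 0"
  shows "\<exists>j. (ctranspose S *v x) $ j \<noteq> 0"
proof -
  obtain T where "T ** ctranspose S = mat 1"
    using ctranspose_invertible[OF assms(1)] by (auto simp: invertible_def)
  then have "T *v (ctranspose S *v x) = x"
    by (simp add: matrix_vector_mul_assoc)
  then have "ctranspose S *v x \<noteq> 0"
    using assms(2) by auto
  then show ?thesis
    by (simp add: vec_eq_iff)
qed

lemma pos_def_diag_inI:
  assumes "invertible S" and d: "\<And>i. 0 < d i"
  shows "pos_def (diag_in S d)"
  unfolding pos_def_def
proof (intro conjI allI impI)
  show "hermitian (diag_in S d)"
    by (rule diag_in_hermitian)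
  fix x :: "complex^'a"
  assume "x \<noteq> 0"
  then obtain j where "(ctranspose S *v x) $ j \<noteq> 0"
    using ctranspose_vector_nonzero[OF assms(1)] by blast
  then show "0 < x \<bullet> (diag_in S d *v x)"
    unfolding inner_diag_in using d by (intro sum_pos2[of _ j]) (auto simp: less_imp_le)
qed

lemma unitary_invertible: "unitary U \<Longrightarrow> invertible U"
  by (auto simp: unitary_def invertible_def)

lemma inner_diag_in_column:
  assumes "unitary V"
  shows "(V *v axis i 1) \<bullet> (diag_in U t *v (V *v axis i 1))
       = (\<Sum>j\<in>UNIV. (cmod ((ctranspose V ** U) $ i $ j))\<^sup>2 * t j)"
proof -
  have "(ctranspose U *v (V *v axis i 1)) $ j = cnj ((ctranspose V ** U) $ i $ j)" for j
    by (simp add: matrix_vector_mul_assoc matrix_vector_mult_def axis_def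
        if_distrib[of "\<lambda>x. _ * x"] matrix_matrix_mult_def mult.commute cong: if_cong)
  then show ?thesis
    by (simp add: inner_diag_in mult.commute)
qed

lemma unitary_column_norm: "unitary U \<Longrightarrow> norm (U *v axis i 1) = 1"
  by (simp add: norm_unitary norm_axis_1)

lemma inner_diag_in_eigenvector:
  assumes "unitary U"
  shows "(U *v axis i 1) \<bullet> (diag_in U l *v (U *v axis i 1)) = l i"
  unfolding inner_diag_in_column[OF assms] unitaryD(1)[OF assms]
  by (simp add: mat_def if_distrib[of cmod] if_distrib[of "\<lambda>x. x\<^sup>2"]
      if_distrib[of "\<lambda>x. x * _"] cong: if_cong)

lemma pos_def_diag_in_iff:
  assumes "unitary U"
  shows "pos_def (diag_in U l) \<longleftrightarrow> (\<forall>i. 0 < l i)"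
proof
  assume h: "pos_def (diag_in U l)"
  have "U *v axis i 1 \<noteq> 0" for i
    using unitary_column_norm[OF assms, of i] by auto
  then show "\<forall>i. 0 < l i"
    using h inner_diag_in_eigenvector[OF assms] unfolding pos_def_def by metis
qed (use assms unitary_invertible pos_def_diag_inI in blast)

lemma pos_def_diagonalisation:
  assumes "pos_def A"
  obtains U a where "unitary U" "\<And>i. 0 < a i" "A = diag_in U a"
proof -
  obtain U a where U: "unitary U" "A = diag_in U a"
    using assms hermitian_diagonalisation unfolding pos_def_def by metis
  moreover have "\<forall>i. 0 < a i"
    using assms pos_def_diag_in_iff[OF U(1)] U(2) by simp
  ultimately show ?thesis
    using that[of U a] by blast
qed

text \<open>Hadamard's inequality, in an arbitrary orthonormal basis: the diagonal of a positive
  definite matrix is a doubly stochastic average of its eigenvalues, and \<open>ln\<close> is concave.\<close>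

lemma Hadamard_inequality:
  assumes V: "unitary V" and T: "pos_def T" and \<tau>: "det T = complex_of_real \<tau>"
  shows "\<tau> \<le> (\<Prod>i\<in>UNIV. (V *v axis i 1) \<bullet> (T *v (V *v axis i 1)))"
proof -
  obtain U t where U: "unitary U" and t: "\<And>i. 0 < t i" and T_eq: "T = diag_in U t"
    using pos_def_diagonalisation[OF T] by blast
  define k where "k i = (V *v axis i 1) \<bullet> (T *v (V *v axis i 1))" for i
  define w where "w i j = (cmod ((ctranspose V ** U) $ i $ j))\<^sup>2" for i j
  have VU: "unitary (ctranspose V ** U)"
    using U V by (simp add: unitary_mult unitary_ctranspose)
  have k_eq: "k i = (\<Sum>j\<in>UNIV. w i j * t j)" for i
    by (simp add: k_def w_def T_eq inner_diag_in_column[OF V])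
  have k: "0 < k i" for i
    using T unitary_column_norm[OF V, of i] unfolding k_def pos_def_def
    by (metis norm_zero zero_neq_one)
  have "(\<Sum>j\<in>UNIV. w i j * ln (t j)) \<le> ln (k i)" for i
    unfolding k_eq
    using concave_on_sum[OF _ _ ln_concave unitary_row_sum[OF VU, of i], of t] t
    by (simp add: w_def)
  then have "(\<Sum>i\<in>UNIV. \<Sum>j\<in>UNIV. w i j * ln (t j)) \<le> (\<Sum>i\<in>UNIV. ln (k i))"
    by (rule sum_mono)
  also have "(\<Sum>i\<in>UNIV. \<Sum>j\<in>UNIV. w i j * ln (t j)) = (\<Sum>j\<in>UNIV. ln (t j))"
    by (subst sum.swap)
       (simp add: sum_distrib_right[symmetric] w_def unitary_column_sum[OF VU])
  finally have "exp (\<Sum>j\<in>UNIV. ln (t j)) \<le> exp (\<Sum>i\<in>UNIV. ln (k i))"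
    by simp
  then have "(\<Prod>j\<in>UNIV. t j) \<le> (\<Prod>i\<in>UNIV. k i)"
    using t k by (simp add: exp_sum)
  moreover have "\<tau> = (\<Prod>j\<in>UNIV. t j)"
    using \<tau> by (metis T_eq U det_diag_in of_real_eq_iff)
  ultimately show ?thesis
    by (simp add: k_def)
qed

section \<open>Weighted geometric means of positive definite matrices\<close>

text \<open>Hoelder's inequality; after normalising by the weighted mean \<open>m\<close> of \<open>d\<close>, each term is
  an instance of Young's inequality.\<close>

lemma sum_powr_Hoelder:
  fixes w d :: "'i \<Rightarrow> real"
  assumes w: "\<And>i. i \<in> I \<Longrightarrow> 0 \<le> w i" and d: "\<And>i. i \<in> I \<Longrightarrow> 0 < d i"
    and \<alpha>: "0 \<le> \<alpha>" "\<alpha> \<le> 1" and fin: "finite I"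
  shows "(\<Sum>i\<in>I. w i * d i powr \<alpha>) \<le> (\<Sum>i\<in>I. w i) powr (1 - \<alpha>) * (\<Sum>i\<in>I. w i * d i) powr \<alpha>"
proof (cases "(\<Sum>i\<in>I. w i) = 0")
  case True
  then have "w i = 0" if "i \<in> I" for i
    using w fin that by (simp add: sum_nonneg_eq_0_iff)
  then show ?thesis
    by simp
next
  case False
  define W where "W = (\<Sum>i\<in>I. w i)"
  define D where "D = (\<Sum>i\<in>I. w i * d i)"
  have W: "0 < W"
    using False w by (simp add: W_def sum_nonneg order_less_le)
  then obtain k where k: "k \<in> I" "0 < w k"
    unfolding W_def by (metis not_less sum_nonpos)
  have D: "0 < D"
    unfolding D_def using k w d fin by (intro sum_pos2[of _ k]) (auto simp: less_imp_le)
  define m where "m = D / W"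
  have m: "0 < m"
    using W D by (simp add: m_def)
  have "(\<Sum>i\<in>I. w i * d i powr \<alpha>) \<le> (\<Sum>i\<in>I. w i * (m powr \<alpha> * ((1 - \<alpha>) + \<alpha> * (d i / m))))"
  proof (intro sum_mono mult_left_mono w)
    fix i
    assume i: "i \<in> I"
    have "d i powr \<alpha> = m powr \<alpha> * (d i / m) powr \<alpha>"
      using d[OF i] m by (simp add: powr_mult[symmetric])
    also have "(d i / m) powr \<alpha> \<le> (1 - \<alpha>) + \<alpha> * (d i / m)"
      using Youngs_inequality_0[of "1 - \<alpha>" \<alpha> 1 "d i / m"] \<alpha> d[OF i] m by simp
    finally show "d i powr \<alpha> \<le> m powr \<alpha> * ((1 - \<alpha>) + \<alpha> * (d i / m))"
      by (simp add: mult_left_mono)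
  qed
  also have "\<dots> = m powr \<alpha> * ((1 - \<alpha>) * W + \<alpha> * D / m)"
    by (simp add: W_def D_def sum_distrib_left sum_divide_distrib sum.distrib[symmetric] algebra_simps)
  also have "\<alpha> * D / m = \<alpha> * W"
    using W D by (simp add: m_def)
  also have "m powr \<alpha> * ((1 - \<alpha>) * W + \<alpha> * W) = W powr (1 - \<alpha>) * D powr \<alpha>"
    using W D by (simp add: m_def powr_divide powr_diff algebra_simps)
  finally show ?thesis
    by (simp add: W_def D_def)
qed

text \<open>In the coordinates of one congruence the pair is \<open>1\<close>, \<open>d\<close> and the mean is the scalar one,
  \<open>d powr \<alpha>\<close>. Here \<open>S = R ** W\<close>, where \<open>R\<close> is the square root of \<open>A\<close> and the unitary
  \<open>W\<close> diagonalises the middle factor of the definition of the mean.\<close>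

lemma geo_mean_inv_congruence:
  assumes A: "pos_def A" and B: "pos_def B"
  shows "\<exists>S d. invertible S \<and> (\<forall>i. 0 < d i) \<and> A = diag_in S (\<lambda>_. 1) \<and> B = diag_in S d \<and>
    (\<forall>\<alpha>. geo_mean_inv \<alpha> A B = diag_in S (\<lambda>i. d i powr \<alpha>))"
proof -
  obtain U a where U: "unitary U" and a: "\<And>i. 0 < a i" and A_eq: "A = diag_in U a"
    using pos_def_diagonalisation[OF A] by blast
  define R where "R = diag_in U (\<lambda>i. a i powr (1/2))"
  define R' where "R' = diag_in U (\<lambda>i. a i powr (-1/2))"
  have R: "mat_powr A (1/2) = R" "mat_powr A (-1/2) = R'"
    by (simp_all add: R_def R'_def A_eq mat_powr_diag_in[OF U])
  have inv: "R ** R' = mat 1" "R' ** R = mat 1"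
    using a U by (simp_all add: R_def R'_def diag_in_mult powr_add[symmetric] diag_in_const
        less_imp_neq[symmetric])
  have RR: "R ** R = A"
    using a U by (simp add: R_def A_eq diag_in_mult powr_add[symmetric] less_imp_le)
  have herm: "ctranspose R = R" "ctranspose R' = R'"
    using diag_in_hermitian by (auto simp: R_def R'_def hermitian_def)
  define C where "C = R' ** B ** R'"
  have "pos_def C"
    unfolding pos_def_def
  proof (intro conjI allI impI)
    show "hermitian C"
      using B by (simp add: C_def hermitian_def pos_def_def ctranspose_mult herm matrix_mul_assoc)
    fix x :: "complex^'a"
    assume "x \<noteq> 0"
    moreover have "R *v (R' *v x) = x"
      by (simp add: matrix_vector_mul_assoc inv)
    ultimately have "R' *v x \<noteq> 0"
      by auto
    then have "0 < (R' *v x) \<bullet> (B *v (R' *v x))"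
      using B by (simp add: pos_def_def)
    then show "0 < x \<bullet> (C *v x)"
      using inner_matrix_vector[of x R' "B *v (R' *v x)"]
      by (simp add: C_def matrix_vector_mul_assoc[symmetric] herm)
  qed
  then obtain W d where W: "unitary W" and d: "\<And>i. 0 < d i" and C_eq: "C = diag_in W d"
    using pos_def_diagonalisation by blast
  define S where "S = R ** W"
  have S_diag: "diag_in S g = R ** diag_in W g ** R" for g
    by (simp add: S_def diag_in_def ctranspose_mult herm matrix_mul_assoc)
  have "invertible S"
  proof -
    have "S ** (ctranspose W ** R') = R ** (W ** ctranspose W) ** R'"
      by (simp add: S_def matrix_mul_assoc)
    then have "S ** (ctranspose W ** R') = mat 1"
      using W inv by (simp add: unitaryD)
    then show ?thesis
      unfolding invertible_def using matrix_left_right_inverse by blast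
  qed
  moreover have "A = diag_in S (\<lambda>_. 1)"
    using W RR by (simp add: S_diag diag_in_const)
  moreover have "B = diag_in S d"
  proof -
    have "R ** C ** R = (R ** R') ** B ** (R' ** R)"
      by (simp add: C_def matrix_mul_assoc)
    then show ?thesis
      by (simp add: S_diag inv flip: C_eq)
  qed
  moreover have "geo_mean_inv \<alpha> A B = diag_in S (\<lambda>i. d i powr \<alpha>)" for \<alpha>
    unfolding geo_mean_inv_def R C_def[symmetric] S_diag
    by (simp add: C_eq mat_powr_diag_in[OF W])
  ultimately show ?thesis
    using d by blast
qed

lemma pos_def_geo_mean_inv:
  assumes "pos_def A" "pos_def B"
  shows "pos_def (geo_mean_inv \<alpha> A B)"
proof -
  obtain S d where S: "invertible S" "\<And>i. 0 < d i"
    "\<And>\<alpha>. geo_mean_inv \<alpha> A B = diag_in S (\<lambda>i. d i powr \<alpha>)"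
    using geo_mean_inv_congruence[OF assms] by blast
  show ?thesis
    unfolding S(3) using S(1,2) by (intro pos_def_diag_inI) (auto simp: less_imp_neq[symmetric])
qed

lemma geo_mean_inv_0_1:
  assumes "pos_def A" "pos_def B"
  shows "geo_mean_inv 0 A B = A" "geo_mean_inv 1 A B = B"
proof -
  obtain S d where S: "\<And>i. 0 < d i" "A = diag_in S (\<lambda>_. 1)" "B = diag_in S d"
    "\<And>\<alpha>. geo_mean_inv \<alpha> A B = diag_in S (\<lambda>i. d i powr \<alpha>)"
    using geo_mean_inv_congruence[OF assms] by blast
  have "d i \<noteq> 0" "0 \<le> d i" for i
    using S(1)[of i] by auto
  then show "geo_mean_inv 0 A B = A" "geo_mean_inv 1 A B = B"
    by (simp_all add: S(4)) (simp_all add: S(2,3))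
qed

lemma inner_geo_mean_inv_le:
  assumes A: "pos_def A" and B: "pos_def B" and \<alpha>: "0 \<le> \<alpha>" "\<alpha> \<le> 1"
  shows "x \<bullet> (geo_mean_inv \<alpha> A B *v x) \<le> (x \<bullet> (A *v x)) powr (1 - \<alpha>) * (x \<bullet> (B *v x)) powr \<alpha>"
proof -
  obtain S d where S: "\<And>i. 0 < d i" "A = diag_in S (\<lambda>_. 1)" "B = diag_in S d"
    "\<And>\<alpha>. geo_mean_inv \<alpha> A B = diag_in S (\<lambda>i. d i powr \<alpha>)"
    using geo_mean_inv_congruence[OF A B] by blast
  show ?thesis
    unfolding S(4) unfolding S(2,3) inner_diag_in
    using sum_powr_Hoelder[of UNIV "\<lambda>j. (cmod ((ctranspose S *v x) $ j))\<^sup>2" d \<alpha>] S(1) \<alpha>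
    by (simp add: mult.commute)
qed

lemma det_geo_mean_inv:
  assumes "pos_def A" "pos_def B"
    and det: "det A = complex_of_real a" "det B = complex_of_real b" and pos: "0 < a" "0 < b"
  shows "det (geo_mean_inv \<alpha> A B) = complex_of_real (a powr (1 - \<alpha>) * b powr \<alpha>)"
proof -
  obtain S d where S: "\<And>i. 0 < d i" "A = diag_in S (\<lambda>_. 1)" "B = diag_in S d"
    "\<And>\<alpha>. geo_mean_inv \<alpha> A B = diag_in S (\<lambda>i. d i powr \<alpha>)"
    using geo_mean_inv_congruence[OF assms(1,2)] by blast
  have detS: "det (diag_in S g) = det S * det (ctranspose S) * complex_of_real (\<Prod>i\<in>UNIV. g i)" for g
    by (simp add: diag_in_def det_mul det_real_diag)
  have da: "det S * det (ctranspose S) = complex_of_real a"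
    using detS[of "\<lambda>_. 1"] det(1) S(2) by simp
  define q where "q = (\<Prod>i\<in>UNIV. d i)"
  have q: "0 < q"
    using S(1) by (simp add: q_def prod_pos)
  have "complex_of_real b = complex_of_real (a * q)"
    using detS[of d] det(2) S(3) by (simp add: da q_def)
  then have b: "b = a * q"
    using of_real_eq_iff by blast
  have "(\<Prod>i\<in>UNIV. d i powr \<alpha>) = q powr \<alpha>"
    using S(1) by (simp add: q_def powr_def exp_sum[symmetric] ln_prod sum_distrib_left prod_pos
        less_imp_neq[symmetric] prod_zero_iff)
  then have "det (geo_mean_inv \<alpha> A B) = complex_of_real (a * q powr \<alpha>)"
    by (simp add: S(4) detS da)
  also have "a * q powr \<alpha> = a powr (1 - \<alpha>) * b powr \<alpha>"
    using pos q by (simp add: b powr_mult powr_diff)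
  finally show ?thesis .
qed

section \<open>Monotonicity of the geometric mean\<close>

text \<open>The constant in the representation of \<open>d powr \<alpha>\<close> as a mixture of \<open>d / (s + d)\<close>
  over \<open>s > 0\<close>. Only its being positive and finite matters.\<close>

definition stieltjes_mass :: "real \<Rightarrow> ennreal"
  where "stieltjes_mass \<alpha> = (\<integral>\<^sup>+s. ennreal (indicator {0<..} s * s powr (\<alpha> - 1) * (1 / (s + 1))) \<partial>lborel)"

lemma stieltjes_integral:
  assumes d: "0 < d"
  shows "(\<integral>\<^sup>+s. ennreal (indicator {0<..} s * s powr (\<alpha> - 1) * (d / (s + d))) \<partial>lborel)
       = ennreal (d powr \<alpha>) * stieltjes_mass \<alpha>"
proof -
  have "(\<integral>\<^sup>+s. ennreal (indicator {0<..} s * s powr (\<alpha> - 1) * (d / (s + d))) \<partial>lborel)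
      = ennreal \<bar>d\<bar> * (\<integral>\<^sup>+s. ennreal (indicator {0<..} (0 + d * s) * (0 + d * s) powr (\<alpha> - 1) *
          (d / ((0 + d * s) + d))) \<partial>lborel)"
    by (rule nn_integral_real_affine) (use d in auto)
  also have "\<dots> = ennreal d * (\<integral>\<^sup>+s. ennreal (d powr (\<alpha> - 1)) *
      ennreal (indicator {0<..} s * s powr (\<alpha> - 1) * (1 / (s + 1))) \<partial>lborel)"
  proof -
    have "indicator {0<..} (0 + d * s) * (0 + d * s) powr (\<alpha> - 1) * (d / ((0 + d * s) + d))
        = d powr (\<alpha> - 1) * (indicator {0<..} s * s powr (\<alpha> - 1) * (1 / (s + 1)))" for s :: real
    proof (cases "0 < s")
      case True
      have "d / (d * s + d) = d * 1 / (d * (s + 1))"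
        by (simp add: algebra_simps)
      then have "d / (d * s + d) = 1 / (s + 1)"
        using d by simp
      then show ?thesis
        using d True by (simp add: powr_mult)
    qed (use d in \<open>auto simp: zero_less_mult_iff\<close>)
    then show ?thesis
      using d by (simp add: ennreal_mult'[symmetric])
  qed
  also have "\<dots> = ennreal d * (ennreal (d powr (\<alpha> - 1)) * stieltjes_mass \<alpha>)"
    unfolding stieltjes_mass_def by (subst nn_integral_cmult) auto
  also have "\<dots> = ennreal (d * d powr (\<alpha> - 1)) * stieltjes_mass \<alpha>"
    using d by (simp add: ennreal_mult mult.assoc)
  also have "d * d powr (\<alpha> - 1) = d powr \<alpha>"
    using d by (simp add: powr_diff)
  finally show ?thesis .
qed

lemma stieltjes_mass_pos: "0 < stieltjes_mass \<alpha>"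
proof -
  have "0 < (\<integral>\<^sup>+s. ennreal (min 1 (2 powr (\<alpha> - 1)) / 3) * indicator {1..2::real} s \<partial>lborel)"
    by (simp add: nn_integral_cmult_indicator)
  also have "\<dots> \<le> stieltjes_mass \<alpha>"
    unfolding stieltjes_mass_def
  proof (rule nn_integral_mono)
    fix s :: real
    show "ennreal (min 1 (2 powr (\<alpha> - 1)) / 3) * indicator {1..2} s
        \<le> ennreal (indicator {0<..} s * s powr (\<alpha> - 1) * (1 / (s + 1)))"
    proof (cases "s \<in> {1..2}")
      case True
      then have "min 1 (2 powr (\<alpha> - 1)) \<le> s powr (\<alpha> - 1)"
        using powr_mono2[of "\<alpha> - 1" 1 s] powr_mono2'[of "\<alpha> - 1" s 2]
        by (cases "0 \<le> \<alpha> - 1") (auto simp: min_le_iff_disj)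
      moreover have "1 / 3 \<le> 1 / (s + 1)"
        using True by (intro divide_left_mono) auto
      ultimately have "min 1 (2 powr (\<alpha> - 1)) * (1 / 3) \<le> s powr (\<alpha> - 1) * (1 / (s + 1))"
        by (intro mult_mono) auto
      then show ?thesis
        using True by (simp add: ennreal_leI)
    qed simp
  qed
  finally show ?thesis .
qed

lemma stieltjes_mass_finite:
  assumes "0 < \<alpha>" "\<alpha> < 1"
  shows "stieltjes_mass \<alpha> < \<infinity>"
proof -
  have I0: "(\<integral>\<^sup>+s. ennreal (s powr (\<alpha> - 1)) * indicator {0..1} s \<partial>lborel)
      = ennreal (1 powr (\<alpha> - 1 + 1) / (\<alpha> - 1 + 1))"
    by (intro nn_integral_has_integral_lebesgue' has_integral_powr_from_0) (use assms in auto)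
  have I1: "(\<integral>\<^sup>+s. ennreal (s powr (\<alpha> - 2)) * indicator {1..} s \<partial>lborel)
      = ennreal (- (1 powr (\<alpha> - 2 + 1)) / (\<alpha> - 2 + 1))"
    by (intro nn_integral_has_integral_lebesgue' has_integral_powr_to_inf) (use assms in auto)
  have "stieltjes_mass \<alpha> \<le> (\<integral>\<^sup>+s. ennreal (s powr (\<alpha> - 1)) * indicator {0..1} s
      + ennreal (s powr (\<alpha> - 2)) * indicator {1..} s \<partial>lborel)"
    unfolding stieltjes_mass_def
  proof (rule nn_integral_mono)
    fix s :: real
    consider "s \<le> 0" | "0 < s" "s \<le> 1" | "1 < s"
      by linarith
    then show "ennreal (indicator {0<..} s * s powr (\<alpha> - 1) * (1 / (s + 1)))
        \<le> ennreal (s powr (\<alpha> - 1)) * indicator {0..1} s + ennreal (s powr (\<alpha> - 2)) * indicator {1..} s"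
    proof cases
      case 2
      have "s powr (\<alpha> - 1) * (1 / (s + 1)) \<le> s powr (\<alpha> - 1) * 1"
        using 2 by (intro mult_left_mono) auto
      then have "ennreal (s powr (\<alpha> - 1) * (1 / (s + 1))) \<le> ennreal (s powr (\<alpha> - 1))"
        by (intro ennreal_leI) simp
      then show ?thesis
        using 2 by (simp add: add_increasing2)
    next
      case 3
      have "s powr (\<alpha> - 1) * (1 / (s + 1)) \<le> s powr (\<alpha> - 1) * (1 / s)"
        using 3 by (intro mult_left_mono divide_left_mono) auto
      also have "\<dots> = s powr (\<alpha> - 2)"
        using 3 powr_diff[of s "\<alpha> - 1" 1] by (simp add: algebra_simps)
      finally have "ennreal (s powr (\<alpha> - 1) * (1 / (s + 1))) \<le> ennreal (s powr (\<alpha> - 2))"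
        by (rule ennreal_leI)
      then show ?thesis
        using 3 by simp
    qed simp
  qed
  also have "\<dots> = ennreal (1 powr (\<alpha> - 1 + 1) / (\<alpha> - 1 + 1))
      + ennreal (- (1 powr (\<alpha> - 2 + 1)) / (\<alpha> - 2 + 1))"
    by (subst nn_integral_add) (simp_all add: I0 I1)
  also have "\<dots> < \<infinity>"
    by simp
  finally show ?thesis .
qed

text \<open>The form on the left is the infimum over \<open>y\<close> of the right-hand side, which is computed
  from the two matrices without reference to the congruence and increases with both of them. In
  each coordinate this is the minimisation of \<open>s * u\<^sup>2 + d * v\<^sup>2\<close> for fixed \<open>u + v\<close>.\<close>

lemma parallel_sum_le:
  assumes d: "\<And>j. 0 < d j" and s: "0 < s"
  shows "s * (x \<bullet> (diag_in S (\<lambda>j. d j / (s + d j)) *v x))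
       \<le> s * (y \<bullet> (diag_in S (\<lambda>_. 1) *v y)) + (x - y) \<bullet> (diag_in S d *v (x - y))"
proof -
  define \<xi> where "\<xi> = ctranspose S *v x"
  define \<eta> where "\<eta> = ctranspose S *v y"
  have diff: "ctranspose S *v (x - y) = \<xi> - \<eta>"
    by (simp add: \<xi>_def \<eta>_def matrix_vector_mult_diff_distrib)
  have "s * (d j / (s + d j) * (cmod (\<xi> $ j))\<^sup>2) \<le> s * (cmod (\<eta> $ j))\<^sup>2 + d j * (cmod (\<xi> $ j - \<eta> $ j))\<^sup>2" for j
  proof -
    define p where "p = cmod (\<eta> $ j)"
    define q where "q = cmod (\<xi> $ j - \<eta> $ j)"
    have sd: "0 < s + d j"
      using d[of j] s by simp
    have "cmod (\<xi> $ j) \<le> p + q"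
      using norm_triangle_ineq[of "\<eta> $ j" "\<xi> $ j - \<eta> $ j"] by (simp add: p_def q_def)
    then have "s * d j * (cmod (\<xi> $ j))\<^sup>2 \<le> s * d j * (p + q)\<^sup>2"
      using d[of j] s by (intro mult_left_mono power_mono) auto
    also have "s * d j * (p + q)\<^sup>2 = (s + d j) * (s * p\<^sup>2 + d j * q\<^sup>2) - (s * p - d j * q)\<^sup>2"
      by (simp add: power2_eq_square algebra_simps)
    also have "\<dots> \<le> (s + d j) * (s * p\<^sup>2 + d j * q\<^sup>2)"
      by simp
    finally show ?thesis
      using sd by (simp add: p_def q_def pos_divide_le_eq mult.commute mult.left_commute)
  qed
  then have "(\<Sum>j\<in>UNIV. s * (d j / (s + d j) * (cmod (\<xi> $ j))\<^sup>2))
      \<le> (\<Sum>j\<in>UNIV. s * (cmod (\<eta> $ j))\<^sup>2 + d j * (cmod (\<xi> $ j - \<eta> $ j))\<^sup>2)"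
    by (rule sum_mono)
  then show ?thesis
    by (simp add: inner_diag_in diff flip: \<xi>_def \<eta>_def)
       (simp add: sum.distrib sum_distrib_left)
qed

lemma parallel_sum_attained:
  assumes S: "invertible S" and d: "\<And>j. 0 < d j" and s: "0 < s"
  shows "\<exists>y. s * (x \<bullet> (diag_in S (\<lambda>j. d j / (s + d j)) *v x))
       = s * (y \<bullet> (diag_in S (\<lambda>_. 1) *v y)) + (x - y) \<bullet> (diag_in S d *v (x - y))"
proof -
  obtain T where T: "ctranspose S ** T = mat 1"
    using ctranspose_invertible[OF S] by (auto simp: invertible_def)
  define \<xi> where "\<xi> = ctranspose S *v x"
  define \<eta> where "\<eta> = (\<chi> j. complex_of_real (d j / (s + d j)) * \<xi> $ j)"
  define y where "y = T *v \<eta>"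
  have y: "ctranspose S *v y = \<eta>"
    by (simp add: y_def matrix_vector_mul_assoc T)
  have diff: "ctranspose S *v (x - y) = \<xi> - \<eta>"
    by (simp add: y \<xi>_def[symmetric] matrix_vector_mult_diff_distrib)
  have "s * (d j / (s + d j) * (cmod (\<xi> $ j))\<^sup>2) = s * (cmod (\<eta> $ j))\<^sup>2 + d j * (cmod (\<xi> $ j - \<eta> $ j))\<^sup>2" for j
  proof -
    define r where "r = cmod (\<xi> $ j)"
    define k where "k = d j / (s + d j)"
    have sd: "s + d j \<noteq> 0" "0 \<le> k" "0 \<le> 1 - k"
      using d[of j] s by (auto simp: k_def field_simps)
    have \<eta>j: "\<eta> $ j = complex_of_real k * \<xi> $ j"
      by (simp only: \<eta>_def k_def vec_lambda_beta)
    have "cmod (\<eta> $ j) = k * r"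
      using sd by (simp add: \<eta>j norm_mult r_def)
    moreover have "cmod (\<xi> $ j - \<eta> $ j) = (1 - k) * r"
    proof -
      have "\<xi> $ j - \<eta> $ j = complex_of_real (1 - k) * \<xi> $ j"
        by (simp add: \<eta>j algebra_simps)
      then show ?thesis
        using sd by (simp add: norm_mult r_def del: of_real_diff)
    qed
    moreover have sk: "s * k = s * k\<^sup>2 + d j * (1 - k)\<^sup>2"
    proof -
      have dk: "d j = k * (s + d j)"
        using sd by (simp add: k_def)
      have "s * k\<^sup>2 + d j * (1 - k)\<^sup>2 = k * (k * (s + d j)) + d j - 2 * k * d j"
        by (simp add: power2_eq_square algebra_simps)
      also have "\<dots> = d j - k * d j"
        by (simp flip: dk)
      also have "\<dots> = s * k"
        using dk by (simp add: algebra_simps)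
      finally show ?thesis ..
    qed
    moreover have "s * (k * r\<^sup>2) = s * (k * r)\<^sup>2 + d j * ((1 - k) * r)\<^sup>2"
    proof -
      have "s * (k * r\<^sup>2) = (s * k) * r\<^sup>2"
        by simp
      also have "\<dots> = s * (k * r)\<^sup>2 + d j * ((1 - k) * r)\<^sup>2"
        by (subst sk) (simp only: power_mult_distrib distrib_right mult.assoc)
      finally show ?thesis .
    qed
    ultimately show ?thesis
      by (simp only: k_def r_def)
  qed
  then have "(\<Sum>j\<in>UNIV. s * (d j / (s + d j) * (cmod (\<xi> $ j))\<^sup>2))
      = (\<Sum>j\<in>UNIV. s * (cmod (\<eta> $ j))\<^sup>2 + d j * (cmod (\<xi> $ j - \<eta> $ j))\<^sup>2)"
    by (rule sum.cong[OF refl])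
  then show ?thesis
    by (intro exI[of _ y]) (simp add: inner_diag_in diff y sum.distrib sum_distrib_left flip: \<xi>_def)
qed

text \<open>Monotonicity of the mean in both arguments: \<open>d powr \<alpha>\<close> is a positive mixture of the
  functions \<open>d / (s + d)\<close>, and for each of them the quadratic form is monotone.\<close>

theorem geo_mean_inv_mono:
  assumes A: "pos_def A" and B: "pos_def B" and A': "pos_def A'" and B': "pos_def B'"
    and AA': "\<And>x. x \<bullet> (A *v x) \<le> x \<bullet> (A' *v x)" and BB': "\<And>x. x \<bullet> (B *v x) \<le> x \<bullet> (B' *v x)"
    and \<alpha>: "0 \<le> \<alpha>" "\<alpha> \<le> 1"
  shows "x \<bullet> (geo_mean_inv \<alpha> A B *v x) \<le> x \<bullet> (geo_mean_inv \<alpha> A' B' *v x)"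
proof (cases "\<alpha> = 0 \<or> \<alpha> = 1")
  case True
  then show ?thesis
    using geo_mean_inv_0_1[OF A B] geo_mean_inv_0_1[OF A' B'] AA' BB' by auto
next
  case False
  then have \<alpha>': "0 < \<alpha>" "\<alpha> < 1"
    using \<alpha> by auto
  obtain S d where S: "invertible S" "\<And>i. 0 < d i" "A = diag_in S (\<lambda>_. 1)" "B = diag_in S d"
    "\<And>\<alpha>. geo_mean_inv \<alpha> A B = diag_in S (\<lambda>i. d i powr \<alpha>)"
    using geo_mean_inv_congruence[OF A B] by blast
  obtain S' d' where S': "invertible S'" "\<And>i. 0 < d' i" "A' = diag_in S' (\<lambda>_. 1)" "B' = diag_in S' d'"
    "\<And>\<alpha>. geo_mean_inv \<alpha> A' B' = diag_in S' (\<lambda>i. d' i powr \<alpha>)"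
    using geo_mean_inv_congruence[OF A' B'] by blast
  define w where "w j = (cmod ((ctranspose S *v x) $ j))\<^sup>2" for j
  define w' where "w' j = (cmod ((ctranspose S' *v x) $ j))\<^sup>2" for j
  have w: "0 \<le> w j" "0 \<le> w' j" for j
    by (simp_all add: w_def w'_def)
  have form: "(\<Sum>j\<in>UNIV. w j * (d j / (s + d j))) \<le> (\<Sum>j\<in>UNIV. w' j * (d' j / (s + d' j)))" if s: "0 < s" for s
  proof -
    obtain y where y: "s * (x \<bullet> (diag_in S' (\<lambda>j. d' j / (s + d' j)) *v x)) = s * (y \<bullet> (A' *v y)) + (x - y) \<bullet> (B' *v (x - y))"
      unfolding S'(3,4)
      using parallel_sum_attained[where S = S' and d = d' and x = x, OF S'(1,2) s] by blast
    have "s * (x \<bullet> (diag_in S (\<lambda>j. d j / (s + d j)) *v x)) \<le> s * (y \<bullet> (A *v y)) + (x - y) \<bullet> (B *v (x - y))"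
      using parallel_sum_le[where S = S and d = d and x = x and y = y, OF S(2) s] S(3,4) by simp
    also have "\<dots> \<le> s * (y \<bullet> (A' *v y)) + (x - y) \<bullet> (B' *v (x - y))"
      using AA' BB' s by (intro add_mono mult_left_mono) auto
    finally have "x \<bullet> (diag_in S (\<lambda>j. d j / (s + d j)) *v x) \<le> x \<bullet> (diag_in S' (\<lambda>j. d' j / (s + d' j)) *v x)"
      using s by (simp only: y[symmetric] mult_le_cancel_left_pos)
    then show ?thesis
      by (simp add: inner_diag_in w_def w'_def mult.commute)
  qed
  have mix: "(\<integral>\<^sup>+s. ennreal (indicator {0<..} s * s powr (\<alpha> - 1) * (\<Sum>j\<in>UNIV. v j * (e j / (s + e j)))) \<partial>lborel)
      = ennreal (\<Sum>j\<in>UNIV. v j * e j powr \<alpha>) * stieltjes_mass \<alpha>"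
    if v: "\<And>j. 0 \<le> v j" and e: "\<And>j. 0 < e j" for v e :: "'a \<Rightarrow> real"
  proof -
    have "ennreal (indicator {0<..} s * s powr (\<alpha> - 1) * (\<Sum>j\<in>UNIV. v j * (e j / (s + e j))))
        = (\<Sum>j\<in>UNIV. ennreal (v j) * ennreal (indicator {0<..} s * s powr (\<alpha> - 1) * (e j / (s + e j))))"
      for s :: real
    proof (cases "0 < s")
      case True
      define g where "g j = s powr (\<alpha> - 1) * (e j / (s + e j))" for j
      have nn: "0 \<le> g j" for j
        using True e[of j] by (simp add: g_def)
      have "s powr (\<alpha> - 1) * (\<Sum>j\<in>UNIV. v j * (e j / (s + e j))) = (\<Sum>j\<in>UNIV. v j * g j)"
        by (simp add: g_def sum_distrib_left mult.left_commute)
      moreover have "ennreal (\<Sum>j\<in>UNIV. v j * g j) = (\<Sum>j\<in>UNIV. ennreal (v j) * ennreal (g j))"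
        using v nn by (simp add: ennreal_mult[symmetric] sum_ennreal)
      ultimately show ?thesis
        using True by (simp only: g_def indicator_simps greaterThan_iff mult_1)
    qed simp
    then have "(\<integral>\<^sup>+s. ennreal (indicator {0<..} s * s powr (\<alpha> - 1) * (\<Sum>j\<in>UNIV. v j * (e j / (s + e j)))) \<partial>lborel)
        = (\<Sum>j\<in>UNIV. ennreal (v j) * (ennreal (e j powr \<alpha>) * stieltjes_mass \<alpha>))"
      by (simp add: nn_integral_sum nn_integral_cmult stieltjes_integral[OF e] del: times_divide_eq_right)
    also have "\<dots> = (\<Sum>j\<in>UNIV. ennreal (v j * e j powr \<alpha>) * stieltjes_mass \<alpha>)"
      using v by (simp add: ennreal_mult mult.assoc)
    also have "\<dots> = ennreal (\<Sum>j\<in>UNIV. v j * e j powr \<alpha>) * stieltjes_mass \<alpha>"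
      using v by (simp add: sum_distrib_right[symmetric] sum_ennreal)
    finally show ?thesis .
  qed
  have "ennreal (\<Sum>j\<in>UNIV. w j * d j powr \<alpha>) * stieltjes_mass \<alpha> \<le> ennreal (\<Sum>j\<in>UNIV. w' j * d' j powr \<alpha>) * stieltjes_mass \<alpha>"
    unfolding mix[OF w(1) S(2), symmetric] mix[OF w(2) S'(2), symmetric]
  proof (intro nn_integral_mono ennreal_leI)
    fix s :: real
    show "indicator {0<..} s * s powr (\<alpha> - 1) * (\<Sum>j\<in>UNIV. w j * (d j / (s + d j)))
        \<le> indicator {0<..} s * s powr (\<alpha> - 1) * (\<Sum>j\<in>UNIV. w' j * (d' j / (s + d' j)))"
      using form[of s] by (cases "0 < s") (auto intro!: mult_left_mono)
  qed
  then have "ennreal (\<Sum>j\<in>UNIV. w j * d j powr \<alpha>) \<le> ennreal (\<Sum>j\<in>UNIV. w' j * d' j powr \<alpha>)"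
    using stieltjes_mass_pos[of \<alpha>] stieltjes_mass_finite[OF \<alpha>']
    by (simp add: ennreal_mult_le_mult_iff mult.commute)
  then have "(\<Sum>j\<in>UNIV. w j * d j powr \<alpha>) \<le> (\<Sum>j\<in>UNIV. w' j * d' j powr \<alpha>)"
    using w by (subst (asm) ennreal_le_iff) (auto intro!: sum_nonneg)
  then show ?thesis
    by (simp add: S(5) S'(5) inner_diag_in w_def w'_def mult.commute)
qed

section \<open>Log-majorisation of the eigenvalues of the mean\<close>

lemma inner_diag_in_mono:
  assumes "\<And>i. l i \<le> m i"
  shows "x \<bullet> (diag_in U l *v x) \<le> x \<bullet> (diag_in U m *v x)"
  unfolding inner_diag_in using assms by (intro sum_mono mult_right_mono) auto

lemma inner_diag_in_const:
  assumes "unitary U"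
  shows "x \<bullet> (diag_in U (\<lambda>_. c) *v x) = c * (norm x)\<^sup>2"
proof -
  have "x \<bullet> (diag_in U (\<lambda>_. c) *v x) = c * ((ctranspose U *v x) \<bullet> (ctranspose U *v x))"
    unfolding inner_diag_in by (simp add: inner_vec_def sum_distrib_left dot_square_norm)
  also have "\<dots> = c * (norm x)\<^sup>2"
    by (simp add: norm_unitary[OF unitary_ctranspose[OF assms]] dot_square_norm)
  finally show ?thesis .
qed

text \<open>Truncating both spectra from above makes the mean smaller, by monotonicity, and bounded
  by the mean of the two thresholds. Its determinant is known and is bounded, by Hadamard's
  inequality in the eigenbasis of the untruncated mean, by the truncated eigenvalues of that
  mean.\<close>

lemma geo_mean_inv_truncation:
  assumes U: "unitary U" and V: "unitary V" and W: "unitary W"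
    and a: "\<And>i. 0 < a i" and b: "\<And>i. 0 < b i" and st: "0 < s" "0 < t"
    and \<alpha>: "0 \<le> \<alpha>" "\<alpha> \<le> 1"
    and Z: "geo_mean_inv \<alpha> (diag_in U a) (diag_in V b) = diag_in W z"
  shows "(\<Prod>i\<in>UNIV. min (a i) s) powr (1 - \<alpha>) * (\<Prod>i\<in>UNIV. min (b i) t) powr \<alpha>
       \<le> (\<Prod>i\<in>UNIV. min (z i) (s powr (1 - \<alpha>) * t powr \<alpha>))"
proof -
  define A' where "A' = diag_in U (\<lambda>i. min (a i) s)"
  define B' where "B' = diag_in V (\<lambda>i. min (b i) t)"
  define k where "k i = (W *v axis i 1) \<bullet> (geo_mean_inv \<alpha> A' B' *v (W *v axis i 1))" for i
  have pd: "pos_def (diag_in U a)" "pos_def (diag_in V b)" "pos_def A'" "pos_def B'"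
    using a b st by (simp_all add: A'_def B'_def pos_def_diag_in_iff U V)
  have det: "det A' = complex_of_real (\<Prod>i\<in>UNIV. min (a i) s)" "det B' = complex_of_real (\<Prod>i\<in>UNIV. min (b i) t)"
    by (simp_all add: A'_def B'_def det_diag_in U V)
  have pos: "0 < (\<Prod>i\<in>UNIV. min (a i) s)" "0 < (\<Prod>i\<in>UNIV. min (b i) t)"
    using a b st by (simp_all add: prod_pos)
  have "(\<Prod>i\<in>UNIV. min (a i) s) powr (1 - \<alpha>) * (\<Prod>i\<in>UNIV. min (b i) t) powr \<alpha> \<le> (\<Prod>i\<in>UNIV. k i)"
    unfolding k_def
    by (rule Hadamard_inequality[OF W pos_def_geo_mean_inv[OF pd(3,4)]
          det_geo_mean_inv[OF pd(3,4) det pos]])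
  also have "\<dots> \<le> (\<Prod>i\<in>UNIV. min (z i) (s powr (1 - \<alpha>) * t powr \<alpha>))"
  proof (intro prod_mono conjI min.boundedI)
    fix i
    define v where "v = W *v axis i 1"
    have v: "norm v = 1" "v \<noteq> 0"
      using unitary_column_norm[OF W, of i] by (auto simp: v_def)
    show "0 \<le> k i"
      using pos_def_geo_mean_inv[OF pd(3,4)] v
      unfolding k_def v_def[symmetric] pos_def_def by (metis less_imp_le)
    have "k i \<le> v \<bullet> (diag_in W z *v v)"
      unfolding k_def v_def[symmetric] Z[symmetric]
      by (intro geo_mean_inv_mono pd \<alpha>) (auto simp: A'_def B'_def intro: inner_diag_in_mono)
    also have "\<dots> = z i"
      unfolding v_def by (rule inner_diag_in_eigenvector[OF W])
    finally show "k i \<le> z i" .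
    have "k i \<le> (v \<bullet> (A' *v v)) powr (1 - \<alpha>) * (v \<bullet> (B' *v v)) powr \<alpha>"
      unfolding k_def v_def[symmetric] by (rule inner_geo_mean_inv_le[OF pd(3,4) \<alpha>])
    also have "\<dots> \<le> s powr (1 - \<alpha>) * t powr \<alpha>"
    proof (intro mult_mono powr_mono2)
      show "v \<bullet> (A' *v v) \<le> s"
        using inner_diag_in_mono[of "\<lambda>i. min (a i) s" "\<lambda>_. s" v U] v
        by (simp add: A'_def inner_diag_in_const[OF U])
      show "v \<bullet> (B' *v v) \<le> t"
        using inner_diag_in_mono[of "\<lambda>i. min (b i) t" "\<lambda>_. t" v V] v
        by (simp add: B'_def inner_diag_in_const[OF V])
      show "0 \<le> v \<bullet> (A' *v v)" "0 \<le> v \<bullet> (B' *v v)"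
        using pd(3,4) v unfolding pos_def_def by (metis less_imp_le)+
    qed (use \<alpha> in auto)
    finally show "k i \<le> s powr (1 - \<alpha>) * t powr \<alpha>" .
  qed
  finally show ?thesis .
qed

lemma ln_weighted_mean:
  fixes x y :: real
  assumes "0 < x" "0 < y"
  shows "ln (x powr (1 - \<alpha>) * y powr \<alpha>) = (1 - \<alpha>) * ln x + \<alpha> * ln y"
  using assms by (simp add: ln_mult ln_powr)

lemma exists_sorted_enumeration:
  fixes g :: "'n::finite \<Rightarrow> real"
  shows "\<exists>e. bij_betw e {..<CARD('n)} UNIV \<and> (\<forall>i j. i \<le> j \<longrightarrow> j < CARD('n) \<longrightarrow> g (e i) \<le> g (e j))"
proof -
  obtain xs :: "'n list" where xs: "set xs = UNIV" "distinct xs"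
    using finite_distinct_list[of "UNIV :: 'n set"] by auto
  define ys where "ys = sort_key g xs"
  have ys: "set ys = UNIV" "distinct ys" "sorted (map g ys)"
    using xs by (simp_all add: ys_def)
  have len: "length ys = CARD('n)"
    using distinct_card[OF ys(2)] ys(1) by simp
  have "bij_betw ((!) ys) {..<CARD('n)} UNIV"
    using bij_betw_nth[OF ys(2)] ys(1) len by auto
  moreover have "g (ys ! i) \<le> g (ys ! j)" if "i \<le> j" "j < CARD('n)" for i j
    using sorted_nth_mono[OF ys(3), of i j] that len by simp
  ultimately show ?thesis
    by blast
qed

lemma Abel_sum_lower_bound:
  fixes w d :: "nat \<Rightarrow> real"
  assumes "\<And>k. k \<le> n \<Longrightarrow> 0 \<le> (\<Sum>j<k. d j)" and "\<And>j. j < n \<Longrightarrow> w (Suc j) \<le> w j"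
  shows "w n * (\<Sum>j<Suc n. d j) \<le> (\<Sum>j<Suc n. w j * d j)"
  using assms
proof (induction n)
  case (Suc n)
  have "w (Suc n) * (\<Sum>j<Suc (Suc n). d j) = w (Suc n) * (\<Sum>j<Suc n. d j) + w (Suc n) * d (Suc n)"
    by (simp add: algebra_simps)
  also have "w (Suc n) * (\<Sum>j<Suc n. d j) \<le> w n * (\<Sum>j<Suc n. d j)"
    using Suc.prems(1)[of "Suc n"] Suc.prems(2)[of n] by (intro mult_right_mono) auto
  also have "\<dots> \<le> (\<Sum>j<Suc n. w j * d j)"
    using Suc.prems by (intro Suc.IH) auto
  finally show ?case
    by simp
qed simp

text \<open>The majorisation \<open>ln z \<prec> (1 - \<alpha>) ln a + \<alpha> ln b\<close>, for \<open>a\<close> and \<open>b\<close> sorted alike, in the form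
  that convex functions can use directly. A separating functional \<open>w\<close> would be violated by the
  vertex whose coordinates are ordered oppositely to \<open>w\<close>: the partial sums that Abel
  summation needs come from the truncation inequality with the thresholds at the \<open>k\<close>-th
  smallest eigenvalues.\<close>

theorem ln_eigenvalues_geo_mean_convex_hull:
  fixes a b z :: "'n::finite \<Rightarrow> real" and U V W :: "complex^'n^'n"
  assumes U: "unitary U" and V: "unitary V" and W: "unitary W"
    and a: "\<And>i. 0 < a i" and b: "\<And>i. 0 < b i" and z: "\<And>i. 0 < z i"
    and \<alpha>: "0 \<le> \<alpha>" "\<alpha> \<le> 1"
    and Z: "geo_mean_inv \<alpha> (diag_in U a) (diag_in V b) = diag_in W z"
  shows "(\<chi> i. ln (z i)) \<in> convex hull
    {\<chi> i. (1 - \<alpha>) * ln (a (\<pi> i)) + \<alpha> * ln (b (\<rho> i)) | \<pi> \<rho>. bij \<pi> \<and> bij \<rho>}" (is "_ \<in> convex hull ?S")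
proof (rule ccontr)
  define n where "n = CARD('n)"
  have n: "0 < n"
    by (simp add: n_def)
  assume "\<not> ?thesis"
  moreover have "finite ?S"
  proof (rule finite_subset)
    show "?S \<subseteq> (\<lambda>(\<pi>, \<rho>). \<chi> i. (1 - \<alpha>) * ln (a (\<pi> i)) + \<alpha> * ln (b (\<rho> i))) ` UNIV"
      by auto
  qed simp
  then have "closed (convex hull ?S)"
    by (simp add: compact_convex_hull compact_imp_closed finite_imp_compact)
  ultimately obtain w r where w: "inner w (\<chi> i. ln (z i)) < r" "\<And>x. x \<in> ?S \<Longrightarrow> r < inner w x"
    using separating_hyperplane_closed_point[of "convex hull ?S" "\<chi> i. ln (z i)"]
    by (meson convex_convex_hull hull_inc)
  obtain ea where ea: "bij_betw ea {..<n} UNIV" "\<And>i j. i \<le> j \<Longrightarrow> j < n \<Longrightarrow> a (ea i) \<le> a (ea j)"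
    using exists_sorted_enumeration[of a] unfolding n_def by blast
  obtain eb where eb: "bij_betw eb {..<n} UNIV" "\<And>i j. i \<le> j \<Longrightarrow> j < n \<Longrightarrow> b (eb i) \<le> b (eb j)"
    using exists_sorted_enumeration[of b] unfolding n_def by blast
  obtain ew where ew: "bij_betw ew {..<n} UNIV" "\<And>i j. i \<le> j \<Longrightarrow> j < n \<Longrightarrow> w $ ew j \<le> w $ ew i"
    using exists_sorted_enumeration[of "\<lambda>i. - w $ i"] unfolding n_def by auto
  define c where "c j = (1 - \<alpha>) * ln (a (ea j)) + \<alpha> * ln (b (eb j))" for j
  have reindex: "(\<Sum>i\<in>UNIV. g i) = (\<Sum>j<n. g (e j))" if "bij_betw e {..<n} UNIV"
    for e and g :: "'n \<Rightarrow> real"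
    using sum.reindex_bij_betw[OF that, of g] by simp
  have split_min: "(\<Sum>i\<in>UNIV. ln (min (g i) (g (e (k - 1))))) = (\<Sum>j<k. ln (g (e j))) + (n - k) * ln (g (e (k - 1)))"
    if e: "bij_betw e {..<n} UNIV" and mono: "\<And>i j. i \<le> j \<Longrightarrow> j < n \<Longrightarrow> g (e i) \<le> g (e j)"
      and k: "0 < k" "k \<le> n" for e :: "nat \<Rightarrow> 'n" and g :: "'n \<Rightarrow> real" and k
  proof -
    have "(\<Sum>i\<in>UNIV. ln (min (g i) (g (e (k - 1))))) = (\<Sum>j<n. ln (min (g (e j)) (g (e (k - 1)))))"
      by (rule reindex[OF e])
    also have "\<dots> = (\<Sum>j\<in>{..<k} \<union> {k..<n}. ln (min (g (e j)) (g (e (k - 1)))))"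
      using k by (intro sum.cong) auto
    also have "\<dots> = (\<Sum>j<k. ln (min (g (e j)) (g (e (k - 1))))) + (\<Sum>j\<in>{k..<n}. ln (min (g (e j)) (g (e (k - 1)))))"
      by (rule sum.union_disjoint) auto
    also have "(\<Sum>j<k. ln (min (g (e j)) (g (e (k - 1))))) = (\<Sum>j<k. ln (g (e j)))"
      using k mono by (intro sum.cong refl arg_cong[of _ _ ln] min_absorb1) auto
    also have "(\<Sum>j\<in>{k..<n}. ln (min (g (e j)) (g (e (k - 1))))) = (\<Sum>j\<in>{k..<n}. ln (g (e (k - 1))))"
      using k mono by (intro sum.cong refl arg_cong[of _ _ ln] min_absorb2) auto
    finally show ?thesis
      using k by (simp add: of_nat_diff)
  qed
  have csum: "(\<Sum>j<k. c j) = (1 - \<alpha>) * (\<Sum>j<k. ln (a (ea j))) + \<alpha> * (\<Sum>j<k. ln (b (eb j)))" for k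
    by (simp add: c_def sum.distrib sum_distrib_left)
  have partial: "(\<Sum>j<k. c j) \<le> (\<Sum>j<k. ln (z (ew j)))" if k: "k \<le> n" for k
  proof (cases "k = 0")
    case False
    then have k0: "0 < k"
      by simp
    define s where "s = a (ea (k - 1))"
    define t where "t = b (eb (k - 1))"
    define \<kappa> where "\<kappa> = s powr (1 - \<alpha>) * t powr \<alpha>"
    have st: "0 < s" "0 < t" "0 < \<kappa>"
      using a b by (simp_all add: s_def t_def \<kappa>_def less_imp_neq[symmetric])
    have ln\<kappa>: "ln \<kappa> = (1 - \<alpha>) * ln s + \<alpha> * ln t"
      using st(1,2) by (simp add: \<kappa>_def ln_mult ln_powr)
    have ln_prod_min: "ln (\<Prod>i\<in>UNIV. min (g i) x) = (\<Sum>i\<in>UNIV. ln (min (g i) x))"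
      "0 < (\<Prod>i\<in>UNIV. min (g i) x)"
      if "\<And>i. 0 < g i" "0 < x" for g :: "'n \<Rightarrow> real" and x
    proof -
      have "0 < min (g i) x" for i
        using that by simp
      then show "ln (\<Prod>i\<in>UNIV. min (g i) x) = (\<Sum>i\<in>UNIV. ln (min (g i) x))"
        "0 < (\<Prod>i\<in>UNIV. min (g i) x)"
        by (simp_all add: ln_prod prod_pos less_imp_neq[symmetric])
    qed
    have "(\<Prod>i\<in>UNIV. min (a i) s) powr (1 - \<alpha>) * (\<Prod>i\<in>UNIV. min (b i) t) powr \<alpha>
        \<le> (\<Prod>i\<in>UNIV. min (z i) \<kappa>)"
      unfolding \<kappa>_def by (rule geo_mean_inv_truncation[OF U V W a b st(1,2) \<alpha> Z])
    moreover have "0 < (\<Prod>i\<in>UNIV. min (a i) s) powr (1 - \<alpha>) * (\<Prod>i\<in>UNIV. min (b i) t) powr \<alpha>"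
      using ln_prod_min(2)[where g = a, OF a st(1)] ln_prod_min(2)[where g = b, OF b st(2)]
      by (intro mult_pos_pos iffD2[OF powr_gt_zero]) linarith+
    ultimately have "ln ((\<Prod>i\<in>UNIV. min (a i) s) powr (1 - \<alpha>) * (\<Prod>i\<in>UNIV. min (b i) t) powr \<alpha>)
        \<le> ln (\<Prod>i\<in>UNIV. min (z i) \<kappa>)"
      by (simp add: ln_mono)
    moreover have "ln ((\<Prod>i\<in>UNIV. min (a i) s) powr (1 - \<alpha>) * (\<Prod>i\<in>UNIV. min (b i) t) powr \<alpha>)
        = (1 - \<alpha>) * (\<Sum>i\<in>UNIV. ln (min (a i) s)) + \<alpha> * (\<Sum>i\<in>UNIV. ln (min (b i) t))"
      unfolding ln_prod_min(1)[where g = a, OF a st(1), symmetric]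
        ln_prod_min(1)[where g = b, OF b st(2), symmetric]
      by (intro ln_weighted_mean ln_prod_min(2) a b st)
    moreover have "ln (\<Prod>i\<in>UNIV. min (z i) \<kappa>) = (\<Sum>i\<in>UNIV. ln (min (z i) \<kappa>))"
      by (rule ln_prod_min(1)[where g = z, OF z st(3)])
    ultimately have "(1 - \<alpha>) * ((\<Sum>j<k. ln (a (ea j))) + (n - k) * ln s)
        + \<alpha> * ((\<Sum>j<k. ln (b (eb j))) + (n - k) * ln t) \<le> (\<Sum>i\<in>UNIV. ln (min (z i) \<kappa>))"
      using split_min[where g = a and e = ea, OF ea k0 k] split_min[where g = b and e = eb, OF eb k0 k]
      by (simp add: s_def t_def)
    also have "(\<Sum>i\<in>UNIV. ln (min (z i) \<kappa>)) = (\<Sum>j<n. ln (min (z (ew j)) \<kappa>))"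
      by (rule reindex[OF ew(1)])
    also have "\<dots> = (\<Sum>j\<in>{..<k} \<union> {k..<n}. ln (min (z (ew j)) \<kappa>))"
      using k by (intro sum.cong) auto
    also have "\<dots> = (\<Sum>j<k. ln (min (z (ew j)) \<kappa>)) + (\<Sum>j\<in>{k..<n}. ln (min (z (ew j)) \<kappa>))"
      by (rule sum.union_disjoint) auto
    also have "\<dots> \<le> (\<Sum>j<k. ln (z (ew j))) + (\<Sum>j\<in>{k..<n}. ln \<kappa>)"
      using z st by (intro add_mono sum_mono) auto
    finally show ?thesis
      using k by (simp add: csum ln\<kappa> algebra_simps)
  qed simp
  have total: "(\<Sum>j<n. c j) = (\<Sum>j<n. ln (z (ew j)))"
  proof -
    have pd: "pos_def (diag_in U a)" "pos_def (diag_in V b)"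
      using a b by (simp_all add: pos_def_diag_in_iff U V)
    define p where "p = (\<Prod>i\<in>UNIV. a i)"
    define q where "q = (\<Prod>i\<in>UNIV. b i)"
    have pq: "0 < p" "0 < q"
      using a b by (simp_all add: p_def q_def prod_pos)
    have "complex_of_real (\<Prod>i\<in>UNIV. z i) = complex_of_real (p powr (1 - \<alpha>) * q powr \<alpha>)"
      unfolding det_diag_in[OF W, symmetric] Z[symmetric]
      by (rule det_geo_mean_inv[OF pd _ _ pq]) (simp_all add: det_diag_in U V p_def q_def)
    then have "(\<Prod>i\<in>UNIV. z i) = p powr (1 - \<alpha>) * q powr \<alpha>"
      using of_real_eq_iff by blast
    then have "ln (\<Prod>i\<in>UNIV. z i) = (1 - \<alpha>) * ln p + \<alpha> * ln q"
      using pq by (simp add: ln_mult ln_powr)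
    moreover have "ln (\<Prod>i\<in>UNIV. g i) = (\<Sum>i\<in>UNIV. ln (g i))" if "\<And>i. 0 < g i" for g :: "'n \<Rightarrow> real"
      using that by (simp add: ln_prod less_imp_neq[symmetric])
    ultimately have "(\<Sum>i\<in>UNIV. ln (z i)) = (1 - \<alpha>) * (\<Sum>i\<in>UNIV. ln (a i)) + \<alpha> * (\<Sum>i\<in>UNIV. ln (b i))"
      using a b z by (simp add: p_def q_def)
    then show ?thesis
      by (simp add: csum reindex[OF ew(1), of "\<lambda>i. ln (z i)"] reindex[OF ea(1), of "\<lambda>i. ln (a i)"]
          reindex[OF eb(1), of "\<lambda>i. ln (b i)"])
  qed
  define d where "d j = ln (z (ew j)) - c j" for j
  have "w $ ew (n - 1) * (\<Sum>j<Suc (n - 1). d j) \<le> (\<Sum>j<Suc (n - 1). w $ ew j * d j)"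
    by (rule Abel_sum_lower_bound[of "n - 1" d "\<lambda>j. w $ ew j"])
       (use partial ew(2) in \<open>auto simp: d_def sum_subtractf\<close>)
  then have "0 \<le> (\<Sum>j<n. w $ ew j * d j)"
    using total n by (simp add: d_def sum_subtractf)
  then have le: "(\<Sum>j<n. w $ ew j * c j) \<le> (\<Sum>j<n. w $ ew j * ln (z (ew j)))"
    by (simp add: d_def sum_subtractf right_diff_distrib)
  define \<sigma> where "\<sigma> = the_inv_into {..<n} ew"
  have \<sigma>: "bij_betw \<sigma> UNIV {..<n}" "\<And>j. j < n \<Longrightarrow> \<sigma> (ew j) = j"
    using ew(1) bij_betw_the_inv_into[OF ew(1)] by (auto simp: \<sigma>_def bij_betw_def the_inv_into_f_f)
  have "bij (ea \<circ> \<sigma>)" "bij (eb \<circ> \<sigma>)"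
    using bij_betw_trans[OF \<sigma>(1)] ea(1) eb(1) by auto
  then have "(\<chi> i. (1 - \<alpha>) * ln (a ((ea \<circ> \<sigma>) i)) + \<alpha> * ln (b ((eb \<circ> \<sigma>) i))) \<in> ?S"
    by blast
  then have "r < (\<Sum>i\<in>UNIV. w $ i * c (\<sigma> i))"
    by (drule_tac w(2)) (simp add: inner_vec_def c_def)
  also have "\<dots> = (\<Sum>j<n. w $ ew j * c j)"
    by (simp add: reindex[OF ew(1)] \<sigma>(2))
  also have "\<dots> \<le> (\<Sum>i\<in>UNIV. w $ i * ln (z i))"
    using le by (simp add: reindex[OF ew(1)])
  also have "\<dots> < r"
    using w(1) by (simp add: inner_vec_def)
  finally show False .
qed

section \<open>Doubly concave functions\<close>

text \<open>A point outside \<open>T\<close> would lie in a gap with end points in \<open>T\<close>, whose midpoint is in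
  \<open>T\<close>.\<close>

lemma midpoint_closed_unit_interval:
  fixes T :: "real set"
  assumes "closed T" "0 \<in> T" "1 \<in> T" and mid: "\<And>x y. x \<in> T \<Longrightarrow> y \<in> T \<Longrightarrow> (x + y) / 2 \<in> T"
    and s: "s \<in> {0..1}"
  shows "s \<in> T"
proof (rule ccontr)
  assume "s \<notin> T"
  define x where "x = Sup (T \<inter> {0..s})"
  define y where "y = Inf (T \<inter> {s..1})"
  have x: "x \<in> T \<inter> {0..s}"
    unfolding x_def using assms by (intro closed_contains_Sup closed_Int) auto
  have y: "y \<in> T \<inter> {s..1}"
    unfolding y_def using assms by (intro closed_contains_Inf closed_Int) auto
  have lt: "x < s" "s < y"
    using x y \<open>s \<notin> T\<close> by (auto simp: order_less_le)
  have m: "(x + y) / 2 \<in> T"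
    using x y mid by blast
  have above: "u \<le> x" if "u \<in> T" "0 \<le> u" "u \<le> s" for u
    unfolding x_def using that by (intro cSup_upper) auto
  have below: "y \<le> u" if "u \<in> T" "s \<le> u" "u \<le> 1" for u
    unfolding y_def using that by (intro cInf_lower) auto
  show False
    using above[OF m] below[OF m] x y lt by (cases "(x + y) / 2 \<le> s") auto
qed

lemma weighted_mean_bounds:
  fixes x y :: real
  assumes "0 < m" "m \<le> x" "m \<le> y" "x \<le> M" "y \<le> M" "0 \<le> \<alpha>" "\<alpha> \<le> 1"
  shows "m \<le> x powr (1 - \<alpha>) * y powr \<alpha>" "x powr (1 - \<alpha>) * y powr \<alpha> \<le> M"
proof -
  have "m = m powr (1 - \<alpha>) * m powr \<alpha>"
    using assms by (simp add: powr_add[symmetric])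
  also have "\<dots> \<le> x powr (1 - \<alpha>) * y powr \<alpha>"
    using assms by (intro mult_mono powr_mono2) auto
  finally show "m \<le> x powr (1 - \<alpha>) * y powr \<alpha>" .
  have "x powr (1 - \<alpha>) * y powr \<alpha> \<le> M powr (1 - \<alpha>) * M powr \<alpha>"
    using assms by (intro mult_mono powr_mono2) auto
  also have "\<dots> = M"
    using assms by (simp add: powr_add[symmetric])
  finally show "x powr (1 - \<alpha>) * y powr \<alpha> \<le> M" .
qed

lemma is_interval_weighted_mean:
  fixes x y :: real
  assumes "is_interval \<Omega>" "x \<in> \<Omega>" "y \<in> \<Omega>" "0 < x" "0 < y" "0 \<le> \<alpha>" "\<alpha> \<le> 1"
  shows "x powr (1 - \<alpha>) * y powr \<alpha> \<in> \<Omega>"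
proof -
  have "min x y \<in> \<Omega>" "max x y \<in> \<Omega>"
    using assms by (auto simp: min_def max_def)
  moreover have "min x y \<le> x powr (1 - \<alpha>) * y powr \<alpha>" "x powr (1 - \<alpha>) * y powr \<alpha> \<le> max x y"
    using weighted_mean_bounds[of "min x y" x y "max x y" \<alpha>] assms by auto
  ultimately show ?thesis
    using assms(1) unfolding is_interval_1 by blast
qed

lemma sqrt_weighted_mean:
  fixes x y :: real
  assumes "0 < x" "0 < y"
  shows "sqrt ((x powr (1 - \<alpha>) * y powr \<alpha>) * (x powr (1 - \<beta>) * y powr \<beta>))
       = x powr (1 - (\<alpha> + \<beta>) / 2) * y powr ((\<alpha> + \<beta>) / 2)"
proof -
  have "(x powr (1 - \<alpha>) * y powr \<alpha>) * (x powr (1 - \<beta>) * y powr \<beta>)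
      = (x powr (1 - (\<alpha> + \<beta>) / 2) * y powr ((\<alpha> + \<beta>) / 2))\<^sup>2"
    using assms by (simp add: power2_eq_square powr_def exp_add[symmetric] algebra_simps)
  then show ?thesis
    using assms by simp
qed

text \<open>Geometric concavity is assumed for midpoints only. The weights for which the inequality holds
  form a closed set that is closed under midpoints.\<close>

lemma doubly_concave_weighted:
  assumes \<Omega>: "is_interval \<Omega>" and f: "doubly_concave_on \<Omega> f"
    and xy: "x \<in> \<Omega>" "y \<in> \<Omega>" "0 < x" "0 < y" and pos: "0 < f x" "0 < f y"
    and \<alpha>: "0 \<le> \<alpha>" "\<alpha> \<le> 1"
  shows "f x powr (1 - \<alpha>) * f y powr \<alpha> \<le> f (x powr (1 - \<alpha>) * y powr \<alpha>)"
proof -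
  define g where "g \<alpha> = x powr (1 - \<alpha>) * y powr \<alpha>" for \<alpha>
  define h where "h \<alpha> = f x powr (1 - \<alpha>) * f y powr \<alpha>" for \<alpha>
  define T where "T = {\<alpha> \<in> {0..1}. h \<alpha> \<le> f (g \<alpha>)}"
  have g\<Omega>: "g \<alpha> \<in> \<Omega>" if "\<alpha> \<in> {0..1}" for \<alpha>
    using is_interval_weighted_mean[OF \<Omega> xy] that by (simp add: g_def)
  have cg: "continuous_on {0..1} g"
    unfolding g_def using xy by (intro continuous_intros) auto
  have "continuous_on {0..1} (\<lambda>\<alpha>. f (g \<alpha>))"
    using f g\<Omega> by (intro continuous_on_compose2[OF _ cg]) (auto simp: doubly_concave_on_def)
  moreover have "continuous_on {0..1} h"
    unfolding h_def using pos by (intro continuous_intros) auto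
  ultimately have T: "closed T"
    unfolding T_def by (intro continuous_on_closed_Collect_le) auto
  have T01: "0 \<in> T" "1 \<in> T"
    using xy pos by (simp_all add: T_def g_def h_def)
  have Tmid: "(\<alpha> + \<beta>) / 2 \<in> T" if "\<alpha> \<in> T" "\<beta> \<in> T" for \<alpha> \<beta>
  proof -
    have ab: "\<alpha> \<in> {0..1}" "\<beta> \<in> {0..1}" "h \<alpha> \<le> f (g \<alpha>)" "h \<beta> \<le> f (g \<beta>)"
      using that by (auto simp: T_def)
    have "h ((\<alpha> + \<beta>) / 2) = sqrt (h \<alpha> * h \<beta>)"
      using sqrt_weighted_mean[OF pos] by (simp add: h_def)
    also have "\<dots> \<le> sqrt (f (g \<alpha>) * f (g \<beta>))"
    proof (intro real_sqrt_le_mono mult_mono ab)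
      show "0 \<le> f (g \<alpha>)"
        using f g\<Omega>[OF ab(1)] by (simp add: doubly_concave_on_def)
      show "0 \<le> h \<beta>"
        by (simp add: h_def)
    qed
    also have "\<dots> \<le> f (sqrt (g \<alpha> * g \<beta>))"
      using f g\<Omega>[OF ab(1)] g\<Omega>[OF ab(2)] by (simp add: doubly_concave_on_def)
    also have "sqrt (g \<alpha> * g \<beta>) = g ((\<alpha> + \<beta>) / 2)"
      using sqrt_weighted_mean[OF xy(3,4)] by (simp add: g_def)
    finally show ?thesis
      using ab by (auto simp: T_def)
  qed
  have "\<alpha> \<in> T"
  proof (rule midpoint_closed_unit_interval[OF T T01])
    show "\<alpha> \<in> {0..1}"
      using \<alpha> by simp
  qed (rule Tmid)
  then show ?thesis
    by (simp add: T_def g_def h_def)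
qed

lemma convex_hull_coordinate:
  fixes S :: "(real^'n) set"
  assumes v: "v \<in> convex hull S" and J: "convex J" and S: "\<And>x i. x \<in> S \<Longrightarrow> x $ i \<in> J"
  shows "v $ i \<in> J"
proof -
  have "convex {x :: real^'n. x $ i \<in> J}"
    using J by (auto simp: convex_def)
  moreover have "S \<subseteq> {x. x $ i \<in> J}"
    using S by auto
  ultimately show ?thesis
    using v hull_minimal[of S "{x. x $ i \<in> J}" convex] by blast
qed

lemma sum_Hoelder_weighted:
  fixes y s t :: "'n::finite \<Rightarrow> real"
  assumes y: "\<And>i. 0 \<le> y i" and st: "\<And>i. 0 < s i" "\<And>i. 0 < t i" and \<alpha>: "0 \<le> \<alpha>" "\<alpha> \<le> 1"
  shows "(\<Sum>i\<in>UNIV. y i * (s i powr (1 - \<alpha>) * t i powr \<alpha>))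
       \<le> (\<Sum>i\<in>UNIV. y i * s i) powr (1 - \<alpha>) * (\<Sum>i\<in>UNIV. y i * t i) powr \<alpha>"
proof -
  have e1: "y i * (s i powr (1 - \<alpha>) * t i powr \<alpha>) = (y i * s i) * (t i / s i) powr \<alpha>" for i
    using st[of i] by (simp add: powr_divide powr_diff)
  have e2: "y i * t i = (y i * s i) * (t i / s i)" for i
    using st(1)[of i] by simp
  show ?thesis
    unfolding e1 e2 using assms by (intro sum_powr_Hoelder) (auto simp: less_imp_le)
qed

lemma convex_positive_log_domain:
  assumes \<Omega>: "is_interval \<Omega>" and f: "doubly_concave_on \<Omega> f"
  shows "convex {t. exp t \<in> \<Omega> \<and> 0 < f (exp t)}"
proof (rule convexI)
  fix s t u v :: real
  assume st: "s \<in> {t. exp t \<in> \<Omega> \<and> 0 < f (exp t)}" "t \<in> {t. exp t \<in> \<Omega> \<and> 0 < f (exp t)}"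
    and uv: "0 \<le> u" "0 \<le> v" "u + v = 1"
  have u: "u = 1 - v"
    using uv by simp
  have e: "exp (u *\<^sub>R s + v *\<^sub>R t) = exp s powr (1 - v) * exp t powr v"
    by (simp add: u powr_def exp_add)
  have "0 < f (exp s) powr (1 - v) * f (exp t) powr v"
    using st by simp
  also have "\<dots> \<le> f (exp s powr (1 - v) * exp t powr v)"
    using st uv by (intro doubly_concave_weighted[OF \<Omega> f]) auto
  finally show "u *\<^sub>R s + v *\<^sub>R t \<in> {t. exp t \<in> \<Omega> \<and> 0 < f (exp t)}"
    using is_interval_weighted_mean[OF \<Omega>, of "exp s" "exp t" v] st uv by (simp only: e mem_Collect_eq) auto
qed

lemma convex_on_log_domain:
  assumes \<Omega>: "is_interval \<Omega>" and f: "doubly_concave_on \<Omega> f" and p: "0 < p"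
  shows "convex_on {t. exp t \<in> \<Omega> \<and> 0 < f (exp t)} (\<lambda>t. f (exp t) powr (-p))"
proof (rule convex_onI[OF _ convex_positive_log_domain[OF \<Omega> f]])
  fix v s t :: real
  assume v: "0 < v" "v < 1"
    and st: "s \<in> {t. exp t \<in> \<Omega> \<and> 0 < f (exp t)}" "t \<in> {t. exp t \<in> \<Omega> \<and> 0 < f (exp t)}"
  have e: "exp ((1 - v) *\<^sub>R s + v *\<^sub>R t) = exp s powr (1 - v) * exp t powr v"
    by (simp add: powr_def exp_add)
  have "f (exp ((1 - v) *\<^sub>R s + v *\<^sub>R t)) powr (-p) \<le> (f (exp s) powr (1 - v) * f (exp t) powr v) powr (-p)"
    unfolding e using st v p doubly_concave_weighted[OF \<Omega> f, of "exp s" "exp t" v]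
    by (intro powr_mono2') auto
  also have "\<dots> = (f (exp s) powr (-p)) powr (1 - v) * (f (exp t) powr (-p)) powr v"
    using st by (simp add: powr_mult powr_powr mult.commute)
  also have "\<dots> \<le> (1 - v) * f (exp s) powr (-p) + v * f (exp t) powr (-p)"
    using st v by (intro Youngs_inequality_0) auto
  finally show "f (exp ((1 - v) *\<^sub>R s + v *\<^sub>R t)) powr (-p) \<le> (1 - v) * f (exp s) powr (-p) + v * f (exp t) powr (-p)" .
qed

text \<open>Log-majorisation passes to \<open>f\<close>: with the norming functional \<open>y\<close> at
  \<open>f z powr (-p)\<close>, the function \<open>v \<mapsto> \<Sum>i. y i * f (exp (v i)) powr (-p)\<close> is convex, so it is
  enough to bound it at the vertices of the hull. There it is bounded by geometric concavity of
  \<open>f\<close> and Hoelder's inequality.\<close>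

theorem anti_geometric_mean:
  fixes a b z :: "'n::finite \<Rightarrow> real"
  assumes N: "symmetric_norm (N :: complex^'n^'n \<Rightarrow> real)" and p: "0 < p"
    and \<Omega>: "is_interval \<Omega>" and f: "doubly_concave_on \<Omega> f"
    and a: "\<And>i. 0 < a i" "\<And>i. a i \<in> \<Omega>" "\<And>i. 0 < f (a i)"
    and b: "\<And>i. 0 < b i" "\<And>i. b i \<in> \<Omega>" "\<And>i. 0 < f (b i)"
    and z: "\<And>i. 0 < z i" and \<alpha>: "0 \<le> \<alpha>" "\<alpha> \<le> 1"
    and hull: "(\<chi> i. ln (z i)) \<in> convex hull
      {\<chi> i. (1 - \<alpha>) * ln (a (\<pi> i)) + \<alpha> * ln (b (\<rho> i)) | \<pi> \<rho>. bij \<pi> \<and> bij \<rho>}" (is "_ \<in> convex hull ?S")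
  shows "z i \<in> \<Omega>" "0 < f (z i)"
    "anti N p (\<lambda>i. f (a i)) powr (1 - \<alpha>) * anti N p (\<lambda>i. f (b i)) powr \<alpha> \<le> anti N p (\<lambda>i. f (z i))"
proof -
  define J where "J = {t. exp t \<in> \<Omega> \<and> 0 < f (exp t)}"
  have J: "convex J" "convex_on J (\<lambda>t. f (exp t) powr (-p))"
    unfolding J_def using convex_positive_log_domain[OF \<Omega> f] convex_on_log_domain[OF \<Omega> f p] by auto
  have SJ: "x $ i \<in> J" if x: "x \<in> ?S" for x i
  proof -
    from x obtain \<pi> \<rho> where x_eq: "x = (\<chi> i. (1 - \<alpha>) * ln (a (\<pi> i)) + \<alpha> * ln (b (\<rho> i)))"
      by blast
    have "ln (a (\<pi> i)) \<in> J" "ln (b (\<rho> i)) \<in> J"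
      using a b by (auto simp: J_def)
    then show ?thesis
      using J(1) \<alpha> convexD[of J "ln (a (\<pi> i))" "ln (b (\<rho> i))" "1 - \<alpha>" \<alpha>] by (simp add: x_eq)
  qed
  have hullJ: "x $ i \<in> J" if "x \<in> convex hull ?S" for x i
    by (rule convex_hull_coordinate[OF that J(1) SJ])
  have zJ: "z i \<in> \<Omega>" "0 < f (z i)" for i
    using hullJ[OF hull, of i] z[of i] by (simp_all add: J_def)
  then show "z i \<in> \<Omega>" "0 < f (z i)"
    by blast+
  define \<Phi> where "\<Phi> s = N (real_diag s)" for s
  have zp: "0 < f (z i) powr (-p)" for i
    using zJ(2)[of i] by simp
  obtain y where y: "\<And>i. 0 \<le> y i" "(\<Sum>i\<in>UNIV. y i * f (z i) powr (-p)) = N (real_diag (\<lambda>i. f (z i) powr (-p)))"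
    "\<And>U s. unitary U \<Longrightarrow>
       (\<Sum>i\<in>UNIV. y i * (\<Sum>j\<in>UNIV. (cmod (U $ i $ j))\<^sup>2 * s j)) \<le> N (real_diag s)"
    by (rule symmetric_norm_support[where t = "\<lambda>i. f (z i) powr (-p)", OF N zp]) (rule that)
  have y_perm: "(\<Sum>i\<in>UNIV. y i * s (\<pi> i)) \<le> \<Phi> s" if "bij \<pi>" for \<pi> s
    using y(3)[OF unitary_permutation_matrix[OF that], of s] by (simp add: sum_permutation_matrix \<Phi>_def)
  define G where "G x = (\<Sum>i\<in>UNIV. y i * f (exp (x $ i)) powr (-p))" for x :: "real^'n"
  have "convex_on (convex hull ?S) G"
  proof (rule convex_onI)
    fix t :: real and x x' :: "real^'n"
    assume t: "0 < t" "t < 1" and x: "x \<in> convex hull ?S" "x' \<in> convex hull ?S"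
    have "G ((1 - t) *\<^sub>R x + t *\<^sub>R x') \<le> (\<Sum>i\<in>UNIV. y i * ((1 - t) * f (exp (x $ i)) powr (-p) + t * f (exp (x' $ i)) powr (-p)))"
      unfolding G_def
      using convex_onD[OF J(2), of t] hullJ[OF x(1)] hullJ[OF x(2)] t y(1)
      by (intro sum_mono mult_left_mono) auto
    also have "\<dots> = (1 - t) * G x + t * G x'"
      by (simp add: G_def sum.distrib[symmetric] sum_distrib_left algebra_simps)
    finally show "G ((1 - t) *\<^sub>R x + t *\<^sub>R x') \<le> (1 - t) * G x + t * G x'" .
  qed (rule convex_convex_hull)
  moreover define c where "c = \<Phi> (\<lambda>i. f (a i) powr (-p)) powr (1 - \<alpha>) * \<Phi> (\<lambda>i. f (b i) powr (-p)) powr \<alpha>"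
  have "\<forall>x\<in>?S. G x \<le> c"
  proof
    fix x
    assume "x \<in> ?S"
    then obtain \<pi> \<rho> where x_eq: "x = (\<chi> i. (1 - \<alpha>) * ln (a (\<pi> i)) + \<alpha> * ln (b (\<rho> i)))"
      and bij: "bij \<pi>" "bij \<rho>"
      by blast
    have "f (exp (x $ i)) powr (-p) \<le> (f (a (\<pi> i)) powr (-p)) powr (1 - \<alpha>) * (f (b (\<rho> i)) powr (-p)) powr \<alpha>" for i
    proof -
      have "exp (x $ i) = a (\<pi> i) powr (1 - \<alpha>) * b (\<rho> i) powr \<alpha>"
        using a(1)[of "\<pi> i"] b(1)[of "\<rho> i"] by (simp add: x_eq exp_add powr_def less_imp_neq[symmetric])
      then have "f (exp (x $ i)) powr (-p) \<le> (f (a (\<pi> i)) powr (1 - \<alpha>) * f (b (\<rho> i)) powr \<alpha>) powr (-p)"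
        using doubly_concave_weighted[OF \<Omega> f a(2) b(2) a(1) b(1) a(3) b(3) \<alpha>, of "\<pi> i" "\<rho> i"]
          a(3)[of "\<pi> i"] b(3)[of "\<rho> i"] p by (intro powr_mono2') auto
      also have "\<dots> = (f (a (\<pi> i)) powr (-p)) powr (1 - \<alpha>) * (f (b (\<rho> i)) powr (-p)) powr \<alpha>"
        using a(3)[of "\<pi> i"] b(3)[of "\<rho> i"] by (simp add: powr_mult powr_powr mult.commute)
      finally show ?thesis .
    qed
    then have "G x \<le> (\<Sum>i\<in>UNIV. y i * ((f (a (\<pi> i)) powr (-p)) powr (1 - \<alpha>) * (f (b (\<rho> i)) powr (-p)) powr \<alpha>))"
      unfolding G_def by (intro sum_mono mult_left_mono y(1))
    also have "\<dots> \<le> (\<Sum>i\<in>UNIV. y i * f (a (\<pi> i)) powr (-p)) powr (1 - \<alpha>) * (\<Sum>i\<in>UNIV. y i * f (b (\<rho> i)) powr (-p)) powr \<alpha>"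
    proof (rule sum_Hoelder_weighted[OF y(1) _ _ \<alpha>])
      show "0 < f (a (\<pi> i)) powr (-p)" "0 < f (b (\<rho> i)) powr (-p)" for i
        using a(3)[of "\<pi> i"] b(3)[of "\<rho> i"] by simp_all
    qed
    also have "\<dots> \<le> c"
      unfolding c_def using y_perm[OF bij(1), of "\<lambda>i. f (a i) powr (-p)"]
        y_perm[OF bij(2), of "\<lambda>i. f (b i) powr (-p)"] \<alpha> y(1)
      by (intro mult_mono powr_mono2) (auto intro!: sum_nonneg)
    finally show "G x \<le> c" .
  qed
  ultimately have "G (\<chi> i. ln (z i)) \<le> c"
    using convex_on_convex_hull_bound[of ?S G c] hull by blast
  moreover have "G (\<chi> i. ln (z i)) = \<Phi> (\<lambda>i. f (z i) powr (-p))"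
    using z y(2) by (simp add: G_def \<Phi>_def)
  ultimately have le: "\<Phi> (\<lambda>i. f (z i) powr (-p)) \<le> c"
    by simp
  have \<Phi>pos: "0 < \<Phi> (\<lambda>i. f (g i) powr (-p))" if "\<And>i. 0 < f (g i)" for g
    unfolding \<Phi>_def using symmetric_norm_real_diag_pos[OF N, of _ undefined] that[of undefined] by simp
  have "c powr (-1/p) \<le> \<Phi> (\<lambda>i. f (z i) powr (-p)) powr (-1/p)"
    using le \<Phi>pos[of z] zJ(2) p by (intro powr_mono2') auto
  also have "c powr (-1/p) = anti N p (\<lambda>i. f (a i)) powr (1 - \<alpha>) * anti N p (\<lambda>i. f (b i)) powr \<alpha>"
    using \<Phi>pos[of a] \<Phi>pos[of b] a b by (simp add: c_def anti_def \<Phi>_def powr_mult powr_powr mult.commute)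
  finally show "anti N p (\<lambda>i. f (a i)) powr (1 - \<alpha>) * anti N p (\<lambda>i. f (b i)) powr \<alpha> \<le> anti N p (\<lambda>i. f (z i))"
    by (simp add: anti_def \<Phi>_def)
qed

section \<open>The mean of positive semidefinite matrices as a limit\<close>

lemma bounded_linear_inner_form:
  "bounded_linear (\<lambda>T :: complex^'n^'n. x \<bullet> (T *v y))"
proof -
  have "linear (\<lambda>T :: complex^'n^'n. x \<bullet> (T *v y))"
  proof (rule linearI)
    fix S T :: "complex^'n^'n" and r :: real
    show "x \<bullet> ((S + T) *v y) = x \<bullet> (S *v y) + x \<bullet> (T *v y)"
      by (simp add: matrix_vector_mult_add_rdistrib inner_add_right)
    have "(r *\<^sub>R T) *v y = r *\<^sub>R (T *v y)"
      by (simp add: vec_eq_iff matrix_vector_mult_def scaleR_sum_right)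
    then show "x \<bullet> ((r *\<^sub>R T) *v y) = r *\<^sub>R (x \<bullet> (T *v y))"
      by simp
  qed
  then show ?thesis
    by (simp add: linear_conv_bounded_linear)
qed

lemma bounded_linear_ctranspose: "bounded_linear (ctranspose :: complex^'n^'n \<Rightarrow> complex^'n^'n)"
  unfolding linear_conv_bounded_linear[symmetric]
  by (rule linearI) (simp_all add: vec_eq_iff)

lemma matrix_entry_inner:
  fixes A :: "complex^'n^'n"
  shows "A $ i $ j = Complex (axis i 1 \<bullet> (A *v axis j 1)) (axis i \<i> \<bullet> (A *v axis j 1))"
proof -
  have "(A *v axis j 1) $ i = A $ i $ j"
    by (simp add: matrix_vector_mult_def axis_def if_distrib[of "\<lambda>x. _ * x"] cong: if_cong)
  then show ?thesis
    by (simp add: inner_axis' inner_complex_def complex_eq_iff)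
qed

lemma hermitian_polarization:
  assumes "hermitian A"
  shows "x \<bullet> (A *v y) = ((x + y) \<bullet> (A *v (x + y)) - x \<bullet> (A *v x) - y \<bullet> (A *v y)) / 2"
proof -
  have "y \<bullet> (A *v x) = x \<bullet> (A *v y)"
    using hermitian_inner[OF assms, of x y] by (simp add: inner_commute)
  then show ?thesis
    by (simp add: matrix_vector_right_distrib inner_add_left inner_add_right)
qed

text \<open>By polarization the quadratic forms determine all entries, so their convergence suffices.\<close>

lemma hermitian_tendsto_exists:
  fixes Z :: "'a \<Rightarrow> complex^'n^'n"
  assumes herm: "\<forall>\<^sub>F e in G. hermitian (Z e)"
    and conv: "\<And>x. \<exists>l. ((\<lambda>e. x \<bullet> (Z e *v x)) \<longlongrightarrow> l) G"
  shows "\<exists>L. (Z \<longlongrightarrow> L) G"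
proof -
  have bilinear: "\<exists>l. ((\<lambda>e. x \<bullet> (Z e *v y)) \<longlongrightarrow> l) G" for x y
  proof -
    obtain l1 l2 l3 where l: "((\<lambda>e. (x + y) \<bullet> (Z e *v (x + y))) \<longlongrightarrow> l1) G"
      "((\<lambda>e. x \<bullet> (Z e *v x)) \<longlongrightarrow> l2) G" "((\<lambda>e. y \<bullet> (Z e *v y)) \<longlongrightarrow> l3) G"
      using conv by meson
    have "((\<lambda>e. ((x + y) \<bullet> (Z e *v (x + y)) - x \<bullet> (Z e *v x) - y \<bullet> (Z e *v y)) / 2) \<longlongrightarrow> (l1 - l2 - l3) / 2) G"
      by (intro tendsto_intros l) simp
    moreover have "\<forall>\<^sub>F e in G. ((x + y) \<bullet> (Z e *v (x + y)) - x \<bullet> (Z e *v x) - y \<bullet> (Z e *v y)) / 2 = x \<bullet> (Z e *v y)"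
      using herm by eventually_elim (rule hermitian_polarization[symmetric])
    ultimately have "((\<lambda>e. x \<bullet> (Z e *v y)) \<longlongrightarrow> (l1 - l2 - l3) / 2) G"
      by (rule Lim_transform_eventually)
    then show ?thesis
      by blast
  qed
  then obtain l where l: "\<And>x y. ((\<lambda>e. x \<bullet> (Z e *v y)) \<longlongrightarrow> l x y) G"
    by metis
  have "(Z \<longlongrightarrow> (\<chi> i j. Complex (l (axis i 1) (axis j 1)) (l (axis i \<i>) (axis j 1)))) G"
  proof (intro vec_tendstoI)
    fix i j
    have "((\<lambda>e. Complex (axis i 1 \<bullet> (Z e *v axis j 1)) (axis i \<i> \<bullet> (Z e *v axis j 1))) \<longlongrightarrow>
        Complex (l (axis i 1) (axis j 1)) (l (axis i \<i>) (axis j 1))) G"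
      by (intro tendsto_Complex l)
    then show "((\<lambda>e. Z e $ i $ j) \<longlongrightarrow>
        (\<chi> i j. Complex (l (axis i 1) (axis j 1)) (l (axis i \<i>) (axis j 1))) $ i $ j) G"
      by (simp flip: matrix_entry_inner)
  qed
  then show ?thesis
    by blast
qed

lemma diag_in_add_mat:
  "unitary U \<Longrightarrow> diag_in U a + mat (complex_of_real e) = diag_in U (\<lambda>i. a i + e)"
  using diag_in_add[of U a "\<lambda>_. e"] by (simp add: diag_in_const)

lemma geo_mean_inv_eigenvalues:
  fixes U V :: "complex^'n^'n"
  assumes U: "unitary U" and V: "unitary V" and a: "\<And>i. 0 < a i" and b: "\<And>i. 0 < b i"
    and \<alpha>: "0 \<le> \<alpha>" "\<alpha> \<le> 1"
  obtains W z where "unitary W" "\<And>i. 0 < z i" "geo_mean_inv \<alpha> (diag_in U a) (diag_in V b) = diag_in W z"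
    "(\<chi> i. ln (z i)) \<in> convex hull
      {\<chi> i. (1 - \<alpha>) * ln (a (\<pi> i)) + \<alpha> * ln (b (\<rho> i)) | \<pi> \<rho>. bij \<pi> \<and> bij \<rho>}"
proof -
  have pd: "pos_def (diag_in U a)" "pos_def (diag_in V b)"
    using a b by (simp_all add: pos_def_diag_in_iff U V)
  obtain W z where W: "unitary W" "\<And>i. 0 < z i" "geo_mean_inv \<alpha> (diag_in U a) (diag_in V b) = diag_in W z"
    using pos_def_diagonalisation[OF pos_def_geo_mean_inv[OF pd]] by blast
  show ?thesis
    by (rule that[OF W ln_eigenvalues_geo_mean_convex_hull[OF U V W(1) a b W(2) \<alpha> W(3)]])
qed

lemma hull_eigenvalue_bounds:
  fixes a b z :: "'n::finite \<Rightarrow> real"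
  assumes a: "\<And>i. 0 < a i" "\<And>i. a i \<in> {m..M}" and b: "\<And>i. 0 < b i" "\<And>i. b i \<in> {m..M}"
    and z: "\<And>i. 0 < z i" and \<alpha>: "0 \<le> \<alpha>" "\<alpha> \<le> 1"
    and hull: "(\<chi> i. ln (z i)) \<in> convex hull
      {\<chi> i. (1 - \<alpha>) * ln (a (\<pi> i)) + \<alpha> * ln (b (\<rho> i)) | \<pi> \<rho>. bij \<pi> \<and> bij \<rho>}"
  shows "z i \<in> {m..M}"
proof -
  define J where "J = {t. exp t \<in> {m..M}}"
  have "is_interval J"
    unfolding is_interval_1 J_def by (auto intro: order_trans)
  then have J: "convex J"
    by (rule is_interval_convex)
  have "(\<chi> i. ln (z i)) $ i \<in> J"
  proof (rule convex_hull_coordinate[OF hull J], safe)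
    fix \<pi> \<rho> :: "'n \<Rightarrow> 'n" and i :: 'n
    have "ln (a (\<pi> i)) \<in> J" "ln (b (\<rho> i)) \<in> J"
      using a(1)[of "\<pi> i"] b(1)[of "\<rho> i"] a(2)[of "\<pi> i"] b(2)[of "\<rho> i"] by (simp_all add: J_def)
    then show "(\<chi> i. (1 - \<alpha>) * ln (a (\<pi> i)) + \<alpha> * ln (b (\<rho> i))) $ i \<in> J"
      using \<alpha> convexD[OF J, of "ln (a (\<pi> i))" "ln (b (\<rho> i))" "1 - \<alpha>" \<alpha>] by simp
  qed
  then show ?thesis
    using z[of i] by (simp add: J_def)
qed

lemma geo_mean_inv_bounds:
  fixes U V :: "complex^'n^'n"
  assumes U: "unitary U" and V: "unitary V"
    and a: "\<And>i. 0 < a i" "\<And>i. a i \<in> {m..M}" and b: "\<And>i. 0 < b i" "\<And>i. b i \<in> {m..M}"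
    and \<alpha>: "0 \<le> \<alpha>" "\<alpha> \<le> 1"
  shows "m * (norm x)\<^sup>2 \<le> x \<bullet> (geo_mean_inv \<alpha> (diag_in U a) (diag_in V b) *v x)"
    "x \<bullet> (geo_mean_inv \<alpha> (diag_in U a) (diag_in V b) *v x) \<le> M * (norm x)\<^sup>2"
proof -
  obtain W z where W: "unitary W" "\<And>i. 0 < z i" "geo_mean_inv \<alpha> (diag_in U a) (diag_in V b) = diag_in W z"
    "(\<chi> i. ln (z i)) \<in> convex hull
      {\<chi> i. (1 - \<alpha>) * ln (a (\<pi> i)) + \<alpha> * ln (b (\<rho> i)) | \<pi> \<rho>. bij \<pi> \<and> bij \<rho>}"
    by (rule geo_mean_inv_eigenvalues[where U = U and V = V and a = a and b = b, OF U V a(1) b(1) \<alpha>])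
      (rule that)
  have z: "m \<le> z i" "z i \<le> M" for i
    using hull_eigenvalue_bounds[where a = a and b = b and z = z, OF a b W(2) \<alpha> W(4), of i] by auto
  show "m * (norm x)\<^sup>2 \<le> x \<bullet> (geo_mean_inv \<alpha> (diag_in U a) (diag_in V b) *v x)"
    using inner_diag_in_mono[of "\<lambda>_. m" z x W] z(1) by (simp add: W(3) inner_diag_in_const[OF W(1)])
  show "x \<bullet> (geo_mean_inv \<alpha> (diag_in U a) (diag_in V b) *v x) \<le> M * (norm x)\<^sup>2"
    using inner_diag_in_mono[of z "\<lambda>_. M" x W] z(2) by (simp add: W(3) inner_diag_in_const[OF W(1)])
qed

text \<open>The limit in the definition of the mean exists, because the quadratic forms of the
  regularised means are bounded below and decrease with the regularisation.\<close>

lemma geo_mean_tendsto: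
  fixes U V :: "complex^'n^'n"
  assumes U: "unitary U" and V: "unitary V" and a: "\<And>i. 0 \<le> a i" and b: "\<And>i. 0 \<le> b i"
    and \<alpha>: "0 \<le> \<alpha>" "\<alpha> \<le> 1"
    and sing: "\<not> (invertible (diag_in U a) \<and> invertible (diag_in V b))"
  shows "((\<lambda>e. geo_mean_inv \<alpha> (diag_in U (\<lambda>i. a i + e)) (diag_in V (\<lambda>i. b i + e)))
    \<longlongrightarrow> geo_mean \<alpha> (diag_in U a) (diag_in V b)) (at_right 0)"
proof -
  define Z where "Z e = geo_mean_inv \<alpha> (diag_in U (\<lambda>i. a i + e)) (diag_in V (\<lambda>i. b i + e))" for e
  have pd: "pos_def (diag_in U (\<lambda>i. a i + e))" "pos_def (diag_in V (\<lambda>i. b i + e))" if "0 < e" for e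
    using a b that by (simp_all add: pos_def_diag_in_iff U V add_nonneg_pos)
  have pdZ: "pos_def (Z e)" if "0 < e" for e
    unfolding Z_def by (rule pos_def_geo_mean_inv[OF pd[OF that]])
  have "\<exists>l. ((\<lambda>e. x \<bullet> (Z e *v x)) \<longlongrightarrow> l) (at_right 0)" for x
  proof -
    have "((\<lambda>e. x \<bullet> (Z e *v x)) \<longlongrightarrow> Inf ((\<lambda>e. x \<bullet> (Z e *v x)) ` ({0<..} \<inter> UNIV))) (at 0 within ({0<..} \<inter> UNIV))"
    proof (rule Lim_right_bound)
      fix s t :: real
      assume st: "0 < s" "s \<le> t"
      show "x \<bullet> (Z s *v x) \<le> x \<bullet> (Z t *v x)"
        unfolding Z_def using st by (intro geo_mean_inv_mono pd \<alpha> inner_diag_in_mono) auto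
    next
      fix s :: real
      assume "0 < s"
      then show "0 \<le> x \<bullet> (Z s *v x)"
        using pdZ[of s] by (cases "x = 0") (auto simp: pos_def_def less_imp_le)
    qed
    then show ?thesis
      by auto
  qed
  moreover have "\<forall>\<^sub>F e in at_right 0. hermitian (Z e)"
    using eventually_at_right_less[of "0::real"] by eventually_elim (use pdZ in \<open>simp add: pos_def_def\<close>)
  ultimately obtain L where L: "(Z \<longlongrightarrow> L) (at_right 0)"
    using hermitian_tendsto_exists[of Z "at_right 0"] by blast
  have "geo_mean \<alpha> (diag_in U a) (diag_in V b) = Lim (at_right 0) Z"
    using sing by (auto simp: geo_mean_def Z_def[abs_def] diag_in_add_mat[OF U] diag_in_add_mat[OF V])
  also have "\<dots> = L"
    by (rule tendsto_Lim[OF trivial_limit_at_right_real L])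
  finally show ?thesis
    using L by (simp add: Z_def[abs_def])
qed

lemma geo_mean_properties:
  fixes U V :: "complex^'n^'n"
  assumes U: "unitary U" and V: "unitary V" and m: "0 \<le> m"
    and a: "\<And>i. a i \<in> {m..M}" and b: "\<And>i. b i \<in> {m..M}" and \<alpha>: "0 \<le> \<alpha>" "\<alpha> \<le> 1"
  shows "hermitian (geo_mean \<alpha> (diag_in U a) (diag_in V b))" (is "hermitian ?Z")
    "m * (norm x)\<^sup>2 \<le> x \<bullet> (geo_mean \<alpha> (diag_in U a) (diag_in V b) *v x)"
    "x \<bullet> (geo_mean \<alpha> (diag_in U a) (diag_in V b) *v x) \<le> M * (norm x)\<^sup>2"
proof -
  have "hermitian ?Z \<and> m * (norm x)\<^sup>2 \<le> x \<bullet> (?Z *v x) \<and> x \<bullet> (?Z *v x) \<le> M * (norm x)\<^sup>2"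
  proof (cases "invertible (diag_in U a) \<and> invertible (diag_in V b)")
    case True
    have ab: "0 < a i" "0 < b i" for i
    proof -
      have "a i \<noteq> 0" "b i \<noteq> 0"
        using True by (simp_all add: invertible_diag_in U V)
      then show "0 < a i" "0 < b i"
        using a[of i] b[of i] m by auto
    qed
    have pd: "pos_def (diag_in U a)" "pos_def (diag_in V b)"
      using ab by (simp_all add: pos_def_diag_in_iff U V)
    show ?thesis
      using True pos_def_geo_mean_inv[OF pd, of \<alpha>]
        geo_mean_inv_bounds[where U = U and V = V and a = a and b = b, OF U V ab(1) a ab(2) b \<alpha>, of x]
      by (simp add: geo_mean_def pos_def_def)
  next
    case False
    define Z where "Z e = geo_mean_inv \<alpha> (diag_in U (\<lambda>i. a i + e)) (diag_in V (\<lambda>i. b i + e))" for e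
    have ab0: "0 \<le> a i" "0 \<le> b i" for i
      using a[of i] b[of i] m by auto
    have lim: "(Z \<longlongrightarrow> ?Z) (at_right 0)"
      unfolding Z_def by (rule geo_mean_tendsto[OF U V ab0 \<alpha> False])
    have pos: "\<forall>\<^sub>F e in at_right 0. (0::real) < e"
      by (rule eventually_at_right_less)
    have ab: "0 < a i + e" "a i + e \<in> {m..M + e}" "0 < b i + e" "b i + e \<in> {m..M + e}" if "0 < e" for e i
      using a[of i] b[of i] m that by auto
    have bnd: "m * (norm x)\<^sup>2 \<le> x \<bullet> (Z e *v x)" "x \<bullet> (Z e *v x) \<le> (M + e) * (norm x)\<^sup>2"
      and hZ: "hermitian (Z e)" if "0 < e" for e
    proof -
      show "m * (norm x)\<^sup>2 \<le> x \<bullet> (Z e *v x)" "x \<bullet> (Z e *v x) \<le> (M + e) * (norm x)\<^sup>2"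
        unfolding Z_def by (rule geo_mean_inv_bounds[OF U V ab[OF that] \<alpha>])+
      have "pos_def (Z e)"
        unfolding Z_def using ab[OF that]
        by (intro pos_def_geo_mean_inv) (simp_all add: pos_def_diag_in_iff U V)
      then show "hermitian (Z e)"
        by (simp add: pos_def_def)
    qed
    have "((\<lambda>e. ctranspose (Z e)) \<longlongrightarrow> ctranspose ?Z) (at_right 0)"
      by (rule bounded_linear.tendsto[OF bounded_linear_ctranspose lim])
    moreover have "\<forall>\<^sub>F e in at_right 0. ctranspose (Z e) = Z e"
      using pos by eventually_elim (use hZ in \<open>simp add: hermitian_def\<close>)
    ultimately have "(Z \<longlongrightarrow> ctranspose ?Z) (at_right 0)"
      by (rule Lim_transform_eventually)
    then have "hermitian ?Z"
      unfolding hermitian_def by (rule tendsto_unique[OF trivial_limit_at_right_real _ lim])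
    moreover have lim_form: "((\<lambda>e. x \<bullet> (Z e *v x)) \<longlongrightarrow> x \<bullet> (?Z *v x)) (at_right 0)"
      by (rule bounded_linear.tendsto[OF bounded_linear_inner_form lim])
    have "m * (norm x)\<^sup>2 \<le> x \<bullet> (?Z *v x)"
      by (rule tendsto_lowerbound[OF lim_form _ trivial_limit_at_right_real])
         (use pos bnd(1) in \<open>auto elim: eventually_mono\<close>)
    moreover have "x \<bullet> (?Z *v x) \<le> M * (norm x)\<^sup>2"
    proof (rule tendsto_le[OF trivial_limit_at_right_real _ lim_form])
      have "((\<lambda>e. (M + e) * (norm x)\<^sup>2) \<longlongrightarrow> (M + 0) * (norm x)\<^sup>2) (at_right 0)"
        by (intro tendsto_intros)
      then show "((\<lambda>e. (M + e) * (norm x)\<^sup>2) \<longlongrightarrow> M * (norm x)\<^sup>2) (at_right 0)"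
        by simp
      show "\<forall>\<^sub>F e in at_right 0. x \<bullet> (Z e *v x) \<le> (M + e) * (norm x)\<^sup>2"
        using pos by eventually_elim (rule bnd(2))
    qed
    ultimately show ?thesis
      by blast
  qed
  then show "hermitian ?Z" "m * (norm x)\<^sup>2 \<le> x \<bullet> (?Z *v x)" "x \<bullet> (?Z *v x) \<le> M * (norm x)\<^sup>2"
    by blast+
qed

lemma geo_mean_0_1:
  fixes U V :: "complex^'n^'n"
  assumes U: "unitary U" and V: "unitary V" and a: "\<And>i. 0 \<le> a i" and b: "\<And>i. 0 \<le> b i"
  shows "geo_mean 0 (diag_in U a) (diag_in V b) = diag_in U a"
    "geo_mean 1 (diag_in U a) (diag_in V b) = diag_in V b"
proof -
  have "geo_mean 0 (diag_in U a) (diag_in V b) = diag_in U a \<and>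
    geo_mean 1 (diag_in U a) (diag_in V b) = diag_in V b"
  proof (cases "invertible (diag_in U a) \<and> invertible (diag_in V b)")
    case True
    then have "a i \<noteq> 0" "b i \<noteq> 0" for i
      by (simp_all add: invertible_diag_in U V)
    then have pd: "pos_def (diag_in U a)" "pos_def (diag_in V b)"
      using a b by (simp_all add: pos_def_diag_in_iff U V order_less_le)
    show ?thesis
      using True geo_mean_inv_0_1[OF pd] by (simp add: geo_mean_def)
  next
    case False
    have pd: "pos_def (diag_in U (\<lambda>i. a i + e))" "pos_def (diag_in V (\<lambda>i. b i + e))" if "0 < e" for e
      using a b that by (simp_all add: pos_def_diag_in_iff U V add_nonneg_pos)
    have reg: "((\<lambda>e. diag_in W (\<lambda>i. c i + e)) \<longlongrightarrow> diag_in W c) (at_right 0)"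
      if W: "unitary W" for W :: "complex^'n^'n" and c
    proof -
      have m: "mat (complex_of_real e) = e *\<^sub>R (mat 1 :: complex^'n^'n)" for e
        by (simp add: vec_eq_iff mat_def complex_eq_iff)
      have "((\<lambda>e. diag_in W c + e *\<^sub>R (mat 1 :: complex^'n^'n)) \<longlongrightarrow> diag_in W c + 0 *\<^sub>R (mat 1 :: complex^'n^'n)) (at_right 0)"
        by (intro tendsto_intros)
      then show ?thesis
        by (simp flip: diag_in_add_mat[OF W] m)
    qed
    have eq0: "\<forall>\<^sub>F e in at_right 0. diag_in U (\<lambda>i. a i + e) = geo_mean_inv 0 (diag_in U (\<lambda>i. a i + e)) (diag_in V (\<lambda>i. b i + e))"
      and eq1: "\<forall>\<^sub>F e in at_right 0. diag_in V (\<lambda>i. b i + e) = geo_mean_inv 1 (diag_in U (\<lambda>i. a i + e)) (diag_in V (\<lambda>i. b i + e))"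
      using eventually_at_right_less[of "0::real"]
      by (eventually_elim, simp add: geo_mean_inv_0_1[OF pd])+
    have "geo_mean 0 (diag_in U a) (diag_in V b) = diag_in U a"
      by (rule tendsto_unique[OF trivial_limit_at_right_real geo_mean_tendsto[OF U V a b _ _ False]
            Lim_transform_eventually[OF reg[OF U] eq0]]) auto
    moreover have "geo_mean 1 (diag_in U a) (diag_in V b) = diag_in V b"
      by (rule tendsto_unique[OF trivial_limit_at_right_real geo_mean_tendsto[OF U V a b _ _ False]
            Lim_transform_eventually[OF reg[OF V] eq1]]) auto
    ultimately show ?thesis
      by blast
  qed
  then show "geo_mean 0 (diag_in U a) (diag_in V b) = diag_in U a"
    "geo_mean 1 (diag_in U a) (diag_in V b) = diag_in V b"
    by blast+
qed

section \<open>The pointwise inequality\<close>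

text \<open>The value that the derived anti-norm with exponent \<open>p\<close> takes at non-negative eigenvalues
  \<open>h\<close>, zeros included.\<close>

definition anti0 :: "(complex^'n^'n \<Rightarrow> real) \<Rightarrow> real \<Rightarrow> ('n \<Rightarrow> real) \<Rightarrow> real"
  where "anti0 N p h = (if \<forall>i. h i \<noteq> 0 then anti N p h else 0)"

text \<open>A functional of \<open>T\<close> that is affine, hence commutes with the integral over the geodesic. It
  is used with a dominating vector \<open>q\<close>, an eigenbasis \<open>E\<close> of the integrated mean and affine
  majorants of \<open>f\<close>, one for each eigenvalue of that mean.\<close>

definition affine_form ::
    "complex^'n^'n \<Rightarrow> ('n \<Rightarrow> real) \<Rightarrow> ('n \<Rightarrow> real) \<Rightarrow> ('n \<Rightarrow> real) \<Rightarrow> complex^'n^'n \<Rightarrow> real"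
  where "affine_form E q c d T =
    (\<Sum>i\<in>UNIV. q i * (c i * ((E *v axis i 1) \<bullet> (T *v (E *v axis i 1))) + d i))"

lemma anti0_nonneg [simp]: "0 \<le> anti0 N p h"
  by (simp add: anti0_def)

lemma affine_form_nonneg:
  fixes T :: "complex^'n^'n"
  assumes E: "unitary E" and q: "anti_dominating N p q"
    and f: "\<And>t. t \<in> {m..M} \<Longrightarrow> 0 \<le> f t" "\<And>t i. t \<in> {m..M} \<Longrightarrow> f t \<le> c i * t + d i"
    and T: "\<And>x. m * (norm x)\<^sup>2 \<le> x \<bullet> (T *v x)" "\<And>x. x \<bullet> (T *v x) \<le> M * (norm x)\<^sup>2"
  shows "0 \<le> affine_form E q c d T"
  unfolding affine_form_def
proof (intro sum_nonneg mult_nonneg_nonneg)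
  fix i
  show "0 \<le> q i"
    using q by (simp add: anti_dominating_def)
  define t where "t = (E *v axis i 1) \<bullet> (T *v (E *v axis i 1))"
  have "t \<in> {m..M}"
    using T[of "E *v axis i 1"] unitary_column_norm[OF E, of i] by (simp add: t_def)
  then show "0 \<le> c i * ((E *v axis i 1) \<bullet> (T *v (E *v axis i 1))) + d i"
    using f(1)[of t] f(2)[of t i] unfolding t_def by linarith
qed

text \<open>Replacing \<open>f\<close> by affine majorants turns the diagonal entries of \<open>f T\<close> in the basis
  \<open>E\<close> into affine functions of those of \<open>T\<close>; this is Jensen's inequality for \<open>f\<close>.\<close>

lemma anti0_le_affine_form:
  fixes z :: "'n::finite \<Rightarrow> real"
  assumes E: "unitary E" and W: "unitary W" and q: "anti_dominating N p q"
    and f: "\<And>t. t \<in> {m..M} \<Longrightarrow> 0 \<le> f t" "\<And>t i. t \<in> {m..M} \<Longrightarrow> f t \<le> c i * t + d i"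
    and z: "\<And>j. z j \<in> {m..M}"
  shows "anti0 N p (\<lambda>j. f (z j)) \<le> affine_form E q c d (diag_in W z)"
proof -
  have EW: "unitary (ctranspose E ** W)"
    using E W by (simp add: unitary_mult unitary_ctranspose)
  define w where "w i j = (cmod ((ctranspose E ** W) $ i $ j))\<^sup>2" for i j
  have q0: "0 \<le> q i" for i
    using q by (simp add: anti_dominating_def)
  have fz: "0 \<le> f (z j)" for j
    using f(1) z by blast
  have "anti0 N p (\<lambda>j. f (z j)) \<le> (\<Sum>i\<in>UNIV. q i * (\<Sum>j\<in>UNIV. w i j * f (z j)))"
  proof (cases "\<forall>j. f (z j) \<noteq> 0")
    case True
    then have "\<forall>j. 0 < f (z j)"
      using fz by (simp add: order_less_le)
    then show ?thesis
      using True q EW unfolding anti_dominating_def anti0_def w_def by simp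
  next
    case False
    then show ?thesis
      using fz q0 by (auto simp: anti0_def w_def intro!: sum_nonneg mult_nonneg_nonneg)
  qed
  also have "\<dots> \<le> (\<Sum>i\<in>UNIV. q i * (\<Sum>j\<in>UNIV. w i j * (c i * z j + d i)))"
    using f(2)[OF z] by (intro sum_mono mult_left_mono q0) (auto simp: w_def)
  also have "\<dots> = (\<Sum>i\<in>UNIV. q i * (c i * (\<Sum>j\<in>UNIV. w i j * z j) + d i))"
  proof (intro sum.cong refl arg_cong2[where f = "(*)"])
    fix i
    have "(\<Sum>j\<in>UNIV. w i j * (c i * z j + d i)) = c i * (\<Sum>j\<in>UNIV. w i j * z j) + (\<Sum>j\<in>UNIV. w i j) * d i"
      by (simp add: distrib_left sum.distrib sum_distrib_left sum_distrib_right mult.left_commute)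
    then show "(\<Sum>j\<in>UNIV. w i j * (c i * z j + d i)) = c i * (\<Sum>j\<in>UNIV. w i j * z j) + d i"
      using unitary_row_sum[OF EW, of i] by (simp add: w_def)
  qed
  also have "\<dots> = affine_form E q c d (diag_in W z)"
    by (simp add: affine_form_def w_def inner_diag_in_column[OF E])
  finally show ?thesis .
qed

lemma doubly_concave_nonneg: "doubly_concave_on \<Omega> f \<Longrightarrow> t \<in> \<Omega> \<Longrightarrow> 0 \<le> f t"
  by (simp add: doubly_concave_on_def)

lemma anti_le_affine_form_geo_mean_inv:
  fixes U V :: "complex^'n^'n"
  assumes N: "symmetric_norm (N :: complex^'n^'n \<Rightarrow> real)" and p: "0 < p"
    and \<Omega>: "is_interval \<Omega>" and f: "doubly_concave_on \<Omega> f" and sub: "{m..M} \<subseteq> \<Omega>"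
    and E: "unitary E" and U: "unitary U" and V: "unitary V" and q: "anti_dominating N p q"
    and le: "\<And>t i. t \<in> {m..M} \<Longrightarrow> f t \<le> c i * t + d i"
    and a: "\<And>i. 0 < a i" "\<And>i. a i \<in> {m..M}" "\<And>i. 0 < f (a i)"
    and b: "\<And>i. 0 < b i" "\<And>i. b i \<in> {m..M}" "\<And>i. 0 < f (b i)"
    and \<alpha>: "0 \<le> \<alpha>" "\<alpha> \<le> 1"
  shows "anti N p (\<lambda>i. f (a i)) powr (1 - \<alpha>) * anti N p (\<lambda>i. f (b i)) powr \<alpha>
    \<le> affine_form E q c d (geo_mean_inv \<alpha> (diag_in U a) (diag_in V b))"
proof -
  obtain W z where W: "unitary W" "\<And>i. 0 < z i" "geo_mean_inv \<alpha> (diag_in U a) (diag_in V b) = diag_in W z"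
    "(\<chi> i. ln (z i)) \<in> convex hull
      {\<chi> i. (1 - \<alpha>) * ln (a (\<pi> i)) + \<alpha> * ln (b (\<rho> i)) | \<pi> \<rho>. bij \<pi> \<and> bij \<rho>}"
    by (rule geo_mean_inv_eigenvalues[where U = U and V = V and a = a and b = b, OF U V a(1) b(1) \<alpha>])
      (rule that)
  have a\<Omega>: "a i \<in> \<Omega>" and b\<Omega>: "b i \<in> \<Omega>" for i
    using a(2) b(2) sub by blast+
  note geo = anti_geometric_mean[where a = a and b = b and z = z,
      OF N p \<Omega> f a(1) a\<Omega> a(3) b(1) b\<Omega> b(3) W(2) \<alpha> W(4)]
  have z: "z i \<in> {m..M}" for i
    by (rule hull_eigenvalue_bounds[where a = a and b = b and z = z, OF a(1,2) b(1,2) W(2) \<alpha> W(4)])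
  have "anti N p (\<lambda>i. f (z i)) = anti0 N p (\<lambda>i. f (z i))"
    using geo(2) by (simp add: anti0_def less_imp_neq[symmetric])
  also have "\<dots> \<le> affine_form E q c d (diag_in W z)"
    using doubly_concave_nonneg[OF f] sub le
    by (intro anti0_le_affine_form[OF E W(1) q _ _ z, where f = f]) auto
  finally show ?thesis
    using geo(3) by (simp add: W(3))
qed

lemma doubly_concave_on_scale:
  assumes f: "doubly_concave_on \<Omega> f" and r: "0 < r"
  shows "doubly_concave_on {t. r * t \<in> \<Omega>} (\<lambda>t. f (r * t))"
  unfolding doubly_concave_on_def
proof (intro conjI ballI)
  show "0 \<le> f (r * x)" if "x \<in> {t. r * t \<in> \<Omega>}" for x
    using f that by (simp add: doubly_concave_on_def)
  show "continuous_on {t. r * t \<in> \<Omega>} (\<lambda>t. f (r * t))"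
  proof (rule continuous_on_compose2[where g = f and t = \<Omega>])
    show "continuous_on \<Omega> f"
      using f by (simp add: doubly_concave_on_def)
    show "continuous_on {t. r * t \<in> \<Omega>} (\<lambda>t. r * t)"
      by (rule continuous_on_mult_left[OF continuous_on_id])
  qed blast
  have conc: "concave_on \<Omega> f"
    using f by (simp add: doubly_concave_on_def)
  show "concave_on {t. r * t \<in> \<Omega>} (\<lambda>t. f (r * t))"
    unfolding concave_on_iff
  proof (intro conjI ballI allI impI convexI)
    fix x y u v :: real
    assume xy: "x \<in> {t. r * t \<in> \<Omega>}" "y \<in> {t. r * t \<in> \<Omega>}" and uv: "0 \<le> u" "0 \<le> v" "u + v = 1"
    have e: "r * (u *\<^sub>R x + v *\<^sub>R y) = u *\<^sub>R (r * x) + v *\<^sub>R (r * y)"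
      by (simp add: algebra_simps)
    show "u *\<^sub>R x + v *\<^sub>R y \<in> {t. r * t \<in> \<Omega>}"
      unfolding mem_Collect_eq e using xy uv concave_on_imp_convex[OF conc] by (intro convexD) auto
    show "u * f (r * x) + v * f (r * y) \<le> f (r * (u *\<^sub>R x + v *\<^sub>R y))"
      unfolding e using conc xy uv unfolding concave_on_iff by blast
  qed
  fix x y
  assume xy: "x \<in> {t. r * t \<in> \<Omega>}" "y \<in> {t. r * t \<in> \<Omega>}"
  have "r * sqrt (x * y) = sqrt ((r * x) * (r * y))"
    using r by (simp add: real_sqrt_mult)
  then show "sqrt (f (r * x) * f (r * y)) \<le> f (r * sqrt (x * y))"
    using f xy by (simp add: doubly_concave_on_def)
qed

lemma is_interval_scale:
  fixes \<Omega> :: "real set"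
  assumes "is_interval \<Omega>" "0 < r"
  shows "is_interval {t. r * t \<in> \<Omega>}"
  unfolding is_interval_1
proof (intro ballI allI impI)
  fix x y t
  assume "x \<in> {t. r * t \<in> \<Omega>}" "y \<in> {t. r * t \<in> \<Omega>}" "x \<le> t \<and> t \<le> y"
  then have "r * x \<in> \<Omega>" "r * y \<in> \<Omega>" "r * x \<le> r * t" "r * t \<le> r * y"
    using assms(2) by auto
  then show "t \<in> {t. r * t \<in> \<Omega>}"
    using assms(1) unfolding is_interval_1 by blast
qed

lemma tendsto_affine_form:
  assumes "(Z \<longlongrightarrow> L) G" and "(r \<longlongrightarrow> 1) G"
  shows "((\<lambda>e. affine_form E q (\<lambda>i. c i * r e) d (Z e)) \<longlongrightarrow> affine_form E q c d L) G"
proof -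
  have "((\<lambda>e. affine_form E q (\<lambda>i. c i * r e) d (Z e)) \<longlongrightarrow> affine_form E q (\<lambda>i. c i * 1) d L) G"
    unfolding affine_form_def
    by (intro tendsto_intros bounded_linear.tendsto[OF bounded_linear_inner_form] assms)
  then show ?thesis
    by simp
qed

text \<open>A regularised pair may have eigenvalues outside \<open>\<Omega>\<close>. Scaling by \<open>M / (M + e)\<close> moves
  them back into \<open>{m..M}\<close>; the scaling is carried out on \<open>f\<close> instead of the matrices.\<close>

lemma anti_le_affine_form_geo_mean_singular:
  fixes U V :: "complex^'n^'n"
  assumes N: "symmetric_norm (N :: complex^'n^'n \<Rightarrow> real)" and p: "0 < p"
    and \<Omega>: "is_interval \<Omega>" and f: "doubly_concave_on \<Omega> f" and sub: "{m..M} \<subseteq> \<Omega>"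
    and m: "0 \<le> m" and M: "0 < M"
    and E: "unitary E" and U: "unitary U" and V: "unitary V" and q: "anti_dominating N p q"
    and le: "\<And>t i. t \<in> {m..M} \<Longrightarrow> f t \<le> c i * t + d i"
    and a: "\<And>i. a i \<in> {m..M}" "\<And>i. 0 < f (a i)"
    and b: "\<And>i. b i \<in> {m..M}" "\<And>i. 0 < f (b i)"
    and \<alpha>: "0 \<le> \<alpha>" "\<alpha> \<le> 1"
    and sing: "\<not> (invertible (diag_in U a) \<and> invertible (diag_in V b))"
  shows "anti N p (\<lambda>i. f (a i)) powr (1 - \<alpha>) * anti N p (\<lambda>i. f (b i)) powr \<alpha>
    \<le> affine_form E q c d (geo_mean \<alpha> (diag_in U a) (diag_in V b))"
proof (rule field_le_mult_one_interval)
  fix \<kappa> :: real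
  assume \<kappa>: "0 < \<kappa>" "\<kappa> < 1"
  define Z where "Z e = geo_mean_inv \<alpha> (diag_in U (\<lambda>i. a i + e)) (diag_in V (\<lambda>i. b i + e))" for e
  define r where "r e = M / (M + e)" for e
  have pos: "\<forall>\<^sub>F e in at_right 0. (0::real) < e"
    by (rule eventually_at_right_less)
  have r: "(r \<longlongrightarrow> 1) (at_right 0)"
  proof -
    have "((\<lambda>e. M / (M + e)) \<longlongrightarrow> M / (M + 0)) (at_right 0)"
      by (intro tendsto_intros) (use M in auto)
    then show ?thesis
      using M by (simp add: r_def[abs_def])
  qed
  have r0: "0 < r e" if "0 < e" for e
    using M that by (simp add: r_def)
  have rescaled: "r e * (t + e) \<in> {m..M}" if "0 < e" "t \<in> {m..M}" for e t
  proof -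
    have "t * (M + e) \<le> M * (t + e)" "M * (t + e) \<le> M * (M + e)"
      using that M by (auto simp: algebra_simps intro!: mult_right_mono)
    then have "t \<le> r e * (t + e)" "r e * (t + e) \<le> M"
      using that M by (simp_all add: r_def field_simps)
    then show ?thesis
      using that by auto
  qed
  have cont: "continuous_on {m..M} f"
    using f sub by (auto simp: doubly_concave_on_def intro: continuous_on_subset)
  have ev: "\<forall>\<^sub>F e in at_right 0. \<forall>i. \<kappa> * f (g i) \<le> f (r e * (g i + e))"
    if g: "\<And>i. g i \<in> {m..M}" "\<And>i. 0 < f (g i)" for g :: "'n \<Rightarrow> real"
  proof (rule eventually_all_finite)
    fix i
    have "((\<lambda>e. r e * (g i + e)) \<longlongrightarrow> 1 * (g i + 0)) (at_right 0)"
      by (intro tendsto_intros r)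
    then have "((\<lambda>e. f (r e * (g i + e))) \<longlongrightarrow> f (g i)) (at_right 0)"
      by (intro continuous_on_tendsto_compose[OF cont])
        (use g pos rescaled in \<open>auto elim!: eventually_mono\<close>)
    moreover have "\<kappa> * f (g i) < f (g i)"
      using g(2)[of i] \<kappa> by simp
    ultimately have "\<forall>\<^sub>F e in at_right 0. \<kappa> * f (g i) < f (r e * (g i + e))"
      by (rule order_tendstoD(1))
    then show "\<forall>\<^sub>F e in at_right 0. \<kappa> * f (g i) \<le> f (r e * (g i + e))"
      by (rule eventually_mono) simp
  qed
  have "\<forall>\<^sub>F e in at_right 0. \<kappa> * (anti N p (\<lambda>i. f (a i)) powr (1 - \<alpha>) * anti N p (\<lambda>i. f (b i)) powr \<alpha>)
      \<le> affine_form E q (\<lambda>i. c i * r e) d (Z e)"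
    using pos ev[OF a] ev[OF b]
  proof eventually_elim
    fix e :: real
    assume e: "0 < e" and ka: "\<forall>i. \<kappa> * f (a i) \<le> f (r e * (a i + e))"
      and kb: "\<forall>i. \<kappa> * f (b i) \<le> f (r e * (b i + e))"
    have \<kappa>f: "0 < \<kappa> * f (a i)" "0 < \<kappa> * f (b i)" for i
      using a(2) b(2) \<kappa> by simp_all
    have anti_a: "\<kappa> * anti N p (\<lambda>i. f (a i)) \<le> anti N p (\<lambda>i. f (r e * (a i + e)))"
      using anti_mono[where s = "\<lambda>i. \<kappa> * f (a i)" and t = "\<lambda>i. f (r e * (a i + e))", OF N p \<kappa>f(1)] ka
      by (simp add: anti_scale[OF N p \<kappa>(1) a(2)])
    have anti_b: "\<kappa> * anti N p (\<lambda>i. f (b i)) \<le> anti N p (\<lambda>i. f (r e * (b i + e)))"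
      using anti_mono[where s = "\<lambda>i. \<kappa> * f (b i)" and t = "\<lambda>i. f (r e * (b i + e))", OF N p \<kappa>f(2)] kb
      by (simp add: anti_scale[OF N p \<kappa>(1) b(2)])
    have "\<kappa> = \<kappa> powr (1 - \<alpha>) * \<kappa> powr \<alpha>"
      using \<kappa> by (simp add: powr_add[symmetric])
    then have "\<kappa> * (anti N p (\<lambda>i. f (a i)) powr (1 - \<alpha>) * anti N p (\<lambda>i. f (b i)) powr \<alpha>)
        = (\<kappa> * anti N p (\<lambda>i. f (a i))) powr (1 - \<alpha>) * (\<kappa> * anti N p (\<lambda>i. f (b i))) powr \<alpha>"
      using \<kappa> by (simp add: powr_mult mult.commute mult.left_commute)
    also have "\<dots> \<le> anti N p (\<lambda>i. f (r e * (a i + e))) powr (1 - \<alpha>) * anti N p (\<lambda>i. f (r e * (b i + e))) powr \<alpha>"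
      using anti_a anti_b \<alpha> \<kappa> by (intro mult_mono powr_mono2) auto
    also have "\<dots> \<le> affine_form E q (\<lambda>i. c i * r e) d (Z e)"
      unfolding Z_def
    proof (rule anti_le_affine_form_geo_mean_inv[where f = "\<lambda>t. f (r e * t)" and m = "m / r e" and M = "M / r e",
          OF N p is_interval_scale[OF \<Omega> r0[OF e]] doubly_concave_on_scale[OF f r0[OF e]] _ E U V q])
      have in_iff: "t \<in> {m / r e..M / r e} \<longleftrightarrow> r e * t \<in> {m..M}" for t
        using r0[OF e] by (simp add: field_simps)
      show "{m / r e..M / r e} \<subseteq> {t. r e * t \<in> \<Omega>}"
        using in_iff sub by blast
      show "f (r e * t) \<le> c i * r e * t + d i" if "t \<in> {m / r e..M / r e}" for t i
        using le[of "r e * t" i] that in_iff by (simp add: mult.assoc)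
      show "0 < a i + e" "0 < b i + e" for i
        using a(1)[of i] b(1)[of i] m e by auto
      show "a i + e \<in> {m / r e..M / r e}" "b i + e \<in> {m / r e..M / r e}" for i
        unfolding in_iff using a(1) b(1) rescaled e by blast+
      show "0 < f (r e * (a i + e))" "0 < f (r e * (b i + e))" for i
        using ka kb \<kappa>f less_le_trans by blast+
    qed (use \<alpha> in auto)
    finally show "\<kappa> * (anti N p (\<lambda>i. f (a i)) powr (1 - \<alpha>) * anti N p (\<lambda>i. f (b i)) powr \<alpha>)
      \<le> affine_form E q (\<lambda>i. c i * r e) d (Z e)" .
  qed
  moreover have "((\<lambda>e. affine_form E q (\<lambda>i. c i * r e) d (Z e)) \<longlongrightarrow>
      affine_form E q c d (geo_mean \<alpha> (diag_in U a) (diag_in V b))) (at_right 0)"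
  proof (rule tendsto_affine_form[OF _ r])
    have "0 \<le> a i" "0 \<le> b i" for i
      using a(1)[of i] b(1)[of i] m by auto
    then show "(Z \<longlongrightarrow> geo_mean \<alpha> (diag_in U a) (diag_in V b)) (at_right 0)"
      unfolding Z_def by (intro geo_mean_tendsto U V \<alpha> sing) auto
  qed
  ultimately show "\<kappa> * (anti N p (\<lambda>i. f (a i)) powr (1 - \<alpha>) * anti N p (\<lambda>i. f (b i)) powr \<alpha>)
      \<le> affine_form E q c d (geo_mean \<alpha> (diag_in U a) (diag_in V b))"
    by (intro tendsto_lowerbound) (auto simp: trivial_limit_at_right_real)
qed

text \<open>The inequality at a single point of the geodesic, in a form that is ready to be integrated.
  For \<open>0 < \<alpha> < 1\<close> the left-hand side vanishes as soon as one of the two values of the anti-norm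
  does; at the end points the mean is one of the two matrices, and \<open>powr1\<close> ignores the other
  value.\<close>

lemma pointwise_bound:
  fixes U V :: "complex^'n^'n"
  assumes N: "symmetric_norm (N :: complex^'n^'n \<Rightarrow> real)" and p: "0 < p"
    and \<Omega>: "is_interval \<Omega>" and f: "doubly_concave_on \<Omega> f" and sub: "{m..M} \<subseteq> \<Omega>"
    and m: "0 \<le> m"
    and E: "unitary E" and U: "unitary U" and V: "unitary V" and q: "anti_dominating N p q"
    and le: "\<And>t i. t \<in> {m..M} \<Longrightarrow> f t \<le> c i * t + d i"
    and a: "\<And>i. a i \<in> {m..M}" and b: "\<And>i. b i \<in> {m..M}"
    and \<alpha>: "0 \<le> \<alpha>" "\<alpha> \<le> 1"
  shows "powr1 (anti0 N p (\<lambda>i. f (a i))) (1 - \<alpha>) * powr1 (anti0 N p (\<lambda>i. f (b i))) \<alpha>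
    \<le> affine_form E q c d (geo_mean \<alpha> (diag_in U a) (diag_in V b))"
proof -
  let ?Z = "geo_mean \<alpha> (diag_in U a) (diag_in V b)"
  have f0: "\<And>t. t \<in> {m..M} \<Longrightarrow> 0 \<le> f t"
    using doubly_concave_nonneg[OF f] sub by blast
  have nn: "0 \<le> a i" "0 \<le> b i" for i
    using a[of i] b[of i] m by auto
  have fA: "anti0 N p (\<lambda>j. f (a j)) \<le> affine_form E q c d (diag_in U a)"
    using anti0_le_affine_form[OF E U q, of m M f c d a] f0 le a by blast
  have fB: "anti0 N p (\<lambda>j. f (b j)) \<le> affine_form E q c d (diag_in V b)"
    using anti0_le_affine_form[OF E V q, of m M f c d b] f0 le b by blast
  have Z0: "0 \<le> affine_form E q c d ?Z"
    by (rule affine_form_nonneg[OF E q f0 le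
          geo_mean_properties(2,3)[where a = a and b = b, OF U V m a b \<alpha>]])
  consider "\<alpha> = 0" | "\<alpha> = 1" | "0 < \<alpha>" "\<alpha> < 1" "\<not> (\<forall>i. f (a i) \<noteq> 0) \<or> \<not> (\<forall>i. f (b i) \<noteq> 0)"
    | "0 < \<alpha>" "\<alpha> < 1" "\<forall>i. f (a i) \<noteq> 0" "\<forall>i. f (b i) \<noteq> 0"
    using \<alpha> unfolding order_le_less by blast
  then show ?thesis
  proof cases
    case 1
    then show ?thesis
      using fA by (simp add: powr1_def geo_mean_0_1[OF U V nn])
  next
    case 2
    then show ?thesis
      using fB by (simp add: powr1_def geo_mean_0_1[OF U V nn])
  next
    case 3
    then have "powr1 (anti0 N p (\<lambda>i. f (a i))) (1 - \<alpha>) * powr1 (anti0 N p (\<lambda>i. f (b i))) \<alpha> = 0"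
      by (auto simp: powr1_def anti0_def)
    then show ?thesis
      using Z0 by linarith
  next
    case 4
    have fp: "0 < f (a i)" "0 < f (b i)" for i
      using 4 f0 a b by (simp_all add: order_less_le)
    have eq: "powr1 (anti0 N p (\<lambda>i. f (a i))) (1 - \<alpha>) * powr1 (anti0 N p (\<lambda>i. f (b i))) \<alpha>
        = anti N p (\<lambda>i. f (a i)) powr (1 - \<alpha>) * anti N p (\<lambda>i. f (b i)) powr \<alpha>"
      using 4 by (simp add: powr1_def anti0_def)
    show ?thesis
    proof (cases "invertible (diag_in U a) \<and> invertible (diag_in V b)")
      case True
      then have "a i \<noteq> 0" "b i \<noteq> 0" for i
        by (simp_all add: invertible_diag_in U V)
      then have "0 < a i" "0 < b i" for i
        using nn by (simp_all add: order_less_le)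
      then show ?thesis
        unfolding eq using True
          anti_le_affine_form_geo_mean_inv[OF N p \<Omega> f sub E U V q le _ a fp(1) _ b fp(2) \<alpha>]
        by (simp add: geo_mean_def)
    next
      case False
      show ?thesis
      proof (cases "0 < M")
        case True
        show ?thesis
          unfolding eq
          by (rule anti_le_affine_form_geo_mean_singular[OF N p \<Omega> f sub m True E U V q le a fp(1) b fp(2) \<alpha> False])
      next
        \<comment> \<open>Both matrices are zero.\<close>
        case M: False
        have ab: "a i = 0" "b i = 0" and m0: "m = 0" "M = 0" for i
          using a[of i] b[of i] m M by auto
        have "x \<bullet> (?Z *v x) = 0" for x
          using geo_mean_properties(2,3)[where a = a and b = b, OF U V m a b \<alpha>, of x] m0 by simp
        moreover have "x \<bullet> (diag_in U a *v x) = 0" for x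
          by (simp add: inner_diag_in ab)
        ultimately have "affine_form E q c d ?Z = affine_form E q c d (diag_in U a)"
          by (simp add: affine_form_def)
        moreover have "anti0 N p (\<lambda>j. f (a j)) = anti N p (\<lambda>j. f (a j))"
          using 4 by (simp add: anti0_def)
        moreover have "anti N p (\<lambda>i. f (a i)) powr (1 - \<alpha>) * anti N p (\<lambda>i. f (b i)) powr \<alpha> = anti N p (\<lambda>i. f (a i))"
          by (simp add: ab powr_add[symmetric])
        ultimately show ?thesis
          unfolding eq using fA by simp
      qed
    qed
  qed
qed

section \<open>Integration over the geodesic\<close>

text \<open>At an end point of the interval a concave function can have infinite slope, so a supporting
  line need not exist there. Up to \<open>\<delta>\<close> there is one: separate the closed convex hypograph from
  the point at height \<open>f r + \<delta>\<close>.\<close>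

lemma concave_affine_majorant:
  fixes f :: "real \<Rightarrow> real"
  assumes f: "concave_on {m..M} f" "continuous_on {m..M} f" and r: "r \<in> {m..M}" and \<delta>: "0 < \<delta>"
  shows "\<exists>c d. (\<forall>t\<in>{m..M}. f t \<le> c * t + d) \<and> c * r + d \<le> f r + \<delta>"
proof -
  define H where "H = {z \<in> {m..M} \<times> UNIV. snd z \<le> f (fst z)}"
  have "convex H"
  proof (rule convexI)
    fix z z' :: "real \<times> real" and u v :: real
    assume z: "z \<in> H" "z' \<in> H" and uv: "0 \<le> u" "0 \<le> v" "u + v = 1"
    have mem: "fst z \<in> {m..M}" "fst z' \<in> {m..M}" and le: "snd z \<le> f (fst z)" "snd z' \<le> f (fst z')"
      using z by (auto simp: H_def)
    have "u * snd z + v * snd z' \<le> u * f (fst z) + v * f (fst z')"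
      using le uv by (intro add_mono mult_left_mono) auto
    also have "\<dots> \<le> f (u *\<^sub>R fst z + v *\<^sub>R fst z')"
      using f(1) mem uv unfolding concave_on_iff by blast
    finally have "u * snd z + v * snd z' \<le> f (u *\<^sub>R fst z + v *\<^sub>R fst z')" .
    moreover have "u *\<^sub>R fst z + v *\<^sub>R fst z' \<in> {m..M}"
      using mem uv by (intro convexD[OF convex_real_interval(5)])
    ultimately show "u *\<^sub>R z + v *\<^sub>R z' \<in> H"
      by (simp add: H_def mem_Times_iff)
  qed
  moreover have "closed H"
    unfolding H_def
  proof (rule continuous_on_closed_Collect_le)
    show "continuous_on ({m..M} \<times> UNIV) (\<lambda>z. f (fst z))"
      by (rule continuous_on_compose2[OF f(2) continuous_on_fst[OF continuous_on_id]]) auto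
    show "continuous_on ({m..M} \<times> UNIV) (snd :: real \<times> real \<Rightarrow> real)"
      by (rule continuous_on_snd[OF continuous_on_id])
  qed (intro closed_Times closed_atLeastAtMost closed_UNIV)
  moreover have "(r, f r + \<delta>) \<notin> H"
    using \<delta> by (simp add: H_def)
  ultimately obtain a b where ab: "inner a (r, f r + \<delta>) < b" "\<And>z. z \<in> H \<Longrightarrow> b < inner a z"
    using separating_hyperplane_closed_point[of H "(r, f r + \<delta>)"] by blast
  obtain a1 a2 where a: "a = (a1, a2)"
    by (cases a)
  have above: "b < a1 * x + a2 * f x" if "x \<in> {m..M}" for x
    using ab(2)[of "(x, f x)"] that by (simp add: H_def a)
  have below: "a1 * r + a2 * (f r + \<delta>) < b"
    using ab(1) by (simp add: a)
  have "a2 * \<delta> < 0"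
    using above[OF r] below by (simp add: algebra_simps)
  then have a2: "a2 < 0"
    using \<delta> by (simp add: mult_less_0_iff)
  show ?thesis
  proof (intro exI conjI ballI)
    show "f t \<le> (- a1 / a2) * t + b / a2" if "t \<in> {m..M}" for t
    proof -
      have "f t \<le> (b - a1 * t) / a2"
        using above[OF that] a2 by (simp add: neg_le_divide_eq mult.commute)
      then show ?thesis
        by (simp add: diff_divide_distrib)
    qed
    have "(b - a1 * r) / a2 \<le> f r + \<delta>"
      using below a2 by (simp add: neg_divide_le_eq mult.commute)
    then show "(- a1 / a2) * r + b / a2 \<le> f r + \<delta>"
      by (simp add: diff_divide_distrib)
  qed
qed

lemma symmetric_norm_single_entry_le:
  assumes N: "symmetric_norm N"
  shows "N (real_diag (\<lambda>i. if i = k then t k else 0)) \<le> N (real_diag t)"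
proof -
  define s where "s i = (if i = k then 1 else -1 :: real)" for i
  have s: "unitary (real_diag s)" "unitary (real_diag (\<lambda>_. 1))"
    by (rule unitary_signs, simp add: s_def)+
  have "N (real_diag (\<lambda>i. s i * t i)) = N (real_diag t)"
    using symmetric_normD(5)[OF N s, of "real_diag t"] by (simp add: real_diag_mult)
  moreover have "real_diag (\<lambda>i. if i = k then t k else 0) = real_diag (\<lambda>i. 1/2 * (t i + s i * t i))"
    by (rule arg_cong[of _ _ real_diag]) (auto simp: s_def)
  ultimately show ?thesis
    using symmetric_norm_real_diag_add[OF N, of t "\<lambda>i. s i * t i"]
      symmetric_norm_real_diag_scale[OF N, of "1/2" "\<lambda>i. t i + s i * t i"] by simp
qed

text \<open>The case of a vanishing \<open>h k\<close> is the reason for perturbing: there the anti-norm of the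
  perturbation is at most a constant times \<open>\<delta>\<close>.\<close>

lemma le_anti0_if_le_anti_perturbed:
  fixes h :: "'n::finite \<Rightarrow> real"
  assumes N: "symmetric_norm (N :: complex^'n^'n \<Rightarrow> real)" and p: "0 < p" and h: "\<And>i. 0 \<le> h i"
    and R: "\<And>\<delta>. 0 < \<delta> \<Longrightarrow> R \<le> anti N p (\<lambda>i. h i + \<delta>)"
  shows "R \<le> anti0 N p h"
proof (cases "\<forall>i. h i \<noteq> 0")
  case True
  then have hp: "0 < h i" for i
    using h[of i] by (simp add: order_less_le)
  define l where "l = Min (range h)"
  have l: "0 < l" "l \<le> h i" for i
    using hp by (simp_all add: l_def)
  have "R \<le> (1 + \<delta> / l) * anti N p h" if \<delta>: "0 < \<delta>" for \<delta>
  proof -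
    have "R \<le> anti N p (\<lambda>i. h i + \<delta>)"
      by (rule R[OF \<delta>])
    also have "\<dots> \<le> anti N p (\<lambda>i. (1 + \<delta> / l) * h i)"
    proof (rule anti_mono[OF N p])
      show "0 < h i + \<delta>" for i
        using hp[of i] \<delta> by simp
      show "h i + \<delta> \<le> (1 + \<delta> / l) * h i" for i
        using l(1) mult_left_mono[OF l(2)[of i], of \<delta>] \<delta> by (simp add: field_simps)
    qed
    also have "\<dots> = (1 + \<delta> / l) * anti N p h"
      using l(1) \<delta> by (intro anti_scale[OF N p _ hp]) (simp add: add_pos_pos)
    finally show ?thesis .
  qed
  then have "\<forall>\<^sub>F \<delta> in at_right 0. R \<le> (1 + \<delta> / l) * anti N p h"
    using eventually_at_right_less[of "0::real"] by (auto elim: eventually_mono)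
  moreover have "((\<lambda>\<delta>. (1 + \<delta> / l) * anti N p h) \<longlongrightarrow> (1 + 0 / l) * anti N p h) (at_right 0)"
    using l(1) by (intro tendsto_intros) auto
  ultimately have "R \<le> (1 + 0 / l) * anti N p h"
    by (intro tendsto_lowerbound[OF _ _ trivial_limit_at_right_real]) auto
  then show ?thesis
    using True by (simp add: anti0_def)
next
  case False
  then obtain k where k: "h k = 0"
    by blast
  define \<kappa> where "\<kappa> = N (real_diag (\<lambda>i. if i = k then 1 else 0))"
  have \<kappa>: "0 < \<kappa>"
    using symmetric_norm_real_diag_pos[OF N, of "\<lambda>i. if i = k then 1 else 0" k] by (simp add: \<kappa>_def)
  have "R \<le> \<kappa> powr (-1/p) * \<delta>" if \<delta>: "0 < \<delta>" for \<delta>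
  proof -
    have "\<kappa> * \<delta> powr (-p) = N (real_diag (\<lambda>i. \<delta> powr (-p) * (if i = k then 1 else 0)))"
      by (simp only: symmetric_norm_real_diag_scale[OF N]) (simp add: \<kappa>_def)
    also have "\<dots> = N (real_diag (\<lambda>i. if i = k then (h k + \<delta>) powr (-p) else 0))"
      by (rule arg_cong[of _ _ "\<lambda>t. N (real_diag t)"]) (auto simp: k)
    also have "\<dots> \<le> N (real_diag (\<lambda>i. (h i + \<delta>) powr (-p)))"
      using symmetric_norm_single_entry_le[OF N, of k "\<lambda>i. (h i + \<delta>) powr (-p)"] by simp
    finally have "anti N p (\<lambda>i. h i + \<delta>) \<le> (\<kappa> * \<delta> powr (-p)) powr (-1/p)"
      unfolding anti_def using \<kappa> \<delta> p by (intro powr_mono2') auto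
    also have "\<dots> = \<kappa> powr (-1/p) * \<delta>"
      using \<kappa> \<delta> p by (simp add: powr_mult powr_powr)
    finally show ?thesis
      using R[OF \<delta>] by simp
  qed
  then have "\<forall>\<^sub>F \<delta> in at_right 0. R \<le> \<kappa> powr (-1/p) * \<delta>"
    using eventually_at_right_less[of "0::real"] by (auto elim: eventually_mono)
  moreover have "((\<lambda>\<delta>. \<kappa> powr (-1/p) * \<delta>) \<longlongrightarrow> \<kappa> powr (-1/p) * 0) (at_right 0)"
    by (intro tendsto_intros)
  ultimately have "R \<le> \<kappa> powr (-1/p) * 0"
    by (intro tendsto_lowerbound[OF _ _ trivial_limit_at_right_real]) auto
  then show ?thesis
    by (simp only: anti0_def if_not_P[OF False] mult_zero_right)
qed

text \<open>A crude bound, for integrability only.\<close>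

lemma hermitian_norm_bound:
  fixes T :: "complex^'n^'n"
  assumes T: "hermitian T" and bound: "\<And>x. 0 \<le> x \<bullet> (T *v x)" "\<And>x. x \<bullet> (T *v x) \<le> M * (norm x)\<^sup>2"
    and M: "0 \<le> M"
  shows "norm T \<le> (\<Sum>i\<in>(UNIV :: 'n set). \<Sum>j\<in>(UNIV :: 'n set). 6 * M)"
proof -
  have form: "\<bar>x \<bullet> (T *v y)\<bar> \<le> 3 * M" if xy: "norm x = 1" "norm y = 1" for x y
  proof -
    have "(norm (x + y))\<^sup>2 \<le> 2\<^sup>2"
      using norm_triangle_ineq[of x y] xy by (intro power_mono) auto
    then have "M * (norm (x + y))\<^sup>2 \<le> M * 4"
      using M by (intro mult_left_mono) auto
    then have "(x + y) \<bullet> (T *v (x + y)) \<le> 4 * M"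
      using bound(2)[of "x + y"] by simp
    then show ?thesis
      using bound(1)[of "x + y"] bound(1)[of x] bound(1)[of y] bound(2)[of x] bound(2)[of y] xy M
      unfolding hermitian_polarization[OF T, of x y] by simp
  qed
  have entry: "cmod (T $ i $ j) \<le> 6 * M" for i j
  proof -
    have "cmod (T $ i $ j) \<le> \<bar>Re (T $ i $ j)\<bar> + \<bar>Im (T $ i $ j)\<bar>"
      by (rule cmod_le)
    also have "\<dots> = \<bar>axis i 1 \<bullet> (T *v axis j 1)\<bar> + \<bar>axis i \<i> \<bullet> (T *v axis j 1)\<bar>"
      by (subst (1 2) matrix_entry_inner) simp
    also have "\<dots> \<le> 3 * M + 3 * M"
      by (intro add_mono form) (simp_all add: norm_eq_1 inner_axis_axis)
    finally show ?thesis
      by simp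
  qed
  have "norm T \<le> (\<Sum>i\<in>UNIV. norm (T $ i))"
    unfolding norm_vec_def by (rule L2_set_le_sum) simp
  also have "\<dots> \<le> (\<Sum>i\<in>UNIV. \<Sum>j\<in>UNIV. cmod (T $ i $ j))"
    unfolding norm_vec_def by (intro sum_mono L2_set_le_sum) simp
  also have "\<dots> \<le> (\<Sum>i\<in>(UNIV :: 'n set). \<Sum>j\<in>(UNIV :: 'n set). 6 * M)"
    by (intro sum_mono entry)
  finally show ?thesis .
qed

lemma geo_mean_inv_measurable:
  assumes "pos_def A" "pos_def B"
  shows "(\<lambda>\<alpha>. geo_mean_inv \<alpha> A B) \<in> borel_measurable borel"
proof -
  obtain S d where S: "\<forall>i. 0 < d i" "\<forall>\<alpha>. geo_mean_inv \<alpha> A B = diag_in S (\<lambda>i. d i powr \<alpha>)"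
    using geo_mean_inv_congruence[OF assms] by blast
  have "geo_mean_inv \<alpha> A B
      = (\<chi> i j. \<Sum>k\<in>UNIV. S $ i $ k * complex_of_real (d k powr \<alpha>) * cnj (S $ j $ k))" for \<alpha>
    unfolding S(2)[rule_format] diag_in_def
    by (subst matrix_matrix_mult_def) (simp add: real_diag_mult_nth)
  moreover have "continuous_on UNIV
      (\<lambda>\<alpha>. \<chi> i j. \<Sum>k\<in>UNIV. S $ i $ k * complex_of_real (d k powr \<alpha>) * cnj (S $ j $ k))"
    using S(1) by (intro continuous_intros) (auto simp: less_imp_neq[symmetric])
  ultimately show ?thesis
    by (simp add: borel_measurable_continuous_onI)
qed

lemma prob_on_unit_space:
  assumes "prob_on_unit \<nu>"
  shows "space \<nu> = {0..1}"
proof -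
  have "space \<nu> = space (restrict_space borel {0..1::real})"
    using assms by (intro sets_eq_imp_space_eq) (simp add: prob_on_unit_def)
  then show ?thesis
    by (simp add: space_restrict_space)
qed

lemma borel_measurable_prob_on_unit:
  assumes "prob_on_unit \<nu>" "g \<in> borel_measurable borel"
  shows "g \<in> borel_measurable \<nu>"
  using measurable_restrict_space1[OF assms(2), of "{0..1}"] assms(1)
  by (simp add: prob_on_unit_def cong: measurable_cong_sets)

lemma geo_mean_measurable:
  fixes U V :: "complex^'n^'n"
  assumes \<nu>: "prob_on_unit \<nu>" and U: "unitary U" and V: "unitary V"
    and a: "\<And>i. 0 \<le> a i" and b: "\<And>i. 0 \<le> b i"
  shows "(\<lambda>\<alpha>. geo_mean \<alpha> (diag_in U a) (diag_in V b)) \<in> borel_measurable \<nu>"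
proof (cases "invertible (diag_in U a) \<and> invertible (diag_in V b)")
  case True
  then have "a i \<noteq> 0" "b i \<noteq> 0" for i
    by (simp_all add: invertible_diag_in U V)
  then have "pos_def (diag_in U a)" "pos_def (diag_in V b)"
    using a b by (simp_all add: pos_def_diag_in_iff U V order_less_le)
  then show ?thesis
    using True borel_measurable_prob_on_unit[OF \<nu> geo_mean_inv_measurable] by (simp add: geo_mean_def)
next
  case False
  define e where "e n = inverse (real (Suc n))" for n
  have e: "filterlim e (at_right 0) sequentially"
  proof -
    have "e \<longlonglongrightarrow> 0"
      unfolding e_def[abs_def] by (rule LIMSEQ_inverse_real_of_nat)
    moreover have "0 < e n" for n
      by (simp add: e_def)
    ultimately show ?thesis
      unfolding filterlim_at by (simp add: less_imp_neq[symmetric])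
  qed
  show ?thesis
  proof (rule borel_measurable_LIMSEQ_metric)
    fix n
    have "pos_def (diag_in U (\<lambda>i. a i + e n))" "pos_def (diag_in V (\<lambda>i. b i + e n))"
      using a b by (simp_all add: pos_def_diag_in_iff U V add_nonneg_pos e_def)
    then show "(\<lambda>\<alpha>. geo_mean_inv \<alpha> (diag_in U (\<lambda>i. a i + e n)) (diag_in V (\<lambda>i. b i + e n))) \<in> borel_measurable \<nu>"
      by (intro borel_measurable_prob_on_unit[OF \<nu> geo_mean_inv_measurable])
  next
    fix \<alpha>
    assume "\<alpha> \<in> space \<nu>"
    then have \<alpha>: "0 \<le> \<alpha>" "\<alpha> \<le> 1"
      by (simp_all add: prob_on_unit_space[OF \<nu>])
    show "(\<lambda>n. geo_mean_inv \<alpha> (diag_in U (\<lambda>i. a i + e n)) (diag_in V (\<lambda>i. b i + e n)))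
        \<longlonglongrightarrow> geo_mean \<alpha> (diag_in U a) (diag_in V b)"
      by (rule filterlim_compose[OF geo_mean_tendsto[OF U V a b \<alpha> False] e])
  qed
qed

lemma geo_mean_integrable:
  fixes U V :: "complex^'n^'n"
  assumes \<nu>: "prob_on_unit \<nu>" and U: "unitary U" and V: "unitary V"
    and m: "0 \<le> m" and a: "\<And>i. a i \<in> {m..M}" and b: "\<And>i. b i \<in> {m..M}"
  shows "integrable \<nu> (\<lambda>\<alpha>. geo_mean \<alpha> (diag_in U a) (diag_in V b))"
proof -
  interpret prob_space \<nu>
    using \<nu> by (simp add: prob_on_unit_def)
  have nn: "0 \<le> a i" "0 \<le> b i" "0 \<le> M" for i
    using a[of i] b[of i] m by auto
  have "norm (geo_mean \<alpha> (diag_in U a) (diag_in V b)) \<le> (\<Sum>i\<in>(UNIV :: 'n set). \<Sum>j\<in>(UNIV :: 'n set). 6 * M)"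
    if "\<alpha> \<in> space \<nu>" for \<alpha>
  proof -
    have \<alpha>: "0 \<le> \<alpha>" "\<alpha> \<le> 1"
      using that by (simp_all add: prob_on_unit_space[OF \<nu>])
    note bounds = geo_mean_properties[where a = a and b = b, OF U V m a b \<alpha>]
    have "0 \<le> x \<bullet> (geo_mean \<alpha> (diag_in U a) (diag_in V b) *v x)" for x
      using bounds(2)[of x] m by (meson mult_nonneg_nonneg order_trans zero_le_power2)
    then show ?thesis
      by (intro hermitian_norm_bound bounds nn)
  qed
  then show ?thesis
    by (intro integrable_const_bound geo_mean_measurable[OF \<nu> U V nn(1,2)]) auto
qed

lemma derived_anti_norm_diag_in:
  assumes F: "\<And>A. A \<in> psd \<Longrightarrow> F A = (if invertible A then N (mat_powr A (-p)) powr (-1/p) else 0)"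
    and N: "symmetric_norm N" and U: "unitary U" and h: "\<And>i. 0 \<le> h i"
  shows "F (diag_in U h) = anti0 N p h"
proof -
  have "diag_in U h \<in> psd"
    using h by (auto simp: psd_def herm_on_def diag_in_hermitian spectrum_diag_in[OF U])
  then show ?thesis
    using F[of "diag_in U h"]
    by (simp add: anti0_def anti_def invertible_diag_in[OF U] mat_powr_diag_in[OF U]
        symmetric_norm_diag_in[OF N U])
qed

lemma herm_on_diagonalisation:
  assumes "A \<in> herm_on \<Omega>"
  obtains U a where "unitary U" "A = diag_in U a" "\<And>i. a i \<in> \<Omega>"
proof -
  have "hermitian A"
    using assms by (simp add: herm_on_def)
  then obtain U a where U: "unitary U" "A = diag_in U a"
    by (rule hermitian_diagonalisation)
  have "complex_of_real ` range a \<subseteq> complex_of_real ` \<Omega>"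
    using assms U by (simp add: herm_on_def spectrum_diag_in)
  then have "complex_of_real (a i) \<in> complex_of_real ` \<Omega>" for i
    by blast
  then have "a i \<in> \<Omega>" for i
    by (metis imageE of_real_eq_iff)
  then show ?thesis
    by (rule that[OF U])
qed

theorem theorem4p7:
  fixes f :: "real \<Rightarrow> real" and \<Omega> :: "real set"
    and A B :: "complex^'n^'n" and F :: "complex^'n^'n \<Rightarrow> real" and \<nu> :: "real measure"
  assumes "is_interval \<Omega>" and "\<Omega> \<subseteq> {0..}"
    and "doubly_concave_on \<Omega> f"
    and "A \<in> herm_on \<Omega>" and "B \<in> herm_on \<Omega>"
    and "derived_anti_norm F"
    and "prob_on_unit \<nu>"
  shows "F (mat_fun f (geodesic_mean \<nu> A B))
           \<ge> scalar_geodesic_mean \<nu> (F (mat_fun f A)) (F (mat_fun f B))"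
proof -
  note \<Omega> = assms(1) and f = assms(3) and \<nu> = assms(7)
  interpret prob_space \<nu>
    using \<nu> by (simp add: prob_on_unit_def)
  obtain N p where N: "symmetric_norm N" and p: "0 < p"
    and F: "\<And>A. A \<in> psd \<Longrightarrow> F A = (if invertible A then N (mat_powr A (-p)) powr (-1/p) else 0)"
    using assms(6) unfolding derived_anti_norm_def by blast
  obtain U a where U: "unitary U" and A: "A = diag_in U a" and a\<Omega>: "\<And>i. a i \<in> \<Omega>"
    using herm_on_diagonalisation[OF assms(4)] by blast
  obtain V b where V: "unitary V" and B: "B = diag_in V b" and b\<Omega>: "\<And>i. b i \<in> \<Omega>"
    using herm_on_diagonalisation[OF assms(5)] by blast
  \<comment> \<open>A compact interval in \<open>\<Omega>\<close> that contains both spectra.\<close>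
  define m where "m = Min (range a \<union> range b)"
  define M where "M = Max (range a \<union> range b)"
  have a: "a i \<in> {m..M}" and b: "b i \<in> {m..M}" for i
    by (auto simp: m_def M_def)
  have "m \<in> range a \<union> range b" "M \<in> range a \<union> range b"
    unfolding m_def M_def by (intro Min_in Max_in; simp)+
  then have mM: "m \<in> \<Omega>" "M \<in> \<Omega>"
    using a\<Omega> b\<Omega> by auto
  have sub: "{m..M} \<subseteq> \<Omega>"
  proof
    fix t
    assume "t \<in> {m..M}"
    then have "m \<le> t \<and> t \<le> M"
      by simp
    then show "t \<in> \<Omega>"
      using \<Omega> mM unfolding is_interval_1 by blast
  qed
  have m: "0 \<le> m"
    using mM assms(2) by auto
  have f0: "0 \<le> f t" if "t \<in> {m..M}" for t
    using doubly_concave_nonneg[OF f] sub that by blast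
  define Z where "Z \<alpha> = geo_mean \<alpha> A B" for \<alpha>
  have Z: "hermitian (Z \<alpha>)" "m * (norm x)\<^sup>2 \<le> x \<bullet> (Z \<alpha> *v x)" "x \<bullet> (Z \<alpha> *v x) \<le> M * (norm x)\<^sup>2"
    if "\<alpha> \<in> space \<nu>" for \<alpha> x
    using geo_mean_properties[where a = a and b = b, OF U V m a b] that
    by (simp_all add: Z_def A B prob_on_unit_space[OF \<nu>])
  have int: "integrable \<nu> Z"
    unfolding Z_def[abs_def] A B by (rule geo_mean_integrable[OF \<nu> U V m a b])
  define X where "X = geodesic_mean \<nu> A B"
  have X: "X = (\<integral>\<alpha>. Z \<alpha> \<partial>\<nu>)"
    by (simp add: X_def geodesic_mean_def Z_def)
  have form: "(\<integral>\<alpha>. x \<bullet> (Z \<alpha> *v y) \<partial>\<nu>) = x \<bullet> (X *v y)" for x y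
    unfolding X by (rule integral_bounded_linear[OF bounded_linear_inner_form int])
  have form_int: "integrable \<nu> (\<lambda>\<alpha>. x \<bullet> (Z \<alpha> *v y))" for x y
    by (rule integrable_bounded_linear[OF bounded_linear_inner_form int])
  have "ctranspose X = (\<integral>\<alpha>. ctranspose (Z \<alpha>) \<partial>\<nu>)"
    unfolding X by (rule integral_bounded_linear[OF bounded_linear_ctranspose int, symmetric])
  also have "\<dots> = X"
    unfolding X using Z(1) by (intro Bochner_Integration.integral_cong) (auto simp: hermitian_def)
  finally have "hermitian X"
    by (simp add: hermitian_def)
  then obtain E x where E: "unitary E" and X_eq: "X = diag_in E x"
    by (rule hermitian_diagonalisation)
  define v where "v i = E *v axis i 1" for i
  have v: "norm (v i) = 1" for i
    by (simp add: v_def unitary_column_norm[OF E])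
  have xv: "x i = (\<integral>\<alpha>. v i \<bullet> (Z \<alpha> *v v i) \<partial>\<nu>)" for i
    unfolding form by (simp add: v_def X_eq inner_diag_in_eigenvector[OF E])
  have x: "x i \<in> {m..M}" for i
  proof -
    have "(\<integral>\<alpha>. m \<partial>\<nu>) \<le> x i" "x i \<le> (\<integral>\<alpha>. M \<partial>\<nu>)"
      unfolding xv using Z(2)[of _ "v i"] Z(3)[of _ "v i"] v[of i]
      by (intro integral_mono form_int; simp)+
    then show ?thesis
      by (simp add: prob_space)
  qed
  have FA: "F (mat_fun f A) = anti0 N p (\<lambda>i. f (a i))"
    unfolding A mat_fun_diag_in[OF U] by (rule derived_anti_norm_diag_in[OF F N U f0[OF a]])
  have FB: "F (mat_fun f B) = anti0 N p (\<lambda>i. f (b i))"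
    unfolding B mat_fun_diag_in[OF V] by (rule derived_anti_norm_diag_in[OF F N V f0[OF b]])
  have FX: "F (mat_fun f X) = anti0 N p (\<lambda>i. f (x i))"
    unfolding X_eq mat_fun_diag_in[OF E] by (rule derived_anti_norm_diag_in[OF F N E f0[OF x]])
  define R where "R = scalar_geodesic_mean \<nu> (F (mat_fun f A)) (F (mat_fun f B))"
  have fm: "concave_on {m..M} f" "continuous_on {m..M} f"
    using f sub unfolding doubly_concave_on_def
    by (auto simp: concave_on_def intro: convex_on_subset continuous_on_subset)
  \<comment> \<open>All inequalities are linearised at the eigenvalues \<open>x\<close> of the integrated mean, so that the
    integral can be taken inside.\<close>
  have "R \<le> anti N p (\<lambda>i. f (x i) + \<delta>)" if \<delta>: "0 < \<delta>" for \<delta>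
  proof -
    have u: "0 < f (x i) + \<delta>" for i
      using f0[OF x, of i] \<delta> by simp
    obtain q where dom: "anti_dominating N p q"
      and q: "(\<Sum>i\<in>UNIV. q i * (f (x i) + \<delta>)) = anti N p (\<lambda>i. f (x i) + \<delta>)"
      using anti_supergradient[where u = "\<lambda>i. f (x i) + \<delta>", OF N p u] by blast
    have q0: "0 \<le> q i" for i
      using dom by (simp add: anti_dominating_def)
    obtain c d where cd: "\<And>t i. t \<in> {m..M} \<Longrightarrow> f t \<le> c i * t + d i" "\<And>i. c i * x i + d i \<le> f (x i) + \<delta>"
      using concave_affine_majorant[OF fm x \<delta>] by metis
    have "R \<le> (\<integral>\<alpha>. affine_form E q c d (Z \<alpha>) \<partial>\<nu>)"
      unfolding R_def scalar_geodesic_mean_def FA FB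
    proof (rule integral_mono')
      show "integrable \<nu> (\<lambda>\<alpha>. affine_form E q c d (Z \<alpha>))"
        unfolding affine_form_def
        by (intro Bochner_Integration.integrable_sum integrable_mult_right Bochner_Integration.integrable_add
            form_int integrable_const)
      fix \<alpha>
      assume \<alpha>: "\<alpha> \<in> space \<nu>"
      then have \<alpha>01: "0 \<le> \<alpha>" "\<alpha> \<le> 1"
        by (simp_all add: prob_on_unit_space[OF \<nu>])
      show "powr1 (anti0 N p (\<lambda>i. f (a i))) (1 - \<alpha>) * powr1 (anti0 N p (\<lambda>i. f (b i))) \<alpha>
          \<le> affine_form E q c d (Z \<alpha>)"
        unfolding Z_def A B by (rule pointwise_bound[OF N p \<Omega> f sub m E U V dom cd(1) a b \<alpha>01])
      show "0 \<le> affine_form E q c d (Z \<alpha>)"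
        by (rule affine_form_nonneg[OF E dom f0 cd(1) Z(2,3)[OF \<alpha>]])
    qed
    also have "\<dots> = (\<Sum>i\<in>UNIV. q i * (c i * x i + d i))"
      unfolding affine_form_def v_def[symmetric] xv
      by (simp add: Bochner_Integration.integral_sum form_int prob_space)
    also have "\<dots> \<le> (\<Sum>i\<in>UNIV. q i * (f (x i) + \<delta>))"
      by (intro sum_mono mult_left_mono cd(2) q0)
    finally show ?thesis
      by (simp add: q)
  qed
  then have "R \<le> anti0 N p (\<lambda>i. f (x i))"
    by (rule le_anti0_if_le_anti_perturbed[OF N p f0[OF x]])
  then show ?thesis
    by (simp add: R_def FX X_def[symmetric])
qed

end
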